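(* Let $r\ge 4$. Then there exist a dimension vector $(x,y)\in\mathcal F_r$ and infinitely many pairwise non-isomorphic elementary representations of $K_r$, all with dimension vector $(x,y)$, which all lie in different $\mathrm{GL}(A_r)$-orbits (i.e. their isomorphism classes lie in pairwise distinct $\mathrm{GL}(A_r)$-orbits).
   Context: Let $\Bbbk$ be an algebraically closed field of arbitrary characteristic; $\mathbb N=\{1,2,\dots\}$. $K_r$ is the generalized Kronecker quiver with vertices $1,2$ and $r$ arrows $\gamma_1,\dots,\gamma_r\colon 1\to 2$. A representation $M$ consists of finite-dimensional $\Bbbk$-vector spaces $M_1,M_2$ and linear maps $M(\gamma_i)\colon M_1\to M_2$, $1\le i\le r$; its dimension vector is $(\dim M_1,\dim M_2)$. An indecomposable representation is preprojective (resp. preinjective) if $\tau^n M=0$ (resp. $\tau^{-n}M=0$) for some $n\in\mathbb N$, where $\tau$ is the Auslander-Reiten translation; every other indecomposable representation is called regular. An arbitrary representation is regular if all its indecomposable direct summands are regular (the zero representation is regular). A non-zero regular representation $E$ is called elementary if there is no short exact sequence $0\to A\to E\to B\to 0$ with $A,B$ regular and non-zero. $\mathcal F_r=\{(x,y)\in\mathbb N^2 \mid \frac{2}{r}x\le y\le x\}$. $A_r=\bigoplus_{i=1}^r\Bbbk\gamma_i$ is the arrow space. $\mathrm{GL}(A_r)$ acts on representations as follows: for $g\in\mathrm{GL}(A_r)$ write $g^{-1}(\gamma_i)=\sum_{j=1}^r\lambda_{ij}\gamma_j$; then $M^{(g)}=(M_1,M_2,(\sum_{j}\lambda_{ij}M(\gamma_j))_{1\le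 i\le r})$. This induces an action on isomorphism classes by $[M]^{(g)}=[M^{(g)}]$. *)

theory Defs
  imports
    "Jordan_Normal_Form.Matrix_Kernel"
    "HOL-Computational_Algebra.Polynomial"
begin

text \<open>
  Representations of the \<open>r\<close>-Kronecker quiver with the spaces at the two vertices identified
  with \<open>k^dim1\<close> and \<open>k^dim2\<close>. The map attached to the \<open>i\<close>-th arrow is \<open>arr M i\<close>, where arrows are
  numbered \<open>0, ..., r - 1\<close>; the values \<open>arr M i\<close> for \<open>i \<ge> r\<close> carry no information.
\<close>

record 'k kron_rep =
  dim1 :: nat
  dim2 :: nat
  arr :: "nat \<Rightarrow> 'k mat"

definition is_rep :: "nat \<Rightarrow> 'k::field kron_rep \<Rightarrow> bool" where
  "is_rep r M \<longleftrightarrow> (\<forall>i<r. arr M i \<in> carrier_mat (dim2 M) (dim1 M))"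

definition dim_vector :: "'k kron_rep \<Rightarrow> nat \<times> nat" where
  "dim_vector M = (dim1 M, dim2 M)"

definition zero_rep :: "'k kron_rep \<Rightarrow> bool" where
  "zero_rep M \<longleftrightarrow> dim1 M = 0 \<and> dim2 M = 0"

definition rep_sum :: "'k::field kron_rep \<Rightarrow> 'k kron_rep \<Rightarrow> 'k kron_rep" where
  "rep_sum M N = \<lparr>dim1 = dim1 M + dim1 N, dim2 = dim2 M + dim2 N,
     arr = (\<lambda>i. four_block_mat (arr M i) (0\<^sub>m (dim2 M) (dim1 N))
                              (0\<^sub>m (dim2 N) (dim1 M)) (arr N i))\<rparr>"


subsection \<open>Homomorphisms and exactness\<close>

type_synonym 'k rep_map = "'k mat \<times> 'k mat"

definition rep_hom :: "nat \<Rightarrow> 'k::field kron_rep \<Rightarrow> 'k kron_rep \<Rightarrow> 'k rep_map \<Rightarrow> bool" where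
  "rep_hom r M N f \<longleftrightarrow>
     fst f \<in> carrier_mat (dim1 N) (dim1 M) \<and> snd f \<in> carrier_mat (dim2 N) (dim2 M) \<and>
     (\<forall>i<r. snd f * arr M i = arr N i * fst f)"

definition rep_iso :: "nat \<Rightarrow> 'k::field kron_rep \<Rightarrow> 'k kron_rep \<Rightarrow> bool" where
  "rep_iso r M N \<longleftrightarrow> is_rep r M \<and> is_rep r N \<and>
     (\<exists>f. rep_hom r M N f \<and> invertible_mat (fst f) \<and> invertible_mat (snd f))"

definition mat_inj :: "'k::field mat \<Rightarrow> bool" where
  "mat_inj A \<longleftrightarrow> inj_on (\<lambda>v. A *\<^sub>v v) (carrier_vec (dim_col A))"

definition mat_range :: "'k::field mat \<Rightarrow> 'k vec set" where
  "mat_range A = (\<lambda>v. A *\<^sub>v v) ` carrier_vec (dim_col A)"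

text \<open>\<open>0 \<rightarrow> L \<rightarrow> M \<rightarrow> N\<close> is exact.\<close>
definition left_exact ::
  "nat \<Rightarrow> 'k::field kron_rep \<Rightarrow> 'k rep_map \<Rightarrow> 'k kron_rep \<Rightarrow> 'k rep_map \<Rightarrow> 'k kron_rep \<Rightarrow> bool" where
  "left_exact r L f M g N \<longleftrightarrow>
     rep_hom r L M f \<and> rep_hom r M N g \<and>
     mat_inj (fst f) \<and> mat_inj (snd f) \<and>
     mat_range (fst f) = mat_kernel (fst g) \<and> mat_range (snd f) = mat_kernel (snd g)"

text \<open>\<open>0 \<rightarrow> L \<rightarrow> M \<rightarrow> N \<rightarrow> 0\<close> is exact.\<close>
definition short_exact ::
  "nat \<Rightarrow> 'k::field kron_rep \<Rightarrow> 'k rep_map \<Rightarrow> 'k kron_rep \<Rightarrow> 'k rep_map \<Rightarrow> 'k kron_rep \<Rightarrow> bool" where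
  "short_exact r L f M g N \<longleftrightarrow>
     left_exact r L f M g N \<and>
     mat_range (fst g) = carrier_vec (dim1 N) \<and> mat_range (snd g) = carrier_vec (dim2 N)"

definition indecomposable :: "nat \<Rightarrow> 'k::field kron_rep \<Rightarrow> bool" where
  "indecomposable r M \<longleftrightarrow> is_rep r M \<and> \<not> zero_rep M \<and>
     (\<forall>A B. is_rep r A \<and> is_rep r B \<and> rep_iso r M (rep_sum A B) \<longrightarrow> zero_rep A \<or> zero_rep B)"


subsection \<open>The Auslander--Reiten translation\<close>

text \<open>
  The path algebra \<open>\<Lambda>\<close> is hereditary and \<open>\<tau> M = D Tr M = D Ext(M, \<Lambda>)\<close>, with \<open>Ext\<close> in degree 1.
  Hence, for any projective resolution \<open>0 \<rightarrow> P' \<rightarrow> P \<rightarrow> M \<rightarrow> 0\<close>, \<open>\<tau> M\<close> is the kernel of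
  \<open>\<nu> P' \<rightarrow> \<nu> P\<close>, where \<open>\<nu> = D Hom(-, \<Lambda>)\<close> is the Nakayama functor. We use the standard resolution
    \<open>0 \<rightarrow> P(2) \<otimes> A \<otimes> M1 \<rightarrow> (P(1) \<otimes> M1) \<oplus> (P(2) \<otimes> M2) \<rightarrow> M \<rightarrow> 0\<close>
  with \<open>A\<close> the arrow space; its first map is \<open>e2 \<otimes> \<gamma> \<otimes> m \<mapsto> (- \<gamma> \<otimes> m, e2 \<otimes> M(\<gamma>) m)\<close>.
  Since \<open>\<nu> P(i) = I(i)\<close>, with dimension vectors \<open>I(1) = (1, 0)\<close> and \<open>I(2) = (r, 1)\<close>, the functor
  \<open>\<nu>\<close> turns this into a map \<open>I(2)^(r m) \<rightarrow> I(1)^m \<oplus> I(2)^n\<close>, where \<open>(m, n)\<close> is the dimension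
  vector of \<open>M\<close>. Coordinates:
    \<^item> \<open>I(2)^d\<close> is \<open>(k^d)^r\<close> at vertex 1 and \<open>k^d\<close> at vertex 2, the \<open>i\<close>-th arrow being the \<open>i\<close>-th
      projection;
    \<^item> the elements of \<open>A \<otimes> M1 = M1^r\<close> are families \<open>(x_j)\<close>, where \<open>x_j\<close> occupies the positions
      \<open>j m, ..., j m + m - 1\<close>;
    \<^item> in \<open>I(1)^m \<oplus> I(2)^n\<close> the map is \<open>(x_j) \<mapsto> \<Sum>j. M(\<gamma>_j) x_j\<close> at vertex 2, and
      \<open>(x_ij) \<mapsto> (- \<Sum>i. x_ii, (\<Sum>j. M(\<gamma>_j) x_ij)_i)\<close> at vertex 1.
\<close>

definition inj1_power :: "nat \<Rightarrow> 'k::field kron_rep" where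
  "inj1_power d = \<lparr>dim1 = d, dim2 = 0, arr = (\<lambda>i. 0\<^sub>m 0 d)\<rparr>"

definition inj2_power :: "nat \<Rightarrow> nat \<Rightarrow> 'k::field kron_rep" where
  "inj2_power r d = \<lparr>dim1 = r * d, dim2 = d,
     arr = (\<lambda>i. mat d (r * d) (\<lambda>(p, c). if c = i * d + p then 1 else 0))\<rparr>"

definition nak_source :: "nat \<Rightarrow> 'k::field kron_rep \<Rightarrow> 'k kron_rep" where
  "nak_source r M = inj2_power r (r * dim1 M)"

definition nak_target :: "nat \<Rightarrow> 'k::field kron_rep \<Rightarrow> 'k kron_rep" where
  "nak_target r M = rep_sum (inj1_power (dim1 M)) (inj2_power r (dim2 M))"

text \<open>The matrix of \<open>(x_j) \<mapsto> \<Sum>j. M(\<gamma>_j) x_j\<close>.\<close>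
definition arrow_mat :: "nat \<Rightarrow> 'k::field kron_rep \<Rightarrow> 'k mat" where
  "arrow_mat r M = mat (dim2 M) (r * dim1 M)
     (\<lambda>(p, c). arr M (c div dim1 M) $$ (p, c mod dim1 M))"

text \<open>The matrix of \<open>(x_ij) \<mapsto> \<Sum>i. x_ii\<close>, for vectors \<open>x_ij\<close> of length \<open>m\<close>.\<close>
definition trace_mat :: "nat \<Rightarrow> nat \<Rightarrow> 'k::field mat" where
  "trace_mat r m = mat m (r * (r * m))
     (\<lambda>(p, c). if c mod (r * m) = (c div (r * m)) * m + p then 1 else 0)"

text \<open>The block diagonal matrix with \<open>r\<close> blocks \<open>A\<close>.\<close>
definition diag_power :: "nat \<Rightarrow> 'k::field mat \<Rightarrow> 'k mat" where
  "diag_power r A = mat (r * dim_row A) (r * dim_col A)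
     (\<lambda>(p, c). if p div dim_row A = c div dim_col A
        then A $$ (p mod dim_row A, c mod dim_col A) else 0)"

definition nak_map :: "nat \<Rightarrow> 'k::field kron_rep \<Rightarrow> 'k rep_map" where
  "nak_map r M =
     ((- trace_mat r (dim1 M)) @\<^sub>r diag_power r (arrow_mat r M), arrow_mat r M)"

text \<open>\<open>\<tau>\<close> is determined up to isomorphism only: \<open>ar_translate r M N\<close> says that \<open>N \<cong> \<tau> M\<close>.\<close>
definition ar_translate :: "nat \<Rightarrow> 'k::field kron_rep \<Rightarrow> 'k kron_rep \<Rightarrow> bool" where
  "ar_translate r M N \<longleftrightarrow> is_rep r M \<and> is_rep r N \<and>
     (\<exists>f. left_exact r N f (nak_source r M) (nak_map r M) (nak_target r M))"

text \<open>
  The \<open>k\<close>-dual of \<open>M\<close> is a representation of the opposite quiver, which is again the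
  \<open>r\<close>-Kronecker quiver after exchanging the two vertices.
\<close>
definition dual_rep :: "'k kron_rep \<Rightarrow> 'k kron_rep" where
  "dual_rep M = \<lparr>dim1 = dim2 M, dim2 = dim1 M, arr = (\<lambda>i. (arr M i)\<^sup>T)\<rparr>"

text \<open>The inverse translation is \<open>Tr D = D (D Tr) D\<close>; \<open>ar_cotranslate r M N\<close> says that it maps
  \<open>M\<close> to \<open>N\<close> up to isomorphism.\<close>
definition ar_cotranslate :: "nat \<Rightarrow> 'k::field kron_rep \<Rightarrow> 'k kron_rep \<Rightarrow> bool" where
  "ar_cotranslate r M N \<longleftrightarrow> ar_translate r (dual_rep M) (dual_rep N)"

definition preprojective :: "nat \<Rightarrow> 'k::field kron_rep \<Rightarrow> bool" where
  "preprojective r M \<longleftrightarrow> indecomposable r M \<and>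
     (\<exists>n\<ge>1. \<exists>N. (ar_translate r ^^ n) M N \<and> zero_rep N)"

definition preinjective :: "nat \<Rightarrow> 'k::field kron_rep \<Rightarrow> bool" where
  "preinjective r M \<longleftrightarrow> indecomposable r M \<and>
     (\<exists>n\<ge>1. \<exists>N. (ar_cotranslate r ^^ n) M N \<and> zero_rep N)"

definition regular_indecomposable :: "nat \<Rightarrow> 'k::field kron_rep \<Rightarrow> bool" where
  "regular_indecomposable r M \<longleftrightarrow>
     indecomposable r M \<and> \<not> preprojective r M \<and> \<not> preinjective r M"

definition regular :: "nat \<Rightarrow> 'k::field kron_rep \<Rightarrow> bool" where
  "regular r M \<longleftrightarrow> is_rep r M \<and>
     (\<forall>N L. indecomposable r N \<and> is_rep r L \<and> rep_iso r M (rep_sum N L)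
        \<longrightarrow> regular_indecomposable r N)"

definition elementary :: "nat \<Rightarrow> 'k::field kron_rep \<Rightarrow> bool" where
  "elementary r E \<longleftrightarrow> regular r E \<and> \<not> zero_rep E \<and>
     \<not> (\<exists>A B f g. regular r A \<and> regular r B \<and> \<not> zero_rep A \<and> \<not> zero_rep B \<and>
          short_exact r A f E g B)"


subsection \<open>The action of the general linear group of the arrow space\<close>

definition GL :: "nat \<Rightarrow> 'k::field mat set" where
  "GL r = {g \<in> carrier_mat r r. invertible_mat g}"

text \<open>
  Column convention: \<open>g\<close> acts on the arrow space by \<open>g(\<gamma>_i) = \<Sum>j. g $$ (j, i) \<gamma>_j\<close>, so the
  coefficient of \<open>\<gamma>_j\<close> in the preimage of \<open>\<gamma>_i\<close> under \<open>g\<close> is the entry \<open>(j, i)\<close> of the inverse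
  matrix.
\<close>
definition twist :: "nat \<Rightarrow> 'k::field mat \<Rightarrow> 'k kron_rep \<Rightarrow> 'k kron_rep" where
  "twist r g M = \<lparr>dim1 = dim1 M, dim2 = dim2 M,
     arr = (\<lambda>i. mat (dim2 M) (dim1 M)
       (\<lambda>(p, q). \<Sum>j<r. the (mat_inverse g) $$ (j, i) * arr M j $$ (p, q)))\<rparr>"

definition iso_class :: "nat \<Rightarrow> 'k::field kron_rep \<Rightarrow> 'k kron_rep set" where
  "iso_class r M = {N. rep_iso r M N}"

text \<open>The orbit of the isomorphism class of \<open>M\<close>.\<close>
definition GL_orbit :: "nat \<Rightarrow> 'k::field kron_rep \<Rightarrow> 'k kron_rep set set" where
  "GL_orbit r M = {iso_class r (twist r g M) | g. g \<in> GL r}"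

definition \<F> :: "nat \<Rightarrow> (nat \<times> nat) set" where
  "\<F> r = {(x, y). 1 \<le> x \<and> 1 \<le> y \<and> 2 / real r * real x \<le> real y \<and> y \<le> x}"

end

theory Submission
  imports Defs
begin

text \<open>
  For \<open>r \<ge> 5\<close> we use the dimension vector \<open>(3, 3)\<close> and representations in which every non-zero
  vector at vertex 1 generates the whole space at vertex 2. A regular subrepresentation is non-zero
  at vertex 1, hence its factor vanishes at vertex 2 and is not regular. For \<open>q \<noteq> 0, 1\<close> the
  span of the arrows of \<open>hankel_rep q\<close> contains exactly two matrices of rank one up to scalars,
  which forces every equivalence to be monomial; therefore \<open>q\<close> is determined up to inversion.

  For \<open>r = 4\<close> such representations form only finitely many orbits, and we use \<open>(6, 3)\<close>. In
  \<open>pair_rep c\<close> every non-zero vector at vertex 1 generates at least two dimensions at vertex 2, and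
  every non-zero functional at vertex 2 pulls back to four linearly independent functionals. Hence
  for regular non-zero \<open>A\<close> and \<open>B\<close> in an exact sequence \<open>0 \<rightarrow> A \<rightarrow> E \<rightarrow> B \<rightarrow> 0\<close> the space \<open>B\<close> is
  one-dimensional at vertex 2 and a sum of injectives, a contradiction. A pencil of arrows is
  special if its members have a common kernel of dimension at least two. There are only finitely
  many special pencils, and an equivalence that identifies the standard special pencils of
  \<open>pair_rep c\<close> and \<open>pair_rep d\<close> preserves a pair of conics with modulus \<open>c^2\<close>. So every equivalence
  class in the family is finite.

  Indecomposable representations of dimension vector \<open>(m, n)\<close> with \<open>n \<le> (r - 1) m\<close> and
  \<open>m \<le> (r - 1) n\<close> are regular, because \<open>\<tau> M\<close> has dimension vector at least
  \<open>(r n' - m, n')\<close> with \<open>n' \<ge> r m - n\<close>, so that the first inequality is inherited by \<open>\<tau> M\<close> and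
  \<open>\<tau>^i M\<close> never vanishes.
\<close>

section \<open>Linear algebra\<close>

text \<open>Over an algebraically closed field a bilinear map k^x \<times> k^y \<rightarrow> k^r
  without zero divisors exists only for r \<ge> x + y - 1, because the projective variety of
  rank-one tensors has dimension x + y - 2. Hence (3, 3) needs five arrows. The model there is the
  product of two polynomials of degree at most 2: its rank-one arrow combinations form a rational
  normal curve, and twisting one coefficient by q leaves only the two end points of the curve, so
  that little symmetry survives. For four arrows a vector at vertex 1 of a (6, 3)-representation is
  read as a 3 by 4 matrix. The rank-one matrices form a variety of dimension 5 in an 11-dimensional
  projective space, so 6 is the only dimension for which a space of matrices and its annihilator can
  both avoid them. Away from characteristic 2 the dual of the conic w_1^2 = w_0 w_2 is y_1^2 = 4 y_0
  y_2. It touches y_1^2 = c^2 y_0 y_2 in two points and coincides with it for c^2 = 4, which is why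
  this value is excluded. As the characteristic is arbitrary, no argument may divide by 2.\<close>

lemma exists_kernel_vec:
  fixes A :: "'k::field mat"
  assumes A: "A \<in> carrier_mat n m" and nm: "n < m"
  shows "\<exists>v\<in>carrier_vec m. v \<noteq> 0\<^sub>v m \<and> A *\<^sub>v v = 0\<^sub>v n"
proof -
  \<comment> \<open>Padding with zero rows gives a square matrix. Its last row is zero because
    \<open>n < m\<close>, so the transpose kills the last unit vector and the determinant criterion
    applies.\<close>
  define B where "B = mat m m (\<lambda>(i, j). if i < n then A $$ (i, j) else 0)"
  have B: "B \<in> carrier_mat m m" by (simp add: B_def)
  have "B\<^sup>T *\<^sub>v unit_vec m (m - 1) = 0\<^sub>v m"
    using nm by (intro eq_vecI) (auto simp: B_def)
  moreover have "unit_vec m (m - 1) \<noteq> (0\<^sub>v m :: 'k vec)"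
    using nm unit_vec_nonzero[of "m - 1" m] by auto
  ultimately have "det (B\<^sup>T) = 0"
    using det_0_iff_vec_prod_zero_field[of "B\<^sup>T" m] B by (metis transpose_carrier_mat unit_vec_carrier)
  then have "det B = 0"
    using det_transpose[OF B] by simp
  then obtain v where v: "v \<in> carrier_vec m" "v \<noteq> 0\<^sub>v m" "B *\<^sub>v v = 0\<^sub>v m"
    using det_0_iff_vec_prod_zero_field[OF B] by blast
  have "A *\<^sub>v v = 0\<^sub>v n"
  proof (rule eq_vecI)
    fix i assume i: "i < dim_vec (0\<^sub>v n :: 'k vec)"
    then have im: "i < m" using nm by simp
    have "row A i = row B i"
      using i im A by (intro eq_vecI) (auto simp: B_def)
    then have "(A *\<^sub>v v) $ i = (B *\<^sub>v v) $ i"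
      using i im A B by simp
    then show "(A *\<^sub>v v) $ i = 0\<^sub>v n $ i"
      using i im v by simp
  qed (use A in simp)
  with v show ?thesis by blast
qed

lemma mat_injI:
  fixes A :: "'k::field mat"
  assumes A: "A \<in> carrier_mat n m"
    and ker: "\<And>v. v \<in> carrier_vec m \<Longrightarrow> A *\<^sub>v v = 0\<^sub>v n \<Longrightarrow> v = 0\<^sub>v m"
  shows "mat_inj A"
  unfolding mat_inj_def
proof (rule inj_onI)
  fix x y assume xy: "x \<in> carrier_vec (dim_col A)" "y \<in> carrier_vec (dim_col A)" "A *\<^sub>v x = A *\<^sub>v y"
  then have c: "x \<in> carrier_vec m" "y \<in> carrier_vec m" using A by auto
  have "A *\<^sub>v (x - y) = 0\<^sub>v n"
    using mult_minus_distrib_mat_vec[OF A c] xy(3) mult_mat_vec_carrier[OF A c(2)] by simp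
  then have "x - y = 0\<^sub>v m" using ker c by simp
  then have "x $ i - y $ i = 0" if "i < m" for i
    using that c by (metis carrier_vecD index_minus_vec(1) index_zero_vec(1))
  then show "x = y" using c by (intro eq_vecI) auto
qed

lemma mat_injD:
  fixes A :: "'k::field mat"
  assumes inj: "mat_inj A" and A: "A \<in> carrier_mat n m"
    and v: "v \<in> carrier_vec m" "A *\<^sub>v v = 0\<^sub>v n"
  shows "v = 0\<^sub>v m"
proof -
  have "A *\<^sub>v 0\<^sub>v m = 0\<^sub>v n" using A by (intro eq_vecI) auto
  then show ?thesis
    using inj_onD[OF inj[unfolded mat_inj_def], of v "0\<^sub>v m"] A v by auto
qed

lemma mat_inj_le:
  fixes A :: "'k::field mat"
  assumes "mat_inj A" and "A \<in> carrier_mat n m"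
  shows "m \<le> n"
  using exists_kernel_vec[OF assms(2)] mat_injD[OF assms] by (metis not_le)

lemma mat_inj_square_inverse:
  fixes A :: "'k::field mat"
  assumes inj: "mat_inj A" and A: "A \<in> carrier_mat n n"
  shows "\<exists>B\<in>carrier_mat n n. A * B = 1\<^sub>m n \<and> B * A = 1\<^sub>m n"
proof -
  have "det A \<noteq> 0"
    using det_0_iff_vec_prod_zero_field[OF A] mat_injD[OF inj A] by blast
  from det_non_zero_imp_unit[OF A this, unfolded Units_def, of "()"]
  show ?thesis by (auto simp: ring_mat_def)
qed

lemma surj_right_inverse:
  fixes A :: "'k::field mat"
  assumes A: "A \<in> carrier_mat n m" and surj: "carrier_vec n \<subseteq> mat_range A"
  shows "\<exists>S\<in>carrier_mat m n. A * S = 1\<^sub>m n"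
proof -
  have "\<exists>s\<in>carrier_vec m. A *\<^sub>v s = unit_vec n j" for j
  proof -
    have "unit_vec n j \<in> (\<lambda>v. A *\<^sub>v v) ` carrier_vec m"
      using surj A unit_vec_carrier[of n j] unfolding mat_range_def by auto
    then show ?thesis by (metis imageE)
  qed
  then obtain s where s: "\<And>j. s j \<in> carrier_vec m" "\<And>j. A *\<^sub>v s j = unit_vec n j"
    by metis
  define S where "S = mat_of_cols m (map s [0..<n])"
  have S: "S \<in> carrier_mat m n" by (simp add: S_def carrier_matI)
  have "A * S = 1\<^sub>m n"
  proof (rule mat_col_eqI)
    fix j assume j: "j < dim_col (1\<^sub>m n :: 'k mat)"
    then have "col S j = s j" using s by (simp add: S_def)
    moreover have "col (A * S) j = A *\<^sub>v col S j" using j by (intro col_mult2[OF A S]) simp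
    ultimately show "col (A * S) j = col (1\<^sub>m n) j" using j s(2)[of j] by simp
  qed (use A S in auto)
  with S show ?thesis by blast
qed

text \<open>Basis completion, one column per step: an injective matrix with fewer columns than rows
  is not onto, since a right inverse would have a kernel, and any vector outside its range can be
  appended.\<close>

lemma mat_inj_extend:
  fixes F :: "'k::field mat"
  assumes "mat_inj F" and "F \<in> carrier_mat n b"
  shows "\<exists>P\<in>carrier_mat n n. mat_inj P \<and> (\<forall>i<n. \<forall>j<b. P $$ (i, j) = F $$ (i, j))"
  using assms
proof (induction "n - b" arbitrary: b F)
  case 0
  then have "n = b" using mat_inj_le[OF 0(2,3)] by simp
  then show ?case using 0(2,3) by blast
next
  case (Suc k)
  note F = Suc.prems(2)
  have bn: "b < n" using Suc.hyps(2) by simp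
  obtain v where v: "v \<in> carrier_vec n" "v \<notin> mat_range F"
  proof (rule ccontr)
    assume "\<not> thesis"
    with that have "carrier_vec n \<subseteq> mat_range F" by blast
    from surj_right_inverse[OF F this]
    obtain S where S: "S \<in> carrier_mat b n" "F * S = 1\<^sub>m n" by blast
    obtain w where w: "w \<in> carrier_vec n" "w \<noteq> 0\<^sub>v n" "S *\<^sub>v w = 0\<^sub>v b"
      using exists_kernel_vec[OF S(1) bn] by blast
    have "w = F *\<^sub>v (S *\<^sub>v w)"
      using assoc_mult_mat_vec[OF F S(1) w(1)] S(2) w(1) by simp
    also have "\<dots> = 0\<^sub>v n" using w(3) F by (intro eq_vecI) auto
    finally show False using w(2) by blast
  qed
  define F' where "F' = mat n (Suc b) (\<lambda>(i, j). if j < b then F $$ (i, j) else v $ i)"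
  have F': "F' \<in> carrier_mat n (Suc b)" by (simp add: F'_def)
  have F'w: "F' *\<^sub>v w = F *\<^sub>v vec b (\<lambda>i. w $ i) + w $ b \<cdot>\<^sub>v v"
    if w: "w \<in> carrier_vec (Suc b)" for w
    using w F v(1) by (intro eq_vecI) (auto simp: F'_def scalar_prod_def mult.commute)
  have "mat_inj F'"
  proof (rule mat_injI[OF F'])
    fix w assume w: "w \<in> carrier_vec (Suc b)" and zero: "F' *\<^sub>v w = 0\<^sub>v n"
    let ?w = "vec b (\<lambda>i. w $ i)"
    have eq: "(F *\<^sub>v ?w) $ i + w $ b * v $ i = 0" if "i < n" for i
    proof -
      have "(F' *\<^sub>v w) $ i = (F *\<^sub>v ?w) $ i + w $ b * v $ i"
        unfolding F'w[OF w] using that F v(1) by (simp del: index_mult_mat_vec)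
      then show ?thesis using zero that by simp
    qed
    have wb: "w $ b = 0"
    proof (rule ccontr)
      assume nz: "w $ b \<noteq> 0"
      have "v = F *\<^sub>v ((- inverse (w $ b)) \<cdot>\<^sub>v ?w)"
      proof (rule eq_vecI)
        fix i assume "i < dim_vec (F *\<^sub>v ((- inverse (w $ b)) \<cdot>\<^sub>v ?w))"
        then have i: "i < n" using F by simp
        have "(F *\<^sub>v ((- inverse (w $ b)) \<cdot>\<^sub>v ?w)) $ i = - inverse (w $ b) * (F *\<^sub>v ?w) $ i"
          using i F by (simp add: mult_mat_vec[of F n b])
        also have "\<dots> = v $ i"
          using eq[OF i] nz by (simp add: field_simps add_eq_0_iff del: index_mult_mat_vec)
        finally show "v $ i = (F *\<^sub>v ((- inverse (w $ b)) \<cdot>\<^sub>v ?w)) $ i" by simp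
      qed (use F v in simp)
      then show False using v(2) F unfolding mat_range_def by auto
    qed
    have "F *\<^sub>v ?w = 0\<^sub>v n"
      using eq wb F by (intro eq_vecI) (auto simp del: index_mult_mat_vec)
    then have "?w = 0\<^sub>v b" using mat_injD[OF Suc.prems(1) F] by simp
    then have "w $ i = 0" if "i < b" for i
      using that by (metis index_vec index_zero_vec(1))
    then show "w = 0\<^sub>v (Suc b)"
      using w wb by (intro eq_vecI) (auto simp: less_Suc_eq)
  qed
  moreover have "k = n - Suc b" using Suc.hyps(2) by simp
  ultimately obtain P where P: "P \<in> carrier_mat n n" "mat_inj P"
    "\<forall>i<n. \<forall>j<Suc b. P $$ (i, j) = F' $$ (i, j)"
    using Suc.hyps(1) F' by blast
  then have "\<forall>i<n. \<forall>j<b. P $$ (i, j) = F $$ (i, j)" using bn by (simp add: F'_def)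
  with P show ?case by blast
qed

lemma mat_inj_left_inverse:
  fixes F :: "'k::field mat"
  assumes "mat_inj F" and F: "F \<in> carrier_mat n b"
  shows "\<exists>L\<in>carrier_mat b n. L * F = 1\<^sub>m b"
proof -
  obtain P where P: "P \<in> carrier_mat n n" "mat_inj P" "\<forall>i<n. \<forall>j<b. P $$ (i, j) = F $$ (i, j)"
    using mat_inj_extend[OF assms] by blast
  obtain Q where Q: "Q \<in> carrier_mat n n" "Q * P = 1\<^sub>m n"
    using mat_inj_square_inverse[OF P(2,1)] by blast
  have bn: "b \<le> n" using mat_inj_le[OF assms] .
  define L where "L = mat b n (\<lambda>(i, j). Q $$ (i, j))"
  have L: "L \<in> carrier_mat b n" by (simp add: L_def)
  have "L * F = 1\<^sub>m b"
  proof (rule eq_matI)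
    fix i j assume ij: "i < dim_row (1\<^sub>m b :: 'k mat)" "j < dim_col (1\<^sub>m b :: 'k mat)"
    then have "(L * F) $$ (i, j) = (Q * P) $$ (i, j)"
      using F P(1,3) Q(1) L bn by (simp add: L_def scalar_prod_def)
    then show "(L * F) $$ (i, j) = 1\<^sub>m b $$ (i, j)" using ij Q(2) bn by simp
  qed (use L F in auto)
  with L show ?thesis by blast
qed

lemma append_zero_vec [simp]: "0\<^sub>v n @\<^sub>v 0\<^sub>v m = 0\<^sub>v (n + m)"
  by (intro eq_vecI) auto

lemma append_eq_zero_vec:
  assumes "v \<in> carrier_vec n" "w \<in> carrier_vec m" "v @\<^sub>v w = 0\<^sub>v (n + m)"
  shows "v = 0\<^sub>v n" "w = 0\<^sub>v m"
  using assms append_vec_eq[OF assms(1), of "0\<^sub>v n" w "0\<^sub>v m"] by auto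

lemma mult_zero_vec:
  fixes A :: "'k::field mat"
  shows "A \<in> carrier_mat n m \<Longrightarrow> A *\<^sub>v 0\<^sub>v m = 0\<^sub>v n"
  by (intro eq_vecI) auto

lemma range_mult:
  assumes "B \<in> carrier_mat n d" "x \<in> carrier_vec d"
  shows "B *\<^sub>v x \<in> mat_range B"
  using assms unfolding mat_range_def by auto

text \<open>The kernel of \<open>C\<close> has dimension at least \<open>y - c\<close>, and
  \<open>D\<close> embeds it into the range of \<open>B\<close>, which has dimension
  \<open>d\<close>. To avoid dimensions of subspaces, a left inverse \<open>L\<close> of
  \<open>B\<close> turns this into a kernel vector of \<open>C\<close> stacked on
  \<open>L * D\<close>.\<close>

lemma dim_le_by_kernel:
  fixes C :: "'k::field mat"
  assumes B: "B \<in> carrier_mat n d" "mat_inj B"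
    and D: "D \<in> carrier_mat n y" "mat_inj D"
    and C: "C \<in> carrier_mat c y"
    and sub: "\<And>v. v \<in> carrier_vec y \<Longrightarrow> C *\<^sub>v v = 0\<^sub>v c \<Longrightarrow> D *\<^sub>v v \<in> mat_range B"
  shows "y \<le> c + d"
proof (rule ccontr)
  assume "\<not> y \<le> c + d"
  then have lt: "c + d < y" by simp
  obtain L where L: "L \<in> carrier_mat d n" "L * B = 1\<^sub>m d"
    using mat_inj_left_inverse[OF B(2,1)] by blast
  have LD: "L * D \<in> carrier_mat d y" using L D by simp
  obtain v where v: "v \<in> carrier_vec y" "v \<noteq> 0\<^sub>v y" "(C @\<^sub>r (L * D)) *\<^sub>v v = 0\<^sub>v (c + d)"
    using exists_kernel_vec[OF carrier_append_rows[OF C LD] lt] by blast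
  have "C *\<^sub>v v \<in> carrier_vec c" "(L * D) *\<^sub>v v \<in> carrier_vec d"
    using C LD v(1) by auto
  then have z: "C *\<^sub>v v = 0\<^sub>v c" "(L * D) *\<^sub>v v = 0\<^sub>v d"
    using append_eq_zero_vec v(3) unfolding mat_mult_append[OF C LD v(1)] by metis+
  obtain u where u: "u \<in> carrier_vec d" "D *\<^sub>v v = B *\<^sub>v u"
    using sub[OF v(1) z(1)] B(1) unfolding mat_range_def by auto
  have "u = (L * B) *\<^sub>v u" using L u by simp
  also have "\<dots> = L *\<^sub>v (D *\<^sub>v v)" using assoc_mult_mat_vec[OF L(1) B(1) u(1)] u(2) by simp
  also have "\<dots> = 0\<^sub>v d" using assoc_mult_mat_vec[OF L(1) D(1) v(1)] z(2) by simp
  finally have "D *\<^sub>v v = 0\<^sub>v n" using u(2) mult_zero_vec[OF B(1)] by simp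
  then show False using mat_injD[OF D(2,1) v(1)] v(2) by blast
qed

text \<open>The columns of \<open>F\<close> together with a section of \<open>g\<close> are
  independent: applying \<open>g\<close> to a linear relation isolates the part from the section,
  and injectivity of \<open>F\<close> removes the rest.\<close>

lemma dim_ge_by_exact:
  fixes F :: "'k::field mat"
  assumes F: "F \<in> carrier_mat n b" "mat_inj F"
    and g: "g \<in> carrier_mat d n" "mat_range g = carrier_vec d"
    and gF: "\<And>u. u \<in> carrier_vec b \<Longrightarrow> g *\<^sub>v (F *\<^sub>v u) = 0\<^sub>v d"
  shows "b + d \<le> n"
proof (rule ccontr)
  assume "\<not> b + d \<le> n"
  then have lt: "n < b + d" by simp
  obtain S where S: "S \<in> carrier_mat n d" "g * S = 1\<^sub>m d"
    using surj_right_inverse[OF g(1)] g(2) by auto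
  define K where "K = four_block_mat F S (0\<^sub>m 0 b) (0\<^sub>m 0 d)"
  have K: "K \<in> carrier_mat n (b + d)" using F S by (auto simp: K_def)
  obtain v where v: "v \<in> carrier_vec (b + d)" "v \<noteq> 0\<^sub>v (b + d)" "K *\<^sub>v v = 0\<^sub>v n"
    using exists_kernel_vec[OF K lt] by blast
  define u w where "u = vec_first v b" and "w = vec_last v d"
  have uw: "u \<in> carrier_vec b" "w \<in> carrier_vec d" "v = u @\<^sub>v w"
    using v(1) vec_first_last_append[OF v(1)] by (auto simp: u_def w_def)
  have "K *\<^sub>v v = (F *\<^sub>v u + S *\<^sub>v w) @\<^sub>v (0\<^sub>m 0 b *\<^sub>v u + 0\<^sub>m 0 d *\<^sub>v w)"
    unfolding uw(3) K_def by (rule four_block_mat_mult_vec[OF F(1) S(1) _ _ uw(1,2)]) auto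
  also have "\<dots> = F *\<^sub>v u + S *\<^sub>v w" using F S by (intro eq_vecI) auto
  finally have sum0: "F *\<^sub>v u + S *\<^sub>v w = 0\<^sub>v n" using v(3) by simp
  have Fu: "F *\<^sub>v u \<in> carrier_vec n" and Sw: "S *\<^sub>v w \<in> carrier_vec n" using F S uw by auto
  have "0\<^sub>v d = g *\<^sub>v (F *\<^sub>v u + S *\<^sub>v w)" using sum0 mult_zero_vec[OF g(1)] by simp
  also have "\<dots> = g *\<^sub>v (F *\<^sub>v u) + g *\<^sub>v (S *\<^sub>v w)"
    by (rule mult_add_distrib_mat_vec[OF g(1) Fu Sw])
  also have "g *\<^sub>v (S *\<^sub>v w) = w"
    using assoc_mult_mat_vec[OF g(1) S(1) uw(2)] S(2) uw(2) by simp
  finally have w0: "w = 0\<^sub>v d" using gF[OF uw(1)] uw(2) by simp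
  then have "F *\<^sub>v u = 0\<^sub>v n" using sum0 mult_zero_vec[OF S(1)] Fu by simp
  then have "u = 0\<^sub>v b" using mat_injD[OF F(2,1) uw(1)] by simp
  then show False using w0 uw(3) v(2) by simp
qed

section \<open>Dimensions under the Auslander--Reiten translation\<close>

definition blk :: "nat \<Rightarrow> 'a vec \<Rightarrow> nat \<Rightarrow> 'a vec" where
  "blk q y i = vec q (\<lambda>l. y $ (i * q + l))"

lemma blk_carrier [simp]: "blk q y i \<in> carrier_vec q"
  by (simp add: blk_def)

lemma blk_index_less: "i < r \<Longrightarrow> l < q \<Longrightarrow> i * q + l < r * (q :: nat)"
  by (metis add.commute div_less_iff_less_mult div_mult_self3 less_nat_zero_code neq0_conv
      div_less add_0 mult.commute)

lemma blk_zero: "i < r \<Longrightarrow> blk q (0\<^sub>v (r * q)) i = 0\<^sub>v q"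
  by (intro eq_vecI) (auto simp: blk_def blk_index_less)

lemma eq_vec_blkI:
  assumes x: "x \<in> carrier_vec (r * q)" and y: "y \<in> carrier_vec (r * q)"
    and eq: "\<And>i. i < r \<Longrightarrow> blk q x i = blk q y i"
  shows "x = y"
proof (rule eq_vecI)
  fix c assume "c < dim_vec y"
  then have c: "c < r * q" using y by simp
  then have q: "0 < q" by (cases q) auto
  have i: "c div q < r" using c by (simp add: less_mult_imp_div_less)
  have "blk q x (c div q) $ (c mod q) = blk q y (c div q) $ (c mod q)" using eq[OF i] by simp
  then show "x $ c = y $ c" using q by (simp add: blk_def)
qed (use x y in simp)

lemma diag_power_carrier: "A \<in> carrier_mat p q \<Longrightarrow> diag_power r A \<in> carrier_mat (r * p) (r * q)"
  by (auto simp: diag_power_def)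

lemma blk_diag_power:
  fixes A :: "'k::field mat"
  assumes A: "A \<in> carrier_mat p q" and y: "y \<in> carrier_vec (r * q)" and i: "i < r"
  shows "blk p (diag_power r A *\<^sub>v y) i = A *\<^sub>v blk q y i"
proof (rule eq_vecI)
  fix k assume "k < dim_vec (A *\<^sub>v blk q y i)"
  then have k: "k < p" using A by simp
  have ik: "i * p + k < r * p" using i k by (rule blk_index_less)
  have dk: "(i * p + k) div p = i" "(i * p + k) mod p = k" using k by auto
  have "blk p (diag_power r A *\<^sub>v y) i $ k = (diag_power r A *\<^sub>v y) $ (i * p + k)"
    using k by (simp add: blk_def)
  also have "\<dots> = (\<Sum>c\<in>{0..<r * q}. (if i = c div q then A $$ (k, c mod q) else 0) * y $ c)"
    using ik y dk k by (simp add: diag_power_def scalar_prod_def carrier_matD[OF A] cong: if_cong)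
  also have "\<dots> = (\<Sum>c\<in>{i * q..<i * q + q}. A $$ (k, c mod q) * y $ c)"
  proof (rule sum.mono_neutral_cong_right)
    show "{i * q..<i * q + q} \<subseteq> {0..<r * q}"
    proof
      fix c assume "c \<in> {i * q..<i * q + q}"
      then have "c = i * q + (c - i * q)" "c - i * q < q" by auto
      then show "c \<in> {0..<r * q}" using blk_index_less[OF i, of "c - i * q" q] by simp
    qed
    show "\<forall>c\<in>{0..<r * q} - {i * q..<i * q + q}. (if i = c div q then A $$ (k, c mod q) else 0) * y $ c = 0"
    proof
      fix c assume c: "c \<in> {0..<r * q} - {i * q..<i * q + q}"
      then have q: "0 < q" by (cases q) auto
      have "i \<noteq> c div q"
      proof
        assume "i = c div q"
        then have "i * q + c mod q = c" by simp
        then show False using c mod_less_divisor[OF q, of c] by auto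
      qed
      then show "(if i = c div q then A $$ (k, c mod q) else 0) * y $ c = 0" by simp
    qed
    show "\<And>c. c \<in> {i * q..<i * q + q} \<Longrightarrow>
        (if i = c div q then A $$ (k, c mod q) else 0) * y $ c = A $$ (k, c mod q) * y $ c"
    proof -
      fix c assume c: "c \<in> {i * q..<i * q + q}"
      then have "c = i * q + (c - i * q)" "c - i * q < q" by auto
      then have "c div q = i" by (metis add.commute add_cancel_right_left div_less div_mult_self1
            less_nat_zero_code add_0 mult.commute)
      then show "(if i = c div q then A $$ (k, c mod q) else 0) * y $ c = A $$ (k, c mod q) * y $ c"
        by simp
    qed
  qed simp
  also have "\<dots> = (\<Sum>l\<in>{0..<q}. A $$ (k, (l + i * q) mod q) * y $ (l + i * q))"
    using sum.shift_bounds_nat_ivl[of "\<lambda>c. A $$ (k, c mod q) * y $ c" 0 "i * q" q]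
    by (simp add: add.commute)
  also have "\<dots> = (A *\<^sub>v blk q y i) $ k"
    using k A by (simp add: scalar_prod_def blk_def add.commute)
  finally show "blk p (diag_power r A *\<^sub>v y) i $ k = (A *\<^sub>v blk q y i) $ k" .
qed (use A in \<open>simp add: blk_def\<close>)

lemma mat_inj_diag_power:
  fixes A :: "'k::field mat"
  assumes A: "A \<in> carrier_mat p q" and inj: "mat_inj A"
  shows "mat_inj (diag_power r A)"
proof (rule mat_injI[OF diag_power_carrier[OF A]])
  fix v assume v: "v \<in> carrier_vec (r * q)" and z: "diag_power r A *\<^sub>v v = 0\<^sub>v (r * p)"
  show "v = 0\<^sub>v (r * q)"
  proof (rule eq_vec_blkI[OF v])
    fix i assume i: "i < r"
    have "A *\<^sub>v blk q v i = 0\<^sub>v p"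
      using blk_diag_power[OF A v i] unfolding z by (simp add: blk_zero[OF i])
    then show "blk q v i = blk q (0\<^sub>v (r * q)) i"
      using mat_injD[OF inj A] by (simp add: blk_zero[OF i])
  qed simp
qed

lemma arrow_mat_carrier [simp]: "arrow_mat r M \<in> carrier_mat (dim2 M) (r * dim1 M)"
  by (simp add: arrow_mat_def)

lemma trace_mat_carrier [simp]: "trace_mat r m \<in> carrier_mat m (r * (r * m))"
  by (simp add: trace_mat_def)

lemma nak_map_carrier:
  "fst (nak_map r M) \<in> carrier_mat (dim1 M + r * dim2 M) (r * (r * dim1 M))"
  "snd (nak_map r M) \<in> carrier_mat (dim2 M) (r * dim1 M)"
  unfolding nak_map_def
  by (auto intro!: diag_power_carrier)

lemma fst_nak_map_mult:
  assumes v: "v \<in> carrier_vec (r * (r * dim1 M))"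
  shows "fst (nak_map r M) *\<^sub>v v =
    (- trace_mat r (dim1 M) *\<^sub>v v) @\<^sub>v (diag_power r (arrow_mat r M) *\<^sub>v v)"
  unfolding nak_map_def fst_conv
  by (rule mat_mult_append[OF uminus_carrier_mat[OF trace_mat_carrier]
        diag_power_carrier[OF arrow_mat_carrier] v])

lemma nak_dims [simp]:
  "dim1 (nak_source r M) = r * (r * dim1 M)" "dim2 (nak_source r M) = r * dim1 M"
  "dim1 (nak_target r M) = dim1 M + r * dim2 M" "dim2 (nak_target r M) = dim2 M"
  by (simp_all add: nak_source_def nak_target_def rep_sum_def inj1_power_def inj2_power_def)

lemma uminus_mult_mat_vec:
  fixes A :: "'k::field mat"
  assumes "A \<in> carrier_mat n m" "v \<in> carrier_vec m"
  shows "- A *\<^sub>v v = - (A *\<^sub>v v)"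
  using assms by (intro eq_vecI) auto

text \<open>At vertex 2 the translate is the kernel of \<open>arrow_mat r M\<close>. At vertex 1 a
  family of \<open>r\<close> vectors from that kernel is already killed by the block diagonal part
  of the Nakayama map, so only the \<open>dim1 M\<close> trace conditions remain.\<close>

lemma ar_translate_dims:
  assumes "ar_translate r M N"
  shows "r * dim1 M \<le> dim2 M + dim2 N" "r * dim2 N \<le> dim1 M + dim1 N"
proof -
  let ?A = "arrow_mat r M"
  obtain f where ex: "left_exact r N f (nak_source r M) (nak_map r M) (nak_target r M)"
    using assms unfolding ar_translate_def by blast
  have f: "fst f \<in> carrier_mat (r * (r * dim1 M)) (dim1 N)" "snd f \<in> carrier_mat (r * dim1 M) (dim2 N)"
    and inj: "mat_inj (fst f)" "mat_inj (snd f)"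
    and rng: "mat_range (fst f) = mat_kernel (fst (nak_map r M))" "mat_range (snd f) = mat_kernel ?A"
    using ex by (auto simp: left_exact_def rep_hom_def nak_map_def)
  show "r * dim1 M \<le> dim2 M + dim2 N"
  proof (rule dim_le_by_kernel[OF f(2) inj(2) one_carrier_mat _ arrow_mat_carrier])
    show "mat_inj (1\<^sub>m (r * dim1 M) :: 'a mat)" by (rule mat_injI[OF one_carrier_mat]) auto
  qed (auto simp: rng mat_kernelI[OF arrow_mat_carrier])
  let ?D = "diag_power r (snd f)"
  have D: "?D \<in> carrier_mat (r * (r * dim1 M)) (r * dim2 N)" by (rule diag_power_carrier[OF f(2)])
  have C: "trace_mat r (dim1 M) * ?D \<in> carrier_mat (dim1 M) (r * dim2 N)"
    by (rule mult_carrier_mat[OF trace_mat_carrier D])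
  show "r * dim2 N \<le> dim1 M + dim1 N"
  proof (rule dim_le_by_kernel[OF f(1) inj(1) D mat_inj_diag_power[OF f(2) inj(2)] C])
    fix v :: "'a vec" assume v: "v \<in> carrier_vec (r * dim2 N)"
      and z: "(trace_mat r (dim1 M) * ?D) *\<^sub>v v = 0\<^sub>v (dim1 M)"
    have Dv: "?D *\<^sub>v v \<in> carrier_vec (r * (r * dim1 M))" using D v by simp
    have tz: "trace_mat r (dim1 M) *\<^sub>v (?D *\<^sub>v v) = 0\<^sub>v (dim1 M)"
      using z assoc_mult_mat_vec[OF trace_mat_carrier D v] by simp
    have az: "diag_power r ?A *\<^sub>v (?D *\<^sub>v v) = 0\<^sub>v (r * dim2 M)"
    proof (rule eq_vec_blkI)
      show "diag_power r ?A *\<^sub>v (?D *\<^sub>v v) \<in> carrier_vec (r * dim2 M)"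
        using diag_power_carrier[OF arrow_mat_carrier[of r M], of r] Dv by auto
      fix i assume i: "i < r"
      have "snd f *\<^sub>v blk (dim2 N) v i \<in> mat_kernel ?A"
        using range_mult[OF f(2)] rng(2) by simp
      then have "?A *\<^sub>v (snd f *\<^sub>v blk (dim2 N) v i) = 0\<^sub>v (dim2 M)"
        using mat_kernelD[OF arrow_mat_carrier] by blast
      then show "blk (dim2 M) (diag_power r ?A *\<^sub>v (?D *\<^sub>v v)) i = blk (dim2 M) (0\<^sub>v (r * dim2 M)) i"
        using blk_diag_power[OF arrow_mat_carrier Dv i] blk_diag_power[OF f(2) v i]
        by (simp add: blk_zero[OF i])
    qed simp
    have "fst (nak_map r M) *\<^sub>v (?D *\<^sub>v v) = 0\<^sub>v (dim1 M + r * dim2 M)"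
      unfolding fst_nak_map_mult[OF Dv] using tz az uminus_mult_mat_vec[OF trace_mat_carrier Dv] by simp
    then show "?D *\<^sub>v v \<in> mat_range (fst f)"
      unfolding rng using mat_kernelI[OF nak_map_carrier(1) Dv] by simp
  qed
qed

text \<open>For dimension vectors (m, n) of \<open>M\<close> and (m', n') of \<open>N\<close> one
  gets n' \<ge> r m - n \<ge> m and then m' \<ge> r n' - m \<ge> (r - 1) n', which is stronger than
  the required inequality because \<open>2 \<le> r\<close>.\<close>

lemma ar_translate_cone:
  assumes "ar_translate r M N" and r: "2 \<le> r" and cone: "dim2 M \<le> (r - 1) * dim1 M" "0 < dim1 M"
  shows "dim2 N \<le> (r - 1) * dim1 N \<and> 0 < dim1 N"
proof -
  obtain s where s: "r = Suc s" "1 \<le> s" using r by (cases r) auto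
  have 1: "dim1 M \<le> dim2 N" using ar_translate_dims(1)[OF assms(1)] cone(1) s by simp
  then have 2: "s * dim2 N \<le> dim1 N" using ar_translate_dims(2)[OF assms(1)] s by simp
  have 3: "dim2 N \<le> dim1 N" using 2 s(2) by (metis le_trans mult_1 mult_le_mono1)
  then have "dim2 N \<le> s * dim1 N" using s(2) by (metis le_trans mult_1 mult_le_mono1)
  then show ?thesis using 1 3 cone(2) s by simp
qed

lemma not_zero_ar_translate_power:
  assumes "(ar_translate r ^^ n) M N" "2 \<le> r" "dim2 M \<le> (r - 1) * dim1 M" "0 < dim1 M"
  shows "\<not> zero_rep N"
proof -
  have "dim2 N \<le> (r - 1) * dim1 N \<and> 0 < dim1 N" using assms(1)
  proof (induction n arbitrary: N)
    case 0
    then show ?case using assms by simp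
  next
    case (Suc n)
    then obtain N' where "(ar_translate r ^^ n) M N'" "ar_translate r N' N" by auto
    then show ?case using Suc.IH ar_translate_cone assms(2) by blast
  qed
  then show ?thesis by (simp add: zero_rep_def)
qed

lemma ar_cotranslate_power:
  "(ar_cotranslate r ^^ n) M N \<Longrightarrow> (ar_translate r ^^ n) (dual_rep M) (dual_rep N)"
proof (induction n arbitrary: N)
  case (Suc n)
  then obtain N' where "(ar_cotranslate r ^^ n) M N'" "ar_cotranslate r N' N" by auto
  then show ?case using Suc.IH unfolding ar_cotranslate_def by auto
qed simp

lemma regular_indecomposableI:
  assumes "indecomposable r M" "2 \<le> r" "dim2 M \<le> (r - 1) * dim1 M" "dim1 M \<le> (r - 1) * dim2 M"
  shows "regular_indecomposable r M"
proof -
  \<comment> \<open>If one dimension vanished, the two inequalities would force the other one to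
    vanish.\<close>
  have pos: "0 < dim1 M" "0 < dim2 M"
    using assms unfolding indecomposable_def zero_rep_def by (auto intro!: Nat.gr0I)
  have "\<not> preprojective r M"
    using not_zero_ar_translate_power assms pos unfolding preprojective_def by blast
  \<comment> \<open>Dualizing exchanges the two inequalities, so the argument for the translation
    applies to \<open>dual_rep M\<close>.\<close>
  moreover have "\<not> preinjective r M"
  proof
    assume "preinjective r M"
    then obtain n N where N: "(ar_cotranslate r ^^ n) M N" "zero_rep N"
      unfolding preinjective_def by blast
    have "\<not> zero_rep (dual_rep N)"
      using not_zero_ar_translate_power[OF ar_cotranslate_power[OF N(1)] assms(2)] assms pos
      by (simp add: dual_rep_def)
    then show False using N(2) by (simp add: zero_rep_def dual_rep_def)
  qed
  ultimately show ?thesis using assms(1) unfolding regular_indecomposable_def by blast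
qed

section \<open>Criteria for not being regular\<close>

lemma invertible_matI:
  assumes "A \<in> carrier_mat n n" "B \<in> carrier_mat n n" "A * B = 1\<^sub>m n" "B * A = 1\<^sub>m n"
  shows "invertible_mat A"
  using assms unfolding invertible_mat_def inverts_mat_def by auto

lemma invertible_matE:
  fixes A :: "'k::field mat"
  assumes A: "A \<in> carrier_mat n m" and inv: "invertible_mat A"
  obtains B where "n = m" "B \<in> carrier_mat n n" "A * B = 1\<^sub>m n" "B * A = 1\<^sub>m n"
proof -
  have nm: "n = m" using assms unfolding invertible_mat_def by auto
  obtain B where B: "A * B = 1\<^sub>m n" "B * A = 1\<^sub>m (dim_row B)"
    using assms unfolding invertible_mat_def inverts_mat_def by auto
  have "dim_col (A * B) = n" "dim_col (B * A) = dim_row B" unfolding B by simp_all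
  then have "B \<in> carrier_mat n n" using A nm by (intro carrier_matI) auto
  then show thesis using that[OF nm _ B(1)] B(2) by auto
qed

lemma invertible_one_mat [simp]: "invertible_mat (1\<^sub>m n :: 'k::field mat)"
  by (rule invertible_matI[of _ n "1\<^sub>m n"]) auto

lemma mat_inj_if_left_inverse:
  fixes A :: "'k::field mat"
  assumes A: "A \<in> carrier_mat n m" "B \<in> carrier_mat m n" "B * A = 1\<^sub>m m"
  shows "mat_inj A"
proof (rule mat_injI[OF A(1)])
  fix v assume v: "v \<in> carrier_vec m" "A *\<^sub>v v = 0\<^sub>v n"
  have "v = (B * A) *\<^sub>v v" using A(3) v by simp
  also have "\<dots> = B *\<^sub>v (A *\<^sub>v v)" by (rule assoc_mult_mat_vec[OF A(2,1) v(1)])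
  finally show "v = 0\<^sub>v m" using v(2) mult_zero_vec[OF A(2)] by simp
qed

lemma rep_iso_dims:
  assumes "rep_iso r M N"
  shows "dim1 M = dim1 N" "dim2 M = dim2 N"
  using assms unfolding rep_iso_def rep_hom_def invertible_mat_def by auto

lemma rep_iso_eqI:
  fixes M N :: "'k::field kron_rep"
  assumes "is_rep r M" "dim1 M = dim1 N" "dim2 M = dim2 N" "\<And>i. i < r \<Longrightarrow> arr M i = arr N i"
  shows "rep_iso r M N"
proof -
  have "is_rep r N" using assms unfolding is_rep_def by metis
  moreover have "rep_hom r M N (1\<^sub>m (dim1 M), 1\<^sub>m (dim2 M))"
    using assms unfolding rep_hom_def is_rep_def
    by (auto simp: left_mult_one_mat right_mult_one_mat)
  ultimately show ?thesis
    using assms(1) unfolding rep_iso_def by (intro conjI exI) auto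
qed

lemma rep_sum_dims [simp]: "dim1 (rep_sum M N) = dim1 M + dim1 N" "dim2 (rep_sum M N) = dim2 M + dim2 N"
  by (simp_all add: rep_sum_def)

lemma is_rep_rep_sum: "is_rep r M \<Longrightarrow> is_rep r N \<Longrightarrow> is_rep r (rep_sum M N)"
  unfolding is_rep_def rep_sum_def by auto

lemma zero_mat_mult_vec:
  fixes x :: "'k::field vec"
  shows "x \<in> carrier_vec m \<Longrightarrow> 0\<^sub>m n m *\<^sub>v x = 0\<^sub>v n"
  by (intro eq_vecI) auto

lemma rep_sum_mult:
  fixes M N :: "'k::field kron_rep"
  assumes "is_rep r M" "is_rep r N" "i < r" "u \<in> carrier_vec (dim1 M)" "w \<in> carrier_vec (dim1 N)"
  shows "arr (rep_sum M N) i *\<^sub>v (u @\<^sub>v w) = (arr M i *\<^sub>v u) @\<^sub>v (arr N i *\<^sub>v w)"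
proof -
  have M: "arr M i \<in> carrier_mat (dim2 M) (dim1 M)" and N: "arr N i \<in> carrier_mat (dim2 N) (dim1 N)"
    using assms unfolding is_rep_def by auto
  have "arr (rep_sum M N) i *\<^sub>v (u @\<^sub>v w) =
    (arr M i *\<^sub>v u + 0\<^sub>m (dim2 M) (dim1 N) *\<^sub>v w) @\<^sub>v (0\<^sub>m (dim2 N) (dim1 M) *\<^sub>v u + arr N i *\<^sub>v w)"
    unfolding rep_sum_def
    by simp (rule four_block_mat_mult_vec[OF M zero_carrier_mat zero_carrier_mat N assms(4,5)])
  then show ?thesis
    using mult_mat_vec_carrier[OF M assms(4)] mult_mat_vec_carrier[OF N assms(5)]
    by (simp add: zero_mat_mult_vec[OF assms(4)] zero_mat_mult_vec[OF assms(5)])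
qed

lemma carrier_vec_no_entries: "carrier_vec 0 = {0\<^sub>v 0}"
  by (auto intro: eq_vecI)

lemma mat_range_no_cols:
  fixes A :: "'k::field mat"
  assumes "A \<in> carrier_mat n 0"
  shows "mat_range A = {0\<^sub>v n}"
  using assms mult_zero_vec[OF assms] unfolding mat_range_def
  by (simp add: carrier_vec_no_entries del: zero_vec_zero)

lemma mat_inj_no_cols:
  fixes A :: "'k::field mat"
  assumes "A \<in> carrier_mat n 0"
  shows "mat_inj A"
  using mat_injI[OF assms] by (simp add: carrier_vec_no_entries)

lemma mat_kernel_inj:
  fixes A :: "'k::field mat"
  assumes "A \<in> carrier_mat n m" "mat_inj A"
  shows "mat_kernel A = {0\<^sub>v m}"
  using mat_injD[OF assms(2,1)] mult_zero_vec[OF assms(1)] assms(1)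
  unfolding mat_kernel_def by auto

section \<open>The Nakayama map and representations with zero translate\<close>

lemma nak_source_mult:
  fixes v :: "'k::field vec"
  assumes v: "v \<in> carrier_vec (r * d)" and i: "i < r"
  shows "arr (inj2_power r d) i *\<^sub>v v = blk d v i"
proof (rule eq_vecI)
  fix p assume "p < dim_vec (blk d v i)"
  then have p: "p < d" by (simp add: blk_def)
  have "(arr (inj2_power r d) i *\<^sub>v v) $ p = (\<Sum>c = 0..<r * d. (if c = i * d + p then 1 else 0) * v $ c)"
    using p v by (simp add: inj2_power_def scalar_prod_def)
  also have "\<dots> = (\<Sum>c = 0..<r * d. if c = i * d + p then v $ c else 0)"
    by (rule sum.cong) auto
  also have "\<dots> = v $ (i * d + p)" using blk_index_less[OF i p] by (simp add: sum.delta)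
  finally show "(arr (inj2_power r d) i *\<^sub>v v) $ p = blk d v i $ p" using p by (simp add: blk_def)
qed (simp add: blk_def inj2_power_def)

lemma is_rep_inj_power: "is_rep r (inj1_power d)" "is_rep r (inj2_power r d)"
  by (auto simp: is_rep_def inj1_power_def inj2_power_def)

lemma eq_mat_by_vecI:
  fixes A B :: "'k::field mat"
  assumes A: "A \<in> carrier_mat n m" and B: "B \<in> carrier_mat n m"
    and eq: "\<And>v. v \<in> carrier_vec m \<Longrightarrow> A *\<^sub>v v = B *\<^sub>v v"
  shows "A = B"
proof (rule eq_matI)
  fix i j assume ij: "i < dim_row B" "j < dim_col B"
  have X: "(X *\<^sub>v unit_vec m j) $ i = X $$ (i, j)" if "X \<in> carrier_mat n m" for X :: "'k mat"
    using that ij B by simp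
  show "A $$ (i, j) = B $$ (i, j)" using eq[OF unit_vec_carrier[of m j]] X[OF A] X[OF B] by simp
qed (use A B in auto)

text \<open>Needed because \<open>left_exact\<close> demands homomorphisms on both sides. The copies
  of I(1) vanish at vertex 2, so the arrows of the target only see the block diagonal part, and they
  see it block by block.\<close>

lemma rep_hom_nak_map:
  assumes "is_rep r M"
  shows "rep_hom r (nak_source r M) (nak_target r M) (nak_map r M)"
  unfolding rep_hom_def
proof (intro conjI allI impI)
  show "fst (nak_map r M) \<in> carrier_mat (dim1 (nak_target r M)) (dim1 (nak_source r M))"
    "snd (nak_map r M) \<in> carrier_mat (dim2 (nak_target r M)) (dim2 (nak_source r M))"
    using nak_map_carrier by auto
  fix i assume i: "i < r"
  let ?m = "dim1 M" and ?n = "dim2 M" and ?A = "arrow_mat r M"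
  have S: "arr (nak_source r M) i \<in> carrier_mat (r * ?m) (r * (r * ?m))"
    by (simp add: nak_source_def inj2_power_def)
  have T: "arr (nak_target r M) i \<in> carrier_mat ?n (?m + r * ?n)"
    using is_rep_rep_sum[OF is_rep_inj_power(1)[of r ?m] is_rep_inj_power(2)[of r ?n]] i
      nak_dims(3,4)[of r M]
    unfolding is_rep_def nak_target_def by metis
  show "snd (nak_map r M) * arr (nak_source r M) i = arr (nak_target r M) i * fst (nak_map r M)"
  proof (rule eq_mat_by_vecI)
    show "snd (nak_map r M) * arr (nak_source r M) i \<in> carrier_mat ?n (r * (r * ?m))"
      by (rule mult_carrier_mat[OF nak_map_carrier(2) S])
    show "arr (nak_target r M) i * fst (nak_map r M) \<in> carrier_mat ?n (r * (r * ?m))"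
      by (rule mult_carrier_mat[OF T nak_map_carrier(1)])
    fix v :: "'a vec" assume v: "v \<in> carrier_vec (r * (r * ?m))"
    have "(snd (nak_map r M) * arr (nak_source r M) i) *\<^sub>v v = ?A *\<^sub>v (arr (nak_source r M) i *\<^sub>v v)"
      using assoc_mult_mat_vec[OF nak_map_carrier(2) S v] by (simp add: nak_map_def)
    also have "\<dots> = ?A *\<^sub>v blk (r * ?m) v i"
      unfolding nak_source_def by (simp add: nak_source_mult[OF v i])
    also have "\<dots> = blk ?n (diag_power r ?A *\<^sub>v v) i"
      by (rule blk_diag_power[OF arrow_mat_carrier v i, symmetric])
    finally have l: "(snd (nak_map r M) * arr (nak_source r M) i) *\<^sub>v v = blk ?n (diag_power r ?A *\<^sub>v v) i" .
    have t: "- trace_mat r ?m *\<^sub>v v \<in> carrier_vec ?m"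
      by (rule mult_mat_vec_carrier[OF uminus_carrier_mat[OF trace_mat_carrier] v])
    have d: "diag_power r ?A *\<^sub>v v \<in> carrier_vec (r * ?n)"
      by (rule mult_mat_vec_carrier[OF diag_power_carrier[OF arrow_mat_carrier] v])
    have "(arr (nak_target r M) i * fst (nak_map r M)) *\<^sub>v v =
        arr (nak_target r M) i *\<^sub>v ((- trace_mat r ?m *\<^sub>v v) @\<^sub>v (diag_power r ?A *\<^sub>v v))"
      using assoc_mult_mat_vec[OF T nak_map_carrier(1) v] fst_nak_map_mult[OF v] by simp
    also have "\<dots> = (arr (inj1_power ?m) i *\<^sub>v (- trace_mat r ?m *\<^sub>v v)) @\<^sub>v
        (arr (inj2_power r ?n) i *\<^sub>v (diag_power r ?A *\<^sub>v v))"
      unfolding nak_target_def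
      using rep_sum_mult[OF is_rep_inj_power(1) is_rep_inj_power(2) i, of "- trace_mat r ?m *\<^sub>v v" ?m
          "diag_power r ?A *\<^sub>v v" ?n] t d by (simp add: inj1_power_def inj2_power_def)
    also have "arr (inj2_power r ?n) i *\<^sub>v (diag_power r ?A *\<^sub>v v) = blk ?n (diag_power r ?A *\<^sub>v v) i"
      by (rule nak_source_mult[OF d i])
    also have "(arr (inj1_power ?m) i *\<^sub>v (- trace_mat r ?m *\<^sub>v v)) @\<^sub>v blk ?n (diag_power r ?A *\<^sub>v v) i
        = blk ?n (diag_power r ?A *\<^sub>v v) i"
      by (intro eq_vecI) (auto simp: inj1_power_def)
    finally show "(snd (nak_map r M) * arr (nak_source r M) i) *\<^sub>v v =
        (arr (nak_target r M) i * fst (nak_map r M)) *\<^sub>v v"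
      using l by simp
  qed
qed

text \<open>The hypothesis \<open>inj\<close> says that the map M1^r \<rightarrow> M2 given by the
  arrows is injective, i.e. that \<open>M\<close> is projective. The block diagonal part then makes
  the Nakayama map injective at vertex 1 as well, and both kernels vanish.\<close>

lemma ar_translate_zero:
  fixes M N :: "'k::field kron_rep"
  assumes M: "is_rep r M" and inj: "mat_inj (arrow_mat r M)" and N: "is_rep r N" "zero_rep N"
  shows "ar_translate r M N"
proof -
  define f :: "'k rep_map" where "f = (0\<^sub>m (r * (r * dim1 M)) 0, 0\<^sub>m (r * dim1 M) 0)"
  have f: "fst f \<in> carrier_mat (r * (r * dim1 M)) 0" "snd f \<in> carrier_mat (r * dim1 M) 0"
    by (simp_all add: f_def)
  have N0: "dim1 N = 0" "dim2 N = 0" using N by (auto simp: zero_rep_def)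
  have "rep_hom r N (nak_source r M) f"
    unfolding rep_hom_def
  proof (intro conjI allI impI)
    fix i assume i: "i < r"
    have S: "arr (nak_source r M) i \<in> carrier_mat (r * dim1 M) (r * (r * dim1 M))"
      by (simp add: nak_source_def inj2_power_def)
    have "arr N i \<in> carrier_mat 0 0" using N(1) N0 i by (auto simp: is_rep_def)
    then show "snd f * arr N i = arr (nak_source r M) i * fst f"
      using f S by (intro eq_matI) auto
  qed (use f N0 in auto)
  moreover have "mat_inj (fst (nak_map r M))"
  proof (rule mat_injI[OF nak_map_carrier(1)])
    fix v :: "'k vec" assume v: "v \<in> carrier_vec (r * (r * dim1 M))"
      and z: "fst (nak_map r M) *\<^sub>v v = 0\<^sub>v (dim1 M + r * dim2 M)"
    have D: "diag_power r (arrow_mat r M) \<in> carrier_mat (r * dim2 M) (r * (r * dim1 M))"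
      by (rule diag_power_carrier[OF arrow_mat_carrier])
    have "diag_power r (arrow_mat r M) *\<^sub>v v = 0\<^sub>v (r * dim2 M)"
      using z unfolding fst_nak_map_mult[OF v]
      by (rule append_eq_zero_vec(2)[OF mult_mat_vec_carrier[OF uminus_carrier_mat[OF trace_mat_carrier] v]
            mult_mat_vec_carrier[OF D v]])
    then show "v = 0\<^sub>v (r * (r * dim1 M))"
      using mat_injD[OF mat_inj_diag_power[OF arrow_mat_carrier inj] D v] by simp
  qed
  then have "mat_kernel (fst (nak_map r M)) = {0\<^sub>v (r * (r * dim1 M))}"
    by (rule mat_kernel_inj[OF nak_map_carrier(1)])
  moreover have "mat_kernel (snd (nak_map r M)) = {0\<^sub>v (r * dim1 M)}"
    using mat_kernel_inj[OF arrow_mat_carrier inj] by (simp add: nak_map_def)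
  ultimately have "left_exact r N f (nak_source r M) (nak_map r M) (nak_target r M)"
    unfolding left_exact_def
    using rep_hom_nak_map[OF M] f
    by (simp add: mat_inj_no_cols[OF f(1)] mat_inj_no_cols[OF f(2)]
        mat_range_no_cols[OF f(1)] mat_range_no_cols[OF f(2)])
  then show ?thesis unfolding ar_translate_def using M N by blast
qed

abbreviation zero_kron :: "'k::field kron_rep" where
  "zero_kron \<equiv> \<lparr>dim1 = 0, dim2 = 0, arr = (\<lambda>_. 0\<^sub>m 0 0)\<rparr>"

lemma preprojectiveI:
  assumes "indecomposable r M" "mat_inj (arrow_mat r M)"
  shows "preprojective r M"
proof -
  have "ar_translate r M zero_kron"
    using assms by (intro ar_translate_zero) (auto simp: indecomposable_def is_rep_def zero_rep_def)
  then have "(ar_translate r ^^ 1) M zero_kron" by (simp add: relcompp_apply)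
  then show ?thesis using assms(1) unfolding preprojective_def
    by (metis (no_types) kron_rep.select_convs(1,2) le_refl zero_rep_def)
qed

lemma is_rep_dual: "is_rep r M \<Longrightarrow> is_rep r (dual_rep M)"
  by (auto simp: is_rep_def dual_rep_def)

lemma preinjectiveI:
  assumes "indecomposable r M" "mat_inj (arrow_mat r (dual_rep M))"
  shows "preinjective r M"
proof -
  have "ar_cotranslate r M zero_kron"
    using assms unfolding ar_cotranslate_def
    by (intro ar_translate_zero) (auto simp: indecomposable_def is_rep_dual is_rep_def zero_rep_def dual_rep_def)
  then have "(ar_cotranslate r ^^ 1) M zero_kron" by (simp add: relcompp_apply)
  then show ?thesis using assms(1) unfolding preinjective_def
    by (metis (no_types) kron_rep.select_convs(1,2) le_refl zero_rep_def)
qed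

section \<open>Direct summands that exclude regularity\<close>

lemma indecomposable_simple:
  assumes "is_rep r M" "dim1 M + dim2 M = 1"
  shows "indecomposable r M"
  unfolding indecomposable_def
proof (intro conjI allI impI)
  fix A B :: "'a kron_rep"
  assume "is_rep r A \<and> is_rep r B \<and> rep_iso r M (rep_sum A B)"
  then have "dim1 M = dim1 A + dim1 B" "dim2 M = dim2 A + dim2 B"
    using rep_iso_dims by fastforce+
  then have "dim1 A + dim2 A + (dim1 B + dim2 B) = 1" using assms(2) by linarith
  then show "zero_rep A \<or> zero_rep B" unfolding zero_rep_def by linarith
qed (use assms in \<open>auto simp: zero_rep_def\<close>)

lemma not_regularI:
  assumes "is_rep r L" "rep_iso r M (rep_sum N L)" "preprojective r N \<or> preinjective r N"
  shows "\<not> regular r M"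
  using assms unfolding regular_def regular_indecomposable_def preprojective_def preinjective_def
  by blast

text \<open>Any line at vertex 2 splits off, and it is the simple projective representation.\<close>

lemma not_regular_dim1_zero:
  fixes M :: "'k::field kron_rep"
  assumes M: "is_rep r M" and d: "dim1 M = 0" "0 < dim2 M"
  shows "\<not> regular r M"
proof -
  define N L :: "'k kron_rep"
    where "N = \<lparr>dim1 = 0, dim2 = 1, arr = (\<lambda>_. 0\<^sub>m 1 0)\<rparr>"
      and "L = \<lparr>dim1 = 0, dim2 = dim2 M - 1, arr = (\<lambda>_. 0\<^sub>m (dim2 M - 1) 0)\<rparr>"
  have rep: "is_rep r N" "is_rep r L" by (auto simp: is_rep_def N_def L_def)
  have "mat_inj (arrow_mat r N)"
    using arrow_mat_carrier[of r N] by (intro mat_inj_no_cols[of _ 1]) (simp add: N_def)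
  then have "preprojective r N"
    using rep by (intro preprojectiveI indecomposable_simple) (auto simp: N_def)
  moreover have "rep_iso r M (rep_sum N L)"
  proof (rule rep_iso_eqI[OF M])
    fix i assume i: "i < r"
    have "arr M i \<in> carrier_mat (dim2 M) 0" using M d i by (auto simp: is_rep_def)
    then show "arr M i = arr (rep_sum N L) i"
      using d by (intro eq_matI) (auto simp: rep_sum_def N_def L_def)
  qed (use d in \<open>auto simp: N_def L_def\<close>)
  ultimately show ?thesis using not_regularI rep by blast
qed

text \<open>A common kernel vector spans a copy of the simple injective I(1). Completing it to a
  basis of the space at vertex 1 makes the first column of every arrow zero, so this copy is a
  direct summand.\<close>

lemma not_regular_kernel:
  fixes M :: "'k::field kron_rep"
  assumes M: "is_rep r M" and v: "v \<in> carrier_vec (dim1 M)" "v \<noteq> 0\<^sub>v (dim1 M)"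
    and ker: "\<And>i. i < r \<Longrightarrow> arr M i *\<^sub>v v = 0\<^sub>v (dim2 M)"
  shows "\<not> regular r M"
proof -
  let ?d = "dim1 M" and ?e = "dim2 M"
  have d: "0 < ?d" using v by (cases "?d") auto
  define F where "F = mat ?d 1 (\<lambda>(i, j). v $ i)"
  have F: "F \<in> carrier_mat ?d 1" by (simp add: F_def)
  have "mat_inj F"
  proof (rule mat_injI[OF F])
    fix u :: "'k vec" assume u: "u \<in> carrier_vec 1" and z: "F *\<^sub>v u = 0\<^sub>v ?d"
    obtain p where p: "p < ?d" "v $ p \<noteq> 0" using v by (metis carrier_vecD eq_vecI index_zero_vec)
    have "(F *\<^sub>v u) $ p = v $ p * u $ 0" using p u by (simp add: F_def scalar_prod_def)
    then show "u = 0\<^sub>v 1" using z p u by (intro eq_vecI) auto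
  qed
  from mat_inj_extend[OF this F] obtain P where P: "P \<in> carrier_mat ?d ?d" "mat_inj P"
    and P0: "\<And>i. i < ?d \<Longrightarrow> P $$ (i, 0) = v $ i"
    by (auto simp: F_def)
  obtain Q where Q: "Q \<in> carrier_mat ?d ?d" "P * Q = 1\<^sub>m ?d" "Q * P = 1\<^sub>m ?d"
    using mat_inj_square_inverse[OF P(2,1)] by blast
  define L :: "'k kron_rep" where
    "L = \<lparr>dim1 = ?d - 1, dim2 = ?e, arr = (\<lambda>i. mat ?e (?d - 1) (\<lambda>(p, q). (arr M i * P) $$ (p, Suc q)))\<rparr>"
  let ?N = "inj1_power 1 :: 'k kron_rep"
  have rep: "is_rep r ?N" "is_rep r L" by (auto simp: is_rep_def inj1_power_def L_def)
  have "mat_inj (arrow_mat r (dual_rep ?N))"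
    using arrow_mat_carrier[of r "dual_rep ?N"]
    by (intro mat_inj_no_cols[of _ 1]) (simp add: dual_rep_def inj1_power_def)
  then have "preinjective r ?N"
    using rep by (intro preinjectiveI indecomposable_simple) (auto simp: inj1_power_def)
  moreover have "rep_iso r M (rep_sum ?N L)"
    unfolding rep_iso_def
  proof (intro conjI exI)
    show "is_rep r M" by fact
    show "is_rep r (rep_sum ?N L)" by (rule is_rep_rep_sum[OF rep])
    show "rep_hom r M (rep_sum ?N L) (Q, 1\<^sub>m ?e)"
      unfolding rep_hom_def
    proof (intro conjI allI impI)
      fix i assume i: "i < r"
      have A: "arr M i \<in> carrier_mat ?e ?d" using M i by (auto simp: is_rep_def)
      have AP: "arr M i * P \<in> carrier_mat ?e ?d" using A P by simp
      have "arr (rep_sum ?N L) i = arr M i * P"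
      proof (rule eq_matI)
        fix p q assume "p < dim_row (arr M i * P)" "q < dim_col (arr M i * P)"
        then have pq: "p < ?e" "q < ?d" using AP by auto
        have "col P 0 = v" using P P0 v d by (intro eq_vecI) auto
        then have "(arr M i * P) $$ (p, 0) = (arr M i *\<^sub>v v) $ p" using pq A P d by simp
        then have "(arr M i * P) $$ (p, 0) = 0" using ker[OF i] pq by simp
        then show "arr (rep_sum ?N L) i $$ (p, q) = (arr M i * P) $$ (p, q)"
          using pq by (cases q) (auto simp: rep_sum_def inj1_power_def L_def)
      qed (use AP d in \<open>auto simp: rep_sum_def inj1_power_def L_def\<close>)
      then have "arr (rep_sum ?N L) i * Q = arr M i * (P * Q)" using A P Q by simp
      then show "snd (Q, 1\<^sub>m ?e) * arr M i = arr (rep_sum ?N L) i * fst (Q, 1\<^sub>m ?e)"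
        using A Q by simp
    qed (use Q d in \<open>auto simp: inj1_power_def L_def\<close>)
    show "invertible_mat (fst (Q, 1\<^sub>m ?e :: 'k mat))" using invertible_matI[OF Q(1) P(1)] Q by simp
  qed simp
  ultimately show ?thesis using not_regularI rep by blast
qed

lemma not_regular_dim2_zero:
  fixes M :: "'k::field kron_rep"
  assumes M: "is_rep r M" and d: "dim2 M = 0" "0 < dim1 M"
  shows "\<not> regular r M"
proof (rule not_regular_kernel[OF M])
  show "unit_vec (dim1 M) 0 \<noteq> (0\<^sub>v (dim1 M) :: 'k vec)" using d(2) by simp
  show "arr M i *\<^sub>v unit_vec (dim1 M) 0 = 0\<^sub>v (dim2 M)" if "i < r" for i
    using M d that by (intro eq_vecI) (auto simp: is_rep_def)
qed simp

text \<open>By \<open>ker\<close> no non-zero summand lives at vertex 1 alone, and vertex 2 has room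
  for one summand only, so \<open>M\<close> is indecomposable. By \<open>inj\<close> the arrows are
  independent functionals, which makes the dual projective and \<open>M\<close>
  preinjective.\<close>

lemma not_regular_injective_hull:
  fixes M :: "'k::field kron_rep"
  assumes M: "is_rep r M" and d: "dim2 M = 1" "0 < dim1 M"
    and inj: "mat_inj (arrow_mat r (dual_rep M))"
    and ker: "\<And>v. v \<in> carrier_vec (dim1 M) \<Longrightarrow> (\<And>i. i < r \<Longrightarrow> arr M i *\<^sub>v v = 0\<^sub>v 1) \<Longrightarrow> v = 0\<^sub>v (dim1 M)"
  shows "\<not> regular r M"
proof -
  have "indecomposable r M"
    unfolding indecomposable_def
  proof (intro conjI allI impI)
    fix A B :: "'k kron_rep"
    assume "is_rep r A \<and> is_rep r B \<and> rep_iso r M (rep_sum A B)"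
    then have rep: "is_rep r A" "is_rep r B" and iso: "rep_iso r M (rep_sum A B)" by auto
    have dims: "dim1 M = dim1 A + dim1 B" "dim2 M = dim2 A + dim2 B"
      using rep_iso_dims[OF iso] by auto
    obtain f where f: "rep_hom r M (rep_sum A B) f" "invertible_mat (fst f)" "invertible_mat (snd f)"
      using iso unfolding rep_iso_def by blast
    have f1: "fst f \<in> carrier_mat (dim1 M) (dim1 M)" and f2: "snd f \<in> carrier_mat 1 1"
      using f(1) dims d(1) unfolding rep_hom_def by auto
    obtain G where G: "G \<in> carrier_mat (dim1 M) (dim1 M)" "fst f * G = 1\<^sub>m (dim1 M)" "G * fst f = 1\<^sub>m (dim1 M)"
      using invertible_matE[OF f1 f(2)] by metis
    obtain H where H: "H \<in> carrier_mat 1 1" "H * snd f = 1\<^sub>m 1"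
      using invertible_matE[OF f2 f(3)] by metis
    have "x = 0\<^sub>v (dim1 M)" if x: "x \<in> carrier_vec (dim1 M)"
      and z: "\<And>i. i < r \<Longrightarrow> arr (rep_sum A B) i *\<^sub>v x = 0\<^sub>v 1" for x
    proof -
      have Gx: "G *\<^sub>v x \<in> carrier_vec (dim1 M)" using G x by simp
      have fGx: "fst f *\<^sub>v (G *\<^sub>v x) = x" using assoc_mult_mat_vec[OF f1 G(1) x] G x by simp
      have "G *\<^sub>v x = 0\<^sub>v (dim1 M)"
      proof (rule ker[OF Gx])
        fix i assume i: "i < r"
        have Mi: "arr M i \<in> carrier_mat 1 (dim1 M)" using M d i by (auto simp: is_rep_def)
        have S: "arr (rep_sum A B) i \<in> carrier_mat 1 (dim1 M)"
          using is_rep_rep_sum[OF rep] dims d i by (auto simp: is_rep_def)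
        have y: "arr M i *\<^sub>v (G *\<^sub>v x) \<in> carrier_vec 1" using Mi Gx by simp
        have "snd f *\<^sub>v (arr M i *\<^sub>v (G *\<^sub>v x)) = arr (rep_sum A B) i *\<^sub>v (fst f *\<^sub>v (G *\<^sub>v x))"
          using assoc_mult_mat_vec[OF f2 Mi Gx] assoc_mult_mat_vec[OF S f1 Gx] f(1) i
          unfolding rep_hom_def by metis
        also have "\<dots> = 0\<^sub>v 1" unfolding fGx using z[OF i] .
        finally show "arr M i *\<^sub>v (G *\<^sub>v x) = 0\<^sub>v 1"
          using mat_injD[OF mat_inj_if_left_inverse[OF f2 H] f2 y] by simp
      qed
      then show "x = 0\<^sub>v (dim1 M)" using fGx mult_zero_vec[OF f1] by simp
    qed note inj_sum = this
    have zero_dim: "dim1 C = 0" if C: "dim2 C = 0" "C = A \<or> C = B" for C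
    proof (rule ccontr)
      assume nz: "dim1 C \<noteq> 0"
      \<comment> \<open>A basis vector of the summand that vanishes at vertex 2: every arrow kills
        it, against joint injectivity.\<close>
      define x where "x = (if C = A then unit_vec (dim1 A) 0 @\<^sub>v 0\<^sub>v (dim1 B)
        else 0\<^sub>v (dim1 A) @\<^sub>v (unit_vec (dim1 B) 0 :: 'k vec))"
      have x: "x \<in> carrier_vec (dim1 M)" using dims by (auto simp: x_def)
      have "arr (rep_sum A B) i *\<^sub>v x = 0\<^sub>v 1" if i: "i < r" for i
      proof -
        have Ai: "arr A i \<in> carrier_mat (dim2 A) (dim1 A)" and Bi: "arr B i \<in> carrier_mat (dim2 B) (dim1 B)"
          using rep i by (auto simp: is_rep_def)
        show ?thesis
        proof (cases "C = A")
          case True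
          then have "dim2 A = 0" using C by simp
          then have "(arr A i *\<^sub>v unit_vec (dim1 A) 0) @\<^sub>v (arr B i *\<^sub>v 0\<^sub>v (dim1 B)) = 0\<^sub>v 1"
            using Ai Bi dims d by (intro eq_vecI) (auto simp: mult_zero_vec[OF Bi])
          then show ?thesis using True rep_sum_mult[OF rep i, of "unit_vec (dim1 A) 0" "0\<^sub>v (dim1 B)"]
            by (simp add: x_def)
        next
          case False
          then have "dim2 B = 0" using C by auto
          then have "(arr A i *\<^sub>v 0\<^sub>v (dim1 A)) @\<^sub>v (arr B i *\<^sub>v unit_vec (dim1 B) 0) = 0\<^sub>v 1"
            using Ai Bi dims d by (intro eq_vecI) (auto simp: mult_zero_vec[OF Ai])
          then show ?thesis using False rep_sum_mult[OF rep i, of "0\<^sub>v (dim1 A)" "unit_vec (dim1 B) 0"]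
            by (simp add: x_def)
        qed
      qed
      then have "x = 0\<^sub>v (dim1 M)" by (rule inj_sum[OF x])
      then have "x $ (if C = A then 0 else dim1 A) = 0" using dims d nz C(2) by auto
      then show False using nz C(2) dims by (auto simp: x_def split: if_splits)
    qed
    have "dim2 A = 0 \<or> dim2 B = 0" using dims d by linarith
    then show "zero_rep A \<or> zero_rep B"
      using zero_dim[of A] zero_dim[of B] unfolding zero_rep_def by blast
  qed (use M d in \<open>auto simp: zero_rep_def\<close>)
  then have "preinjective r M" using inj by (rule preinjectiveI)
  \<comment> \<open>Regularity is tested on direct summands, so \<open>M\<close> has to be exhibited
    as a summand of itself.\<close>
  moreover have "rep_iso r M (rep_sum M zero_kron)"
  proof (rule rep_iso_eqI[OF M])
    fix i assume "i < r"
    then have "arr M i \<in> carrier_mat (dim2 M) (dim1 M)" using M by (auto simp: is_rep_def)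
    then show "arr M i = arr (rep_sum M zero_kron) i"
      by (intro eq_matI) (auto simp: rep_sum_def)
  qed auto
  moreover have "is_rep r (zero_kron :: 'k kron_rep)" by (simp add: is_rep_def)
  ultimately show ?thesis using not_regularI by blast
qed

section \<open>Criteria for elementary representations\<close>

text \<open>\<open>sub_rank r E p\<close>: subrepresentations that are non-zero at vertex 1 have dimension at least
  \<open>p\<close> at vertex 2. \<open>quot_rank\<close> is the dual bound on factor representations.\<close>

definition sub_rank :: "nat \<Rightarrow> 'k::field kron_rep \<Rightarrow> nat \<Rightarrow> bool" where
  "sub_rank r E p \<longleftrightarrow> (\<forall>v B b. v \<in> carrier_vec (dim1 E) \<longrightarrow> v \<noteq> 0\<^sub>v (dim1 E) \<longrightarrow>
     B \<in> carrier_mat (dim2 E) b \<longrightarrow> (\<forall>i<r. arr E i *\<^sub>v v \<in> mat_range B) \<longrightarrow> p \<le> b)"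

definition quot_rank :: "nat \<Rightarrow> 'k::field kron_rep \<Rightarrow> nat \<Rightarrow> bool" where
  "quot_rank r E q \<longleftrightarrow> (\<forall>w C d h. w \<in> carrier_vec (dim2 E) \<longrightarrow> w \<noteq> 0\<^sub>v (dim2 E) \<longrightarrow>
     C \<in> carrier_mat d (dim1 E) \<longrightarrow>
     (\<forall>i<r. h i \<in> carrier_vec d \<and> (\<forall>e\<in>carrier_vec (dim1 E). w \<bullet> (arr E i *\<^sub>v e) = h i \<bullet> (C *\<^sub>v e))) \<longrightarrow>
     q \<le> d)"

lemma quot_rankD:
  assumes "quot_rank r E q" "w \<in> carrier_vec (dim2 E)" "w \<noteq> 0\<^sub>v (dim2 E)"
    and "C \<in> carrier_mat d (dim1 E)" "\<And>i. i < r \<Longrightarrow> h i \<in> carrier_vec d"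
    and "\<And>i e. i < r \<Longrightarrow> e \<in> carrier_vec (dim1 E) \<Longrightarrow> w \<bullet> (arr E i *\<^sub>v e) = h i \<bullet> (C *\<^sub>v e)"
  shows "q \<le> d"
  using assms unfolding quot_rank_def by blast

lemma rep_hom_apply:
  fixes M N :: "'k::field kron_rep"
  assumes "is_rep r M" "is_rep r N" "rep_hom r M N f" "i < r" "u \<in> carrier_vec (dim1 M)"
  shows "arr N i *\<^sub>v (fst f *\<^sub>v u) = snd f *\<^sub>v (arr M i *\<^sub>v u)"
proof -
  have M: "arr M i \<in> carrier_mat (dim2 M) (dim1 M)" and N: "arr N i \<in> carrier_mat (dim2 N) (dim1 N)"
    and f: "fst f \<in> carrier_mat (dim1 N) (dim1 M)" "snd f \<in> carrier_mat (dim2 N) (dim2 M)"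
      "snd f * arr M i = arr N i * fst f"
    using assms unfolding is_rep_def rep_hom_def by auto
  show ?thesis
    using assoc_mult_mat_vec[OF N f(1) assms(5)] assoc_mult_mat_vec[OF f(2) M assms(5)] f(3) by simp
qed

lemma sub_rank_iso:
  fixes E T :: "'k::field kron_rep"
  assumes iso: "rep_iso r E T" and sr: "sub_rank r E p"
  shows "sub_rank r T p"
  unfolding sub_rank_def
proof (intro allI impI)
  fix v :: "'k vec" and B b
  assume v: "v \<in> carrier_vec (dim1 T)" "v \<noteq> 0\<^sub>v (dim1 T)" and B: "B \<in> carrier_mat (dim2 T) b"
    and rng: "\<forall>i<r. arr T i *\<^sub>v v \<in> mat_range B"
  have dims: "dim1 E = dim1 T" "dim2 E = dim2 T" using rep_iso_dims[OF iso] by auto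
  obtain f where rep: "is_rep r E" "is_rep r T" and f: "rep_hom r E T f" "invertible_mat (fst f)" "invertible_mat (snd f)"
    using iso unfolding rep_iso_def by blast
  have f1: "fst f \<in> carrier_mat (dim1 T) (dim1 T)" and f2: "snd f \<in> carrier_mat (dim2 T) (dim2 T)"
    using f(1) dims unfolding rep_hom_def by auto
  obtain G where G: "G \<in> carrier_mat (dim1 T) (dim1 T)" "fst f * G = 1\<^sub>m (dim1 T)"
    using invertible_matE[OF f1 f(2)] by metis
  obtain H where H: "H \<in> carrier_mat (dim2 T) (dim2 T)" "H * snd f = 1\<^sub>m (dim2 T)"
    using invertible_matE[OF f2 f(3)] by metis
  have Gv: "G *\<^sub>v v \<in> carrier_vec (dim1 E)" using G v dims by simp
  have fGv: "fst f *\<^sub>v (G *\<^sub>v v) = v" using assoc_mult_mat_vec[OF f1 G(1) v(1)] G v by simp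
  have "G *\<^sub>v v \<noteq> 0\<^sub>v (dim1 E)" using fGv v(2) mult_zero_vec[OF f1] dims by metis
  moreover have HB: "H * B \<in> carrier_mat (dim2 E) b" using H B dims by simp
  moreover have "arr E i *\<^sub>v (G *\<^sub>v v) \<in> mat_range (H * B)" if i: "i < r" for i
  proof -
    have Ei: "arr E i *\<^sub>v (G *\<^sub>v v) \<in> carrier_vec (dim2 T)"
      using rep(1) i Gv dims unfolding is_rep_def by (metis mult_mat_vec_carrier)
    obtain x where x: "x \<in> carrier_vec b" "arr T i *\<^sub>v v = B *\<^sub>v x"
      using rng i B unfolding mat_range_def by auto
    have "arr E i *\<^sub>v (G *\<^sub>v v) = H *\<^sub>v (snd f *\<^sub>v (arr E i *\<^sub>v (G *\<^sub>v v)))"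
      using assoc_mult_mat_vec[OF H(1) f2 Ei] H(2) Ei by simp
    also have "\<dots> = H *\<^sub>v (B *\<^sub>v x)" using rep_hom_apply[OF rep f(1) i Gv] fGv x(2) by simp
    also have "\<dots> = (H * B) *\<^sub>v x" using assoc_mult_mat_vec[OF H(1) B x(1)] by simp
    finally show ?thesis using range_mult[OF HB x(1)] by simp
  qed
  ultimately show "p \<le> b" using sr Gv unfolding sub_rank_def by blast
qed

lemma scalar_prod_mult_transpose:
  fixes A :: "'k::field mat"
  assumes A: "A \<in> carrier_mat n m" and w: "w \<in> carrier_vec n" and v: "v \<in> carrier_vec m"
  shows "(A\<^sup>T *\<^sub>v w) \<bullet> v = w \<bullet> (A *\<^sub>v v)"
  using transpose_vec_mult_scalar[OF A v w] by simp

lemma quot_rank_iso: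
  fixes E T :: "'k::field kron_rep"
  assumes iso: "rep_iso r E T" and qr: "quot_rank r E q"
  shows "quot_rank r T q"
  unfolding quot_rank_def
proof (intro allI impI)
  fix w :: "'k vec" and C d h
  assume w: "w \<in> carrier_vec (dim2 T)" "w \<noteq> 0\<^sub>v (dim2 T)" and C: "C \<in> carrier_mat d (dim1 T)"
    and h: "\<forall>i<r. h i \<in> carrier_vec d \<and> (\<forall>e\<in>carrier_vec (dim1 T). w \<bullet> (arr T i *\<^sub>v e) = h i \<bullet> (C *\<^sub>v e))"
  have dims: "dim1 E = dim1 T" "dim2 E = dim2 T" using rep_iso_dims[OF iso] by auto
  obtain f where rep: "is_rep r E" "is_rep r T" and f: "rep_hom r E T f" "invertible_mat (fst f)" "invertible_mat (snd f)"
    using iso unfolding rep_iso_def by blast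
  have f1: "fst f \<in> carrier_mat (dim1 T) (dim1 T)" and f2: "snd f \<in> carrier_mat (dim2 T) (dim2 T)"
    using f(1) dims unfolding rep_hom_def by auto
  obtain H where H: "H \<in> carrier_mat (dim2 T) (dim2 T)" "snd f * H = 1\<^sub>m (dim2 T)"
    using invertible_matE[OF f2 f(3)] by metis
  let ?w = "(snd f)\<^sup>T *\<^sub>v w"
  have "(H\<^sup>T * (snd f)\<^sup>T) *\<^sub>v w = H\<^sup>T *\<^sub>v ?w"
    using H(1) f2 w(1) by (intro assoc_mult_mat_vec) auto
  moreover have "H\<^sup>T * (snd f)\<^sup>T = 1\<^sub>m (dim2 T)"
    using transpose_mult[OF f2 H(1)] H(2) by simp
  ultimately have "H\<^sup>T *\<^sub>v ?w = w" using w(1) by simp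
  then have "?w \<noteq> 0\<^sub>v (dim2 E)"
    using w(2) mult_zero_vec[of "H\<^sup>T" "dim2 T" "dim2 T"] H(1) dims by auto
  moreover have "?w \<in> carrier_vec (dim2 E)" using f2 w dims by simp
  moreover have "C * fst f \<in> carrier_mat d (dim1 E)" using C f1 dims by simp
  moreover have "?w \<bullet> (arr E i *\<^sub>v e) = h i \<bullet> ((C * fst f) *\<^sub>v e)"
    if i: "i < r" and e: "e \<in> carrier_vec (dim1 E)" for i e
  proof -
    have Ee: "arr E i *\<^sub>v e \<in> carrier_vec (dim2 T)"
      using rep(1) i e dims unfolding is_rep_def by (metis mult_mat_vec_carrier)
    have fe: "fst f *\<^sub>v e \<in> carrier_vec (dim1 T)" using f1 e dims by simp
    have "?w \<bullet> (arr E i *\<^sub>v e) = w \<bullet> (arr T i *\<^sub>v (fst f *\<^sub>v e))"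
      using scalar_prod_mult_transpose[OF f2 w(1) Ee] rep_hom_apply[OF rep f(1) i e] by simp
    also have "\<dots> = h i \<bullet> (C *\<^sub>v (fst f *\<^sub>v e))" using h i fe by blast
    finally show ?thesis using assoc_mult_mat_vec[OF C f1, of e] e dims by simp
  qed
  ultimately show "q \<le> d" using qr h unfolding quot_rank_def by blast
qed

section \<open>Rank bounds, direct summands and exact sequences\<close>

lemma sub_rank_summand:
  fixes N L :: "'k::field kron_rep"
  assumes sr: "sub_rank r (rep_sum N L) p" and rep: "is_rep r N" "is_rep r L"
  shows "0 < dim1 N \<Longrightarrow> p \<le> dim2 N" "0 < dim1 L \<Longrightarrow> p \<le> dim2 L"
proof -
  let ?n = "dim1 N" and ?l = "dim1 L" and ?n' = "dim2 N" and ?l' = "dim2 L"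
  have carr: "arr N i \<in> carrier_mat ?n' ?n" "arr L i \<in> carrier_mat ?l' ?l" if "i < r" for i
    using rep that unfolding is_rep_def by auto
  show "p \<le> dim2 N" if pos: "0 < dim1 N"
  proof -
    let ?B = "1\<^sub>m ?n' @\<^sub>r 0\<^sub>m ?l' ?n' :: 'k mat" and ?v = "unit_vec ?n 0 @\<^sub>v 0\<^sub>v ?l :: 'k vec"
    have B: "?B \<in> carrier_mat (dim2 (rep_sum N L)) ?n'" by simp
    have Bx: "?B *\<^sub>v x = x @\<^sub>v 0\<^sub>v ?l'" if "x \<in> carrier_vec ?n'" for x
      using mat_mult_append[OF one_carrier_mat zero_carrier_mat that, of ?l'] that
      by (simp add: zero_mat_mult_vec[OF that])
    have "?v \<noteq> 0\<^sub>v (dim1 (rep_sum N L))"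
      using pos append_eq_zero_vec(1)[of "unit_vec ?n 0" ?n "0\<^sub>v ?l :: 'k vec" ?l] by auto
    moreover have "arr (rep_sum N L) i *\<^sub>v ?v \<in> mat_range ?B" if i: "i < r" for i
    proof -
      have "arr (rep_sum N L) i *\<^sub>v ?v = ?B *\<^sub>v (arr N i *\<^sub>v unit_vec ?n 0)"
        using rep_sum_mult[OF rep i, of "unit_vec ?n 0" "0\<^sub>v ?l"] mult_zero_vec[OF carr(2)[OF i]]
          Bx[OF mult_mat_vec_carrier[OF carr(1)[OF i] unit_vec_carrier]] by simp
      then show ?thesis using range_mult[OF B mult_mat_vec_carrier[OF carr(1)[OF i] unit_vec_carrier]] by simp
    qed
    ultimately show ?thesis using sr B unfolding sub_rank_def by (metis rep_sum_dims(1) append_carrier_vec unit_vec_carrier zero_carrier_vec)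
  qed
  show "p \<le> dim2 L" if pos: "0 < dim1 L"
  proof -
    let ?B = "0\<^sub>m ?n' ?l' @\<^sub>r 1\<^sub>m ?l' :: 'k mat" and ?v = "0\<^sub>v ?n @\<^sub>v unit_vec ?l 0 :: 'k vec"
    have B: "?B \<in> carrier_mat (dim2 (rep_sum N L)) ?l'" by simp
    have Bx: "?B *\<^sub>v x = 0\<^sub>v ?n' @\<^sub>v x" if "x \<in> carrier_vec ?l'" for x
      using mat_mult_append[OF zero_carrier_mat one_carrier_mat that, of ?n'] that
      by (simp add: zero_mat_mult_vec[OF that])
    have "?v \<noteq> 0\<^sub>v (dim1 (rep_sum N L))"
      using pos append_eq_zero_vec(2)[of "0\<^sub>v ?n :: 'k vec" ?n "unit_vec ?l 0" ?l] by auto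
    moreover have "arr (rep_sum N L) i *\<^sub>v ?v \<in> mat_range ?B" if i: "i < r" for i
    proof -
      have "arr (rep_sum N L) i *\<^sub>v ?v = ?B *\<^sub>v (arr L i *\<^sub>v unit_vec ?l 0)"
        using rep_sum_mult[OF rep i, of "0\<^sub>v ?n" "unit_vec ?l 0"] mult_zero_vec[OF carr(1)[OF i]]
          Bx[OF mult_mat_vec_carrier[OF carr(2)[OF i] unit_vec_carrier]] by simp
      then show ?thesis using range_mult[OF B mult_mat_vec_carrier[OF carr(2)[OF i] unit_vec_carrier]] by simp
    qed
    ultimately show ?thesis using sr B unfolding sub_rank_def by (metis rep_sum_dims(1) append_carrier_vec unit_vec_carrier zero_carrier_vec)
  qed
qed

lemma quot_rank_summand:
  fixes N L :: "'k::field kron_rep"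
  assumes qr: "quot_rank r (rep_sum N L) q" and rep: "is_rep r N" "is_rep r L"
  shows "0 < dim2 N \<Longrightarrow> q \<le> dim1 N" "0 < dim2 L \<Longrightarrow> q \<le> dim1 L"
proof -
  let ?n = "dim1 N" and ?l = "dim1 L" and ?n' = "dim2 N" and ?l' = "dim2 L"
  have carr: "arr N i \<in> carrier_mat ?n' ?n" "arr L i \<in> carrier_mat ?l' ?l" if "i < r" for i
    using rep that unfolding is_rep_def by auto
  have split: "\<exists>u x. u \<in> carrier_vec ?n \<and> x \<in> carrier_vec ?l \<and> e = u @\<^sub>v x"
    if "e \<in> carrier_vec (dim1 (rep_sum N L))" for e :: "'k vec"
    using vec_first_last_append[of e ?n ?l] that
    by (intro exI[of _ "vec_first e ?n"] exI[of _ "vec_last e ?l"]) simp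
  show "q \<le> dim1 N" if pos: "0 < dim2 N"
  proof -
    let ?w = "unit_vec ?n' 0 @\<^sub>v 0\<^sub>v ?l' :: 'k vec"
    let ?C = "four_block_mat (1\<^sub>m ?n) (0\<^sub>m ?n ?l) (0\<^sub>m 0 ?n) (0\<^sub>m 0 ?l) :: 'k mat"
    have C: "?C \<in> carrier_mat ?n (dim1 (rep_sum N L))" by auto
    have Cx: "?C *\<^sub>v (u @\<^sub>v x) = u" if "u \<in> carrier_vec ?n" "x \<in> carrier_vec ?l" for u x
      using four_block_mat_mult_vec[OF one_carrier_mat zero_carrier_mat zero_carrier_mat zero_carrier_mat that, of 0] that
      by (intro eq_vecI) auto
    have "?w \<noteq> 0\<^sub>v (dim2 (rep_sum N L))"
      using pos append_eq_zero_vec(1)[of "unit_vec ?n' 0" ?n' "0\<^sub>v ?l' :: 'k vec" ?l'] by auto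
    moreover have "?w \<bullet> (arr (rep_sum N L) i *\<^sub>v e) = row (arr N i) 0 \<bullet> (?C *\<^sub>v e)"
      if i: "i < r" and e: "e \<in> carrier_vec (dim1 (rep_sum N L))" for i e
    proof -
      obtain u x where ux: "u \<in> carrier_vec ?n" "x \<in> carrier_vec ?l" "e = u @\<^sub>v x" using split[OF e] by blast
      have "?w \<bullet> (arr (rep_sum N L) i *\<^sub>v e) = unit_vec ?n' 0 \<bullet> (arr N i *\<^sub>v u) + 0\<^sub>v ?l' \<bullet> (arr L i *\<^sub>v x)"
        unfolding ux(3) rep_sum_mult[OF rep i ux(1,2)]
        by (rule scalar_prod_append[OF unit_vec_carrier zero_carrier_vec
              mult_mat_vec_carrier[OF carr(1)[OF i] ux(1)] mult_mat_vec_carrier[OF carr(2)[OF i] ux(2)]])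
      also have "\<dots> = row (arr N i) 0 \<bullet> u"
        using carr[OF i] ux pos by simp
      finally show ?thesis unfolding ux(3) Cx[OF ux(1,2)] .
    qed
    moreover have "row (arr N i) 0 \<in> carrier_vec ?n" if "i < r" for i using carr(1)[OF that] by (simp add: carrier_vecI)
    moreover have "?w \<in> carrier_vec (dim2 (rep_sum N L))" by simp
    ultimately show ?thesis
      using quot_rankD[OF qr, of ?w ?C ?n "\<lambda>i. row (arr N i) 0"] C by blast
  qed
  show "q \<le> dim1 L" if pos: "0 < dim2 L"
  proof -
    let ?w = "0\<^sub>v ?n' @\<^sub>v unit_vec ?l' 0 :: 'k vec"
    let ?C = "four_block_mat (0\<^sub>m ?l ?n) (1\<^sub>m ?l) (0\<^sub>m 0 ?n) (0\<^sub>m 0 ?l) :: 'k mat"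
    have C: "?C \<in> carrier_mat ?l (dim1 (rep_sum N L))" by auto
    have Cx: "?C *\<^sub>v (u @\<^sub>v x) = x" if "u \<in> carrier_vec ?n" "x \<in> carrier_vec ?l" for u x
      using four_block_mat_mult_vec[OF zero_carrier_mat one_carrier_mat zero_carrier_mat zero_carrier_mat that, of 0] that
      by (intro eq_vecI) auto
    have "?w \<noteq> 0\<^sub>v (dim2 (rep_sum N L))"
      using pos append_eq_zero_vec(2)[of "0\<^sub>v ?n' :: 'k vec" ?n' "unit_vec ?l' 0" ?l'] by auto
    moreover have "?w \<bullet> (arr (rep_sum N L) i *\<^sub>v e) = row (arr L i) 0 \<bullet> (?C *\<^sub>v e)"
      if i: "i < r" and e: "e \<in> carrier_vec (dim1 (rep_sum N L))" for i e
    proof -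
      obtain u x where ux: "u \<in> carrier_vec ?n" "x \<in> carrier_vec ?l" "e = u @\<^sub>v x" using split[OF e] by blast
      have "?w \<bullet> (arr (rep_sum N L) i *\<^sub>v e) = 0\<^sub>v ?n' \<bullet> (arr N i *\<^sub>v u) + unit_vec ?l' 0 \<bullet> (arr L i *\<^sub>v x)"
        unfolding ux(3) rep_sum_mult[OF rep i ux(1,2)]
        by (rule scalar_prod_append[OF zero_carrier_vec unit_vec_carrier
              mult_mat_vec_carrier[OF carr(1)[OF i] ux(1)] mult_mat_vec_carrier[OF carr(2)[OF i] ux(2)]])
      also have "\<dots> = row (arr L i) 0 \<bullet> x"
        using carr[OF i] ux pos by simp
      finally show ?thesis unfolding ux(3) Cx[OF ux(1,2)] .
    qed
    moreover have "row (arr L i) 0 \<in> carrier_vec ?l" if "i < r" for i using carr(2)[OF that] by (simp add: carrier_vecI)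
    moreover have "?w \<in> carrier_vec (dim2 (rep_sum N L))" by simp
    ultimately show ?thesis
      using quot_rankD[OF qr, of ?w ?C ?l "\<lambda>i. row (arr L i) 0"] C by blast
  qed
qed

text \<open>A non-zero summand is non-zero at vertex 2 by \<open>sr\<close>, and then has dimension
  at least \<open>q\<close> at vertex 1 by \<open>qr\<close>. Two such summands would contradict
  \<open>dim1 E < 2 * q\<close>. Hence an indecomposable summand has the dimension vector of
  \<open>E\<close>, to which \<open>cone\<close> applies.\<close>

lemma regular_if_ranks:
  assumes E: "is_rep r E" and sr: "sub_rank r E p" "1 \<le> p" and qr: "quot_rank r E q" "dim1 E < 2 * q"
    and r: "2 \<le> r" and cone: "dim2 E \<le> (r - 1) * dim1 E" "dim1 E \<le> (r - 1) * dim2 E"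
  shows "regular r E"
  unfolding regular_def
proof (intro conjI allI impI)
  fix N L assume "indecomposable r N \<and> is_rep r L \<and> rep_iso r E (rep_sum N L)"
  then have N: "indecomposable r N" and L: "is_rep r L" and iso: "rep_iso r E (rep_sum N L)" by auto
  have N': "is_rep r N" "\<not> (dim1 N = 0 \<and> dim2 N = 0)"
    using N by (auto simp: indecomposable_def zero_rep_def)
  note s = sub_rank_summand[OF sub_rank_iso[OF iso sr(1)] N'(1) L]
    and q = quot_rank_summand[OF quot_rank_iso[OF iso qr(1)] N'(1) L]
  have dims: "dim1 E = dim1 N + dim1 L" "dim2 E = dim2 N + dim2 L"
    using rep_iso_dims[OF iso] by auto
  have n2: "0 < dim2 N" using N'(2) s(1) sr(2) by (cases "dim1 N = 0") auto
  then have "q \<le> dim1 N" using q(1) by blast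
  then have "dim1 L < q" using dims qr(2) by linarith
  then have l2: "dim2 L = 0" using q(2) by (meson leD neq0_conv)
  then have "dim1 L = 0" using s(2) sr(2) by (cases "dim1 L = 0") auto
  then show "regular_indecomposable r N"
    using regular_indecomposableI[OF N r] cone l2 dims by simp
qed (rule E)

text \<open>The images of one basis vector of \<open>A\<close> under all arrows of \<open>E\<close>
  stay in the range of \<open>snd f\<close>, a matrix with \<open>dim2 A\<close> columns.\<close>

lemma short_exact_sub_rank:
  assumes ex: "short_exact r A f E g B" and rep: "is_rep r A" "is_rep r E"
    and sr: "sub_rank r E p" and pos: "0 < dim1 A"
  shows "p \<le> dim2 A"
proof -
  have f: "rep_hom r A E f" "mat_inj (fst f)" using ex unfolding short_exact_def left_exact_def by auto
  have f1: "fst f \<in> carrier_mat (dim1 E) (dim1 A)" and f2: "snd f \<in> carrier_mat (dim2 E) (dim2 A)"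
    using f unfolding rep_hom_def by auto
  let ?u = "unit_vec (dim1 A) 0"
  have "fst f *\<^sub>v ?u \<noteq> 0\<^sub>v (dim1 E)" 
    using mat_injD[OF f(2) f1 unit_vec_carrier[of _ 0]] unit_vec_nonzero[OF pos] by blast
  moreover have "fst f *\<^sub>v ?u \<in> carrier_vec (dim1 E)" using f1 by simp
  moreover have "arr E i *\<^sub>v (fst f *\<^sub>v ?u) \<in> mat_range (snd f)" if i: "i < r" for i
  proof -
    have "arr A i *\<^sub>v ?u \<in> carrier_vec (dim2 A)"
      using rep(1) i unfolding is_rep_def by (metis mult_mat_vec_carrier unit_vec_carrier)
    then show ?thesis using rep_hom_apply[OF rep f(1) i unit_vec_carrier] range_mult[OF f2] by simp
  qed
  ultimately show ?thesis using sr f2 unfolding sub_rank_def by blast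
qed

text \<open>The first coordinate functional at vertex 2 of \<open>B\<close>, pulled back along
  \<open>snd g\<close>, is non-zero by surjectivity. Its pull-backs along the arrows of
  \<open>E\<close> factor through \<open>fst g\<close>, a matrix with \<open>dim1 B\<close>
  rows.\<close>

lemma short_exact_quot_rank:
  fixes E :: "'k::field kron_rep"
  assumes ex: "short_exact r A f E g B" and rep: "is_rep r E" "is_rep r B"
    and qr: "quot_rank r E q" and pos: "0 < dim2 B"
  shows "q \<le> dim1 B"
proof -
  have g: "rep_hom r E B g" "mat_range (snd g) = carrier_vec (dim2 B)"
    using ex unfolding short_exact_def left_exact_def by auto
  have g1: "fst g \<in> carrier_mat (dim1 B) (dim1 E)" and g2: "snd g \<in> carrier_mat (dim2 B) (dim2 E)"
    using g unfolding rep_hom_def by auto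
  let ?w = "row (snd g) 0"
  have w: "?w \<in> carrier_vec (dim2 E)" using g2 by (simp add: carrier_vecI)
  have "?w \<noteq> 0\<^sub>v (dim2 E)"
  proof
    assume z: "?w = 0\<^sub>v (dim2 E)"
    obtain x where x: "x \<in> carrier_vec (dim2 E)" "unit_vec (dim2 B) 0 = snd g *\<^sub>v x"
      using g(2) g2 unit_vec_carrier[of "dim2 B" 0] unfolding mat_range_def
      by (metis carrier_matD(2) imageE)
    have "(snd g *\<^sub>v x) $ 0 = ?w \<bullet> x" using pos g2 by simp
    then have "(unit_vec (dim2 B) 0 :: 'k vec) $ 0 = 0" using x z by simp
    then show False using pos by simp
  qed
  moreover have "row (arr B i) 0 \<in> carrier_vec (dim1 B) \<and>
      (\<forall>e\<in>carrier_vec (dim1 E). ?w \<bullet> (arr E i *\<^sub>v e) = row (arr B i) 0 \<bullet> (fst g *\<^sub>v e))"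
    if i: "i < r" for i
  proof (intro conjI ballI)
    have Bi: "arr B i \<in> carrier_mat (dim2 B) (dim1 B)" using rep i unfolding is_rep_def by auto
    then show "row (arr B i) 0 \<in> carrier_vec (dim1 B)" by (simp add: carrier_vecI)
    fix e :: "'k vec" assume e: "e \<in> carrier_vec (dim1 E)"
    have "?w \<bullet> (arr E i *\<^sub>v e) = (snd g *\<^sub>v (arr E i *\<^sub>v e)) $ 0" using g2 pos by simp
    also have "\<dots> = (arr B i *\<^sub>v (fst g *\<^sub>v e)) $ 0" using rep_hom_apply[OF rep g(1) i e] by simp
    finally show "?w \<bullet> (arr E i *\<^sub>v e) = row (arr B i) 0 \<bullet> (fst g *\<^sub>v e)" using Bi pos by simp
  qed
  ultimately show ?thesis
    using quot_rankD[OF qr w, of "fst g" "dim1 B" "\<lambda>i. row (arr B i) 0"] g1 by blast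
qed

lemma short_exact_dim2:
  fixes E :: "'k::field kron_rep"
  assumes ex: "short_exact r A f E g B"
  shows "dim2 A + dim2 B \<le> dim2 E"
proof -
  have f2: "snd f \<in> carrier_mat (dim2 E) (dim2 A)" "mat_inj (snd f)"
    and g2: "snd g \<in> carrier_mat (dim2 B) (dim2 E)" "mat_range (snd g) = carrier_vec (dim2 B)"
    and k: "mat_range (snd f) = mat_kernel (snd g)"
    using ex unfolding short_exact_def left_exact_def rep_hom_def by auto
  show ?thesis
  proof (rule dim_ge_by_exact[OF f2 g2])
    fix u :: "'k vec" assume "u \<in> carrier_vec (dim2 A)"
    then show "snd g *\<^sub>v (snd f *\<^sub>v u) = 0\<^sub>v (dim2 B)"
      using range_mult[OF f2(1)] mat_kernelD(2)[OF g2(1)] k by blast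
  qed
qed

lemma regular_nonzero_dims:
  assumes "regular r M" "\<not> zero_rep M"
  shows "0 < dim1 M" "0 < dim2 M"
  using assms not_regular_dim1_zero[of r M] not_regular_dim2_zero[of r M]
  by (auto simp: regular_def zero_rep_def)

lemma elementary_if_generated:
  assumes E: "is_rep r E" "0 < dim2 E" and sr: "sub_rank r E (dim2 E)"
    and qr: "quot_rank r E q" "dim1 E < 2 * q"
    and r: "2 \<le> r" and cone: "dim2 E \<le> (r - 1) * dim1 E" "dim1 E \<le> (r - 1) * dim2 E"
  shows "elementary r E"
  unfolding elementary_def
proof (intro conjI notI)
  show "regular r E" using E by (intro regular_if_ranks[OF E(1) sr _ qr r cone]) simp
  assume "\<exists>A B f g. regular r A \<and> regular r B \<and> \<not> zero_rep A \<and> \<not> zero_rep B \<and> short_exact r A f E g B"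
  then obtain A B f g where AB: "regular r A" "regular r B" "\<not> zero_rep A" "\<not> zero_rep B"
    and ex: "short_exact r A f E g B" by blast
  have "dim2 E \<le> dim2 A"
    using short_exact_sub_rank[OF ex _ E(1) sr] AB regular_nonzero_dims[of r A] by (auto simp: regular_def)
  then show False using short_exact_dim2[OF ex] regular_nonzero_dims[OF AB(2,4)] by linarith
qed (use E in \<open>auto simp: zero_rep_def\<close>)

text \<open>A factor representation that is one-dimensional at vertex 2 is a sum of copies of the
  injective representations \<open>I(2)\<close> and \<open>I(1)\<close>, because its arrows are linearly independent
  functionals.\<close>

lemma elementary_if_injective_quotients:
  fixes E :: "'k::field kron_rep"
  assumes E: "is_rep r E" "2 \<le> dim2 E" and sr: "sub_rank r E (dim2 E - 1)"
    and qr: "quot_rank r E r" "dim1 E < 2 * r"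
    and r: "2 \<le> r" and cone: "dim2 E \<le> (r - 1) * dim1 E" "dim1 E \<le> (r - 1) * dim2 E"
  shows "elementary r E"
  unfolding elementary_def
proof (intro conjI notI)
  show "regular r E" using E by (intro regular_if_ranks[OF E(1) sr _ qr r cone]) simp
  assume "\<exists>A B f g. regular r A \<and> regular r B \<and> \<not> zero_rep A \<and> \<not> zero_rep B \<and> short_exact r A f E g B"
  then obtain A B f g where AB: "regular r A" "regular r B" "\<not> zero_rep A" "\<not> zero_rep B"
    and ex: "short_exact r A f E g B" by blast
  have rep: "is_rep r A" "is_rep r B" using AB by (auto simp: regular_def)
  have "dim2 E - 1 \<le> dim2 A"
    using short_exact_sub_rank[OF ex rep(1) E(1) sr] regular_nonzero_dims[OF AB(1,3)] by blast
  then have B2: "dim2 B = 1"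
    using short_exact_dim2[OF ex] regular_nonzero_dims[OF AB(2,4)] E(2) by linarith
  have B1: "r \<le> dim1 B" using short_exact_quot_rank[OF ex E(1) rep(2) qr(1)] B2 by simp
  let ?d = "dim1 B"
  have Bi: "arr B i \<in> carrier_mat 1 ?d" if "i < r" for i using rep(2) B2 that by (auto simp: is_rep_def)
  have ker: "v = 0\<^sub>v ?d" if "v \<in> carrier_vec ?d" "\<And>i. i < r \<Longrightarrow> arr B i *\<^sub>v v = 0\<^sub>v 1" for v
    using not_regular_kernel[OF rep(2) that(1)] that(2) AB(2) B2 by auto
  \<comment> \<open>The rows of \<open>H\<close> are the arrows of \<open>B\<close>. They are
    jointly injective, since otherwise \<open>B\<close> would have a simple injective summand. So
    \<open>?d \<le> r\<close>, and with \<open>B1\<close> the matrix \<open>H\<close> is square and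
    invertible; its transpose is the arrow matrix of the dual.\<close>
  define H where "H = mat r ?d (\<lambda>(i, p). arr B i $$ (0, p))"
  have H: "H \<in> carrier_mat r ?d" by (simp add: H_def)
  have Hinj: "mat_inj H"
  proof (rule mat_injI[OF H])
    fix v assume v: "v \<in> carrier_vec ?d" and z: "H *\<^sub>v v = 0\<^sub>v r"
    show "v = 0\<^sub>v ?d"
    proof (rule ker[OF v])
      fix i assume i: "i < r"
      have "row (arr B i) 0 = row H i" using Bi[OF i] i by (intro eq_vecI) (auto simp: H_def)
      then have "(arr B i *\<^sub>v v) $ 0 = (H *\<^sub>v v) $ i" using Bi[OF i] i H by simp
      then show "arr B i *\<^sub>v v = 0\<^sub>v 1" using z i Bi[OF i] by (intro eq_vecI) auto
    qed
  qed
  then have d: "?d = r" using mat_inj_le[OF _ H] B1 by simp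
  obtain K where K: "K \<in> carrier_mat r r" "H * K = 1\<^sub>m r"
    using mat_inj_square_inverse[OF Hinj] H d by auto
  have "arrow_mat r (dual_rep B) = H\<^sup>T"
  proof (rule eq_matI)
    fix p c assume "p < dim_row (H\<^sup>T)" "c < dim_col (H\<^sup>T)"
    then have pc: "p < ?d" "c < r" using H by auto
    then show "arrow_mat r (dual_rep B) $$ (p, c) = H\<^sup>T $$ (p, c)"
      using Bi[OF pc(2)] B2 by (simp add: arrow_mat_def dual_rep_def H_def)
  qed (use H B2 in \<open>auto simp: arrow_mat_def dual_rep_def\<close>)
  moreover have "K\<^sup>T * H\<^sup>T = 1\<^sub>m r" using transpose_mult[of H r r K r] H K d by simp
  ultimately have "mat_inj (arrow_mat r (dual_rep B))"
    using mat_inj_if_left_inverse[of "H\<^sup>T" r r "K\<^sup>T"] H K d by simp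
  then have "\<not> regular r B"
    using not_regular_injective_hull[OF rep(2) B2] ker d r by simp
  then show False using AB by blast
qed (use E in \<open>auto simp: zero_rep_def\<close>)

section \<open>Spans of the arrows and orbits\<close>

definition lin_comb :: "nat \<Rightarrow> 'k::field kron_rep \<Rightarrow> (nat \<Rightarrow> 'k) \<Rightarrow> 'k mat" where
  "lin_comb r E a = mat (dim2 E) (dim1 E) (\<lambda>(p, q). \<Sum>j<r. a j * arr E j $$ (p, q))"

text \<open>A twist by an element of \<open>GL r\<close> replaces the arrows by invertible linear
  combinations of them, so the span is constant on orbits up to base change at the two vertices. All
  comparisons of orbits are made on it.\<close>

definition arrow_span :: "nat \<Rightarrow> 'k::field kron_rep \<Rightarrow> 'k mat set" where
  "arrow_span r E = range (lin_comb r E)"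

definition mat_space_equiv :: "nat \<Rightarrow> nat \<Rightarrow> 'k::field mat set \<Rightarrow> 'k mat set \<Rightarrow> bool" where
  "mat_space_equiv n m X Y \<longleftrightarrow> (\<exists>R R' P P'. R \<in> carrier_mat n n \<and> R' \<in> carrier_mat n n \<and>
     P \<in> carrier_mat m m \<and> P' \<in> carrier_mat m m \<and> R * R' = 1\<^sub>m n \<and> R' * R = 1\<^sub>m n \<and>
     P * P' = 1\<^sub>m m \<and> P' * P = 1\<^sub>m m \<and> (\<lambda>M. R * M * P) ` X = Y)"

lemma lin_comb_carrier [simp]: "lin_comb r E a \<in> carrier_mat (dim2 E) (dim1 E)"
  by (simp add: lin_comb_def)

lemma arrow_span_carrier: "arrow_span r E \<subseteq> carrier_mat (dim2 E) (dim1 E)"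
  by (auto simp: arrow_span_def)

lemma mat_space_equiv_refl:
  fixes X :: "'k::field mat set"
  assumes "X \<subseteq> carrier_mat n m"
  shows "mat_space_equiv n m X X"
proof -
  have "(\<lambda>M. 1\<^sub>m n * M * 1\<^sub>m m) ` X = (\<lambda>M. M) ` X"
    using assms by (intro image_cong) auto
  then show ?thesis
    unfolding mat_space_equiv_def
    by (intro exI[of _ "1\<^sub>m n"] exI[of _ "1\<^sub>m m"]) simp
qed

lemma mult_sandwich:
  fixes M :: "'k::field mat"
  assumes "M \<in> carrier_mat n m" "R \<in> carrier_mat n n" "P \<in> carrier_mat m m"
    "S \<in> carrier_mat n n" "Q \<in> carrier_mat m m"
  shows "S * (R * M * P) * Q = (S * R) * M * (P * Q)"
proof -
  have "S * (R * M * P) = S * R * M * P" using assms by (simp add: assoc_mult_mat[of _ n n _ m] assoc_mult_mat[of _ n m])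
  then show ?thesis using assms by (simp add: assoc_mult_mat[of _ n m _ m])
qed

lemma mult_right_inverses:
  fixes A :: "'k::field mat"
  assumes "A \<in> carrier_mat k k" "A' \<in> carrier_mat k k" "B \<in> carrier_mat k k" "B' \<in> carrier_mat k k"
    "A * A' = 1\<^sub>m k" "B * B' = 1\<^sub>m k"
  shows "(A * B) * (B' * A') = 1\<^sub>m k"
proof -
  have "(A * B) * (B' * A') = A * (B * (B' * A'))"
    using assms by (intro assoc_mult_mat) auto
  also have "B * (B' * A') = (B * B') * A'"
    using assms by (intro assoc_mult_mat[symmetric]) auto
  finally show ?thesis using assms by simp
qed

lemma mat_space_equiv_sym:
  fixes X :: "'k::field mat set"
  assumes X: "X \<subseteq> carrier_mat n m" and XY: "mat_space_equiv n m X Y"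
  shows "mat_space_equiv n m Y X"
proof -
  obtain R R' P P' where c: "R \<in> carrier_mat n n" "R' \<in> carrier_mat n n" "P \<in> carrier_mat m m" "P' \<in> carrier_mat m m"
    and i: "R * R' = 1\<^sub>m n" "R' * R = 1\<^sub>m n" "P * P' = 1\<^sub>m m" "P' * P = 1\<^sub>m m"
    and Y: "(\<lambda>M. R * M * P) ` X = Y"
    using XY unfolding mat_space_equiv_def by blast
  have "R' * (R * M * P) * P' = M" if "M \<in> X" for M
    using mult_sandwich[of M n m R P R' P'] c i X that by auto
  then have "(\<lambda>M. R' * M * P') ` Y = X" unfolding Y[symmetric] by (force simp: image_iff)
  then show ?thesis unfolding mat_space_equiv_def using c i by blast
qed

lemma mat_space_equiv_trans:
  fixes X :: "'k::field mat set"
  assumes X: "X \<subseteq> carrier_mat n m" and XY: "mat_space_equiv n m X Y" and YZ: "mat_space_equiv n m Y Z"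
  shows "mat_space_equiv n m X Z"
proof -
  obtain R R' P P' where c: "R \<in> carrier_mat n n" "R' \<in> carrier_mat n n" "P \<in> carrier_mat m m" "P' \<in> carrier_mat m m"
    and i: "R * R' = 1\<^sub>m n" "R' * R = 1\<^sub>m n" "P * P' = 1\<^sub>m m" "P' * P = 1\<^sub>m m"
    and Y: "(\<lambda>M. R * M * P) ` X = Y"
    using XY unfolding mat_space_equiv_def by blast
  obtain S S' Q Q' where c': "S \<in> carrier_mat n n" "S' \<in> carrier_mat n n" "Q \<in> carrier_mat m m" "Q' \<in> carrier_mat m m"
    and i': "S * S' = 1\<^sub>m n" "S' * S = 1\<^sub>m n" "Q * Q' = 1\<^sub>m m" "Q' * Q = 1\<^sub>m m"
    and Z: "(\<lambda>M. S * M * Q) ` Y = Z"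
    using YZ unfolding mat_space_equiv_def by blast
  have "S * (R * M * P) * Q = (S * R) * M * (P * Q)" if "M \<in> X" for M
    using mult_sandwich[of M n m R P S Q] c c' X that by auto
  then have img: "(\<lambda>M. (S * R) * M * (P * Q)) ` X = Z"
    unfolding Z[symmetric] Y[symmetric] by (simp add: image_image)
  have inv: "(S * R) * (R' * S') = 1\<^sub>m n" "(R' * S') * (S * R) = 1\<^sub>m n"
    "(P * Q) * (Q' * P') = 1\<^sub>m m" "(Q' * P') * (P * Q) = 1\<^sub>m m"
    using c c' i i' by (intro mult_right_inverses; simp)+
  have "S * R \<in> carrier_mat n n" "R' * S' \<in> carrier_mat n n" "P * Q \<in> carrier_mat m m" "Q' * P' \<in> carrier_mat m m"
    using c c' by auto
  then show ?thesis unfolding mat_space_equiv_def using img inv by blast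
qed

lemma sandwich_index:
  fixes M :: "'k::field mat"
  assumes "M \<in> carrier_mat n m" "R \<in> carrier_mat n n" "P \<in> carrier_mat m m" "p < n" "q < m"
  shows "(R * M * P) $$ (p, q) = (\<Sum>l<m. \<Sum>k<n. R $$ (p, k) * M $$ (k, l) * P $$ (l, q))"
proof -
  have "R * M * P = R * (M * P)" using assms by (intro assoc_mult_mat) auto
  then have "(R * M * P) $$ (p, q) = (\<Sum>k<n. \<Sum>l<m. R $$ (p, k) * M $$ (k, l) * P $$ (l, q))"
    using assms by (simp add: scalar_prod_def sum_distrib_left atLeast0LessThan mult.assoc)
  then show ?thesis by (simp add: sum.swap[of _ "{..<m}"])
qed

lemma sandwich_lin_comb:
  fixes E F :: "'k::field kron_rep"
  assumes R: "R \<in> carrier_mat (dim2 E) (dim2 E)" and P: "P \<in> carrier_mat (dim1 E) (dim1 E)"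
    and E: "is_rep r E" and dims: "dim1 F = dim1 E" "dim2 F = dim2 E"
    and eq: "\<And>j. j < r \<Longrightarrow> R * arr E j * P = arr F j"
  shows "R * lin_comb r E a * P = lin_comb r F a"
proof (rule eq_matI)
  fix p q assume "p < dim_row (lin_comb r F a)" "q < dim_col (lin_comb r F a)"
  then have pq: "p < dim2 E" "q < dim1 E" using dims by (auto simp: lin_comb_def)
  have "(R * lin_comb r E a * P) $$ (p, q) =
      (\<Sum>l<dim1 E. \<Sum>k<dim2 E. \<Sum>j<r. a j * (R $$ (p, k) * arr E j $$ (k, l) * P $$ (l, q)))"
    unfolding sandwich_index[OF lin_comb_carrier R P pq]
    by (intro sum.cong refl) (simp add: lin_comb_def sum_distrib_left sum_distrib_right mult_ac)
  also have "\<dots> = (\<Sum>l<dim1 E. \<Sum>j<r. \<Sum>k<dim2 E. a j * (R $$ (p, k) * arr E j $$ (k, l) * P $$ (l, q)))"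
    by (intro sum.cong refl sum.swap)
  also have "\<dots> = (\<Sum>j<r. \<Sum>l<dim1 E. \<Sum>k<dim2 E. a j * (R $$ (p, k) * arr E j $$ (k, l) * P $$ (l, q)))"
    by (rule sum.swap)
  also have "\<dots> = (\<Sum>j<r. a j * arr F j $$ (p, q))"
  proof (intro sum.cong refl)
    fix j assume "j \<in> {..<r}"
    then have j: "j < r" by simp
    have Ej: "arr E j \<in> carrier_mat (dim2 E) (dim1 E)" using E j by (simp add: is_rep_def)
    show "(\<Sum>l<dim1 E. \<Sum>k<dim2 E. a j * (R $$ (p, k) * arr E j $$ (k, l) * P $$ (l, q))) = a j * arr F j $$ (p, q)"
      using sandwich_index[OF Ej R P pq] eq[OF j] by (simp add: sum_distrib_left)
  qed
  finally show "(R * lin_comb r E a * P) $$ (p, q) = lin_comb r F a $$ (p, q)"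
    using pq dims by (simp add: lin_comb_def)
qed (use R P dims in \<open>auto simp: lin_comb_def\<close>)

lemma rep_iso_imp_equiv:
  fixes E F :: "'k::field kron_rep"
  assumes "rep_iso r E F"
  shows "mat_space_equiv (dim2 E) (dim1 E) (arrow_span r E) (arrow_span r F)"
proof -
  have dims: "dim1 F = dim1 E" "dim2 F = dim2 E" using rep_iso_dims[OF assms] by auto
  obtain f where rep: "is_rep r E" and f: "rep_hom r E F f" "invertible_mat (fst f)" "invertible_mat (snd f)"
    using assms unfolding rep_iso_def by blast
  have f1: "fst f \<in> carrier_mat (dim1 E) (dim1 E)" and f2: "snd f \<in> carrier_mat (dim2 E) (dim2 E)"
    using f(1) dims unfolding rep_hom_def by auto
  obtain G where G: "G \<in> carrier_mat (dim1 E) (dim1 E)" "fst f * G = 1\<^sub>m (dim1 E)" "G * fst f = 1\<^sub>m (dim1 E)"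
    using invertible_matE[OF f1 f(2)] by metis
  obtain H where H: "H \<in> carrier_mat (dim2 E) (dim2 E)" "snd f * H = 1\<^sub>m (dim2 E)" "H * snd f = 1\<^sub>m (dim2 E)"
    using invertible_matE[OF f2 f(3)] by metis
  have "snd f * arr E j * G = arr F j" if j: "j < r" for j
  proof -
    have F: "arr F j \<in> carrier_mat (dim2 E) (dim1 E)"
      using assms j dims unfolding rep_iso_def is_rep_def by auto
    have "snd f * arr E j * G = arr F j * fst f * G" using f(1) j by (simp add: rep_hom_def)
    also have "\<dots> = arr F j * (fst f * G)" by (rule assoc_mult_mat[OF F f1 G(1)])
    finally show ?thesis using G(2) F by simp
  qed
  then have "snd f * lin_comb r E a * G = lin_comb r F a" for a
    by (rule sandwich_lin_comb[OF f2 G(1) rep dims])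
  then have "(\<lambda>M. snd f * M * G) ` arrow_span r E = arrow_span r F"
    by (simp add: arrow_span_def image_image)
  then show ?thesis unfolding mat_space_equiv_def using f2 H G f1 by blast
qed

section \<open>Invariance of the arrow span and choice of representatives\<close>

lemma GL_inverse:
  assumes "g \<in> GL r"
  obtains H where "mat_inverse g = Some H" "H \<in> carrier_mat r r" "g * H = 1\<^sub>m r" "H * g = 1\<^sub>m r"
proof -
  have g: "g \<in> carrier_mat r r" "invertible_mat g" using assms by (auto simp: GL_def)
  obtain B where "B \<in> carrier_mat r r" "g * B = 1\<^sub>m r" "B * g = 1\<^sub>m r"
    using invertible_matE[OF g] by metis
  then have "g \<in> Units (ring_mat TYPE('a) r ())" using g(1) by (auto simp: Units_def ring_mat_def)
  then obtain H where "mat_inverse g = Some H" using mat_inverse(1)[OF g(1), where b = "()"] by (cases "mat_inverse g") auto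
  then show thesis using mat_inverse(2)[OF g(1)] that by blast
qed

lemma twist_dims [simp]: "dim1 (twist r g M) = dim1 M" "dim2 (twist r g M) = dim2 M"
  by (simp_all add: twist_def)

lemma is_rep_twist [simp]: "is_rep r (twist r' g M)"
  by (simp add: is_rep_def twist_def)

lemma arrow_span_twist:
  fixes M :: "'k::field kron_rep"
  assumes g: "g \<in> GL r"
  shows "arrow_span r (twist r g M) = arrow_span r M"
proof -
  obtain H where H: "mat_inverse g = Some H" "H \<in> carrier_mat r r" "g * H = 1\<^sub>m r" "H * g = 1\<^sub>m r"
    using GL_inverse[OF g] .
  have gc: "g \<in> carrier_mat r r" using g by (simp add: GL_def)
  have lin: "lin_comb r (twist r g M) a = lin_comb r M (\<lambda>j. \<Sum>i<r. H $$ (j, i) * a i)" for a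
  proof (rule eq_matI)
    fix p q assume "p < dim_row (lin_comb r M (\<lambda>j. \<Sum>i<r. H $$ (j, i) * a i))"
      "q < dim_col (lin_comb r M (\<lambda>j. \<Sum>i<r. H $$ (j, i) * a i))"
    then have pq: "p < dim2 M" "q < dim1 M" by (auto simp: lin_comb_def)
    have "lin_comb r (twist r g M) a $$ (p, q) = (\<Sum>i<r. \<Sum>j<r. H $$ (j, i) * a i * arr M j $$ (p, q))"
      using pq H(1) by (simp add: lin_comb_def twist_def sum_distrib_left mult_ac)
    also have "\<dots> = (\<Sum>j<r. \<Sum>i<r. H $$ (j, i) * a i * arr M j $$ (p, q))" by (rule sum.swap)
    finally show "lin_comb r (twist r g M) a $$ (p, q) = lin_comb r M (\<lambda>j. \<Sum>i<r. H $$ (j, i) * a i) $$ (p, q)"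
      using pq by (simp add: lin_comb_def sum_distrib_right)
  qed (auto simp: lin_comb_def)
  have "lin_comb r M b \<in> arrow_span r (twist r g M)" for b
  proof -
    \<comment> \<open>The twist acts on coefficients by the inverse \<open>H\<close> of
      \<open>g\<close>, so the coefficients \<open>g b\<close> recover \<open>b\<close>.\<close>
    define a where "a i = (\<Sum>k<r. g $$ (i, k) * b k)" for i
    have "(\<Sum>i<r. H $$ (j, i) * a i) = b j" if j: "j < r" for j
    proof -
      have "(\<Sum>i<r. H $$ (j, i) * a i) = (\<Sum>i<r. \<Sum>k<r. H $$ (j, i) * g $$ (i, k) * b k)"
        by (simp add: a_def sum_distrib_left mult.assoc)
      also have "\<dots> = (\<Sum>k<r. \<Sum>i<r. H $$ (j, i) * g $$ (i, k) * b k)" by (rule sum.swap)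
      also have "\<dots> = (\<Sum>k<r. (H * g) $$ (j, k) * b k)"
        using H(2) gc j by (intro sum.cong refl) (simp add: scalar_prod_def atLeast0LessThan sum_distrib_right)
      also have "\<dots> = (\<Sum>k<r. if k = j then b k else 0)"
        using j unfolding H(4) by (intro sum.cong refl) auto
      also have "\<dots> = b j" using j by simp
      finally show ?thesis .
    qed
    then have "lin_comb r (twist r g M) a = lin_comb r M b"
      unfolding lin by (intro eq_matI) (auto simp: lin_comb_def)
    then show ?thesis unfolding arrow_span_def by (metis rangeI)
  qed
  then show ?thesis unfolding arrow_span_def by (auto simp: lin)
qed

lemma one_in_GL: "1\<^sub>m r \<in> GL r"
  by (simp add: GL_def)

lemma GL_orbit_eq_imp_equiv:
  fixes E F :: "'k::field kron_rep"
  assumes "GL_orbit r E = GL_orbit r F"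
  shows "mat_space_equiv (dim2 F) (dim1 F) (arrow_span r F) (arrow_span r E)"
proof -
  \<comment> \<open>The identity twist provides an explicit member of the first orbit; equality of
    orbits places it in the second one.\<close>
  let ?E = "twist r (1\<^sub>m r) E"
  have "iso_class r ?E \<in> GL_orbit r F" using assms one_in_GL[of r] unfolding GL_orbit_def by blast
  then obtain g where g: "g \<in> GL r" "iso_class r ?E = iso_class r (twist r g F)"
    unfolding GL_orbit_def by blast
  have "rep_iso r ?E ?E" by (rule rep_iso_eqI) auto
  then have "rep_iso r (twist r g F) ?E" using g(2) unfolding iso_class_def by blast
  then show ?thesis
    using rep_iso_imp_equiv[of r "twist r g F" ?E] arrow_span_twist[OF g(1), of F]
      arrow_span_twist[OF one_in_GL, of r E] by simp
qed

text \<open>An infinite parameter set with finite equivalence classes has infinitely many classes,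
  and \<open>T\<close> selects one parameter from each. Isomorphism and equality of orbits both
  imply equivalence of the spans, so the selected representations are separated in both
  senses.\<close>

lemma infinitely_many_orbits:
  fixes E :: "'c \<Rightarrow> 'k::field kron_rep"
  assumes inf: "infinite C" and dims: "\<And>c. c \<in> C \<Longrightarrow> dim1 (E c) = x \<and> dim2 (E c) = y"
    and el: "\<And>c. c \<in> C \<Longrightarrow> elementary r (E c)"
    and fin: "\<And>c. c \<in> C \<Longrightarrow> finite {c' \<in> C. mat_space_equiv y x (arrow_span r (E c')) (arrow_span r (E c))}"
  shows "\<exists>S :: 'k kron_rep set. infinite S \<and> (\<forall>E\<in>S. elementary r E \<and> dim_vector E = (x, y)) \<and>
    (\<forall>E\<in>S. \<forall>F\<in>S. E \<noteq> F \<longrightarrow> \<not> rep_iso r E F) \<and> inj_on (GL_orbit r) S"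
proof -
  define \<phi> where "\<phi> c = {c' \<in> C. mat_space_equiv y x (arrow_span r (E c')) (arrow_span r (E c))}" for c
  have carr: "arrow_span r (E c) \<subseteq> carrier_mat y x" if "c \<in> C" for c
    using arrow_span_carrier[of r "E c"] dims[OF that] by simp
  have \<phi>_eq: "\<phi> c = \<phi> d" if cd: "c \<in> C" "d \<in> C" and "mat_space_equiv y x (arrow_span r (E c)) (arrow_span r (E d))" for c d
    unfolding \<phi>_def using mat_space_equiv_trans carr mat_space_equiv_sym[OF carr[OF cd(1)]] that by blast
  have self: "c \<in> \<phi> c" if "c \<in> C" for c unfolding \<phi>_def using mat_space_equiv_refl[OF carr] that by blast
  have infphi: "infinite (\<phi> ` C)"
  proof
    assume "finite (\<phi> ` C)"
    moreover have "\<forall>Z\<in>\<phi> ` C. finite Z" using fin unfolding \<phi>_def by blast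
    ultimately have "finite (\<Union> (\<phi> ` C))" by blast
    moreover have "C \<subseteq> \<Union> (\<phi> ` C)" using self by blast
    ultimately show False using inf finite_subset by blast
  qed
  have "\<exists>U. U \<subseteq> C \<and> inj_on \<phi> U \<and> \<phi> ` C = \<phi> ` U"
    by (rule subset_image_inj[THEN iffD1, OF subset_refl])
  then obtain T where T: "T \<subseteq> C" "inj_on \<phi> T" "\<phi> ` C = \<phi> ` T" by metis
  then have infT: "infinite T" using infphi finite_imageI by metis
  have inj: "c = d" if cd: "c \<in> T" "d \<in> T" and "mat_space_equiv y x (arrow_span r (E c)) (arrow_span r (E d))" for c d
    using \<phi>_eq[of c d] that T by (auto dest: inj_onD)
  have "inj_on E T"
  proof (rule inj_onI)
    fix c d assume "c \<in> T" "d \<in> T" "E c = E d"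
    then show "c = d" using inj[of c d] mat_space_equiv_refl[OF carr[of d]] T(1) by auto
  qed
  then have "infinite (E ` T)" using infT finite_imageD by blast
  moreover have "\<not> rep_iso r (E c) (E d)" if "c \<in> T" "d \<in> T" "E c \<noteq> E d" for c d
  proof
    assume "rep_iso r (E c) (E d)"
    then have "c = d" 
      using rep_iso_imp_equiv[of r "E c" "E d"] inj[of c d] that T(1) dims[of c] by auto
    then show False using that by simp
  qed
  moreover have "inj_on (GL_orbit r) (E ` T)"
  proof (rule inj_onI)
    fix X Y assume "X \<in> E ` T" "Y \<in> E ` T" and eq: "GL_orbit r X = GL_orbit r Y"
    then obtain c d where cd: "c \<in> T" "d \<in> T" "X = E c" "Y = E d" by blast
    have "mat_space_equiv y x (arrow_span r (E d)) (arrow_span r (E c))"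
      using GL_orbit_eq_imp_equiv[OF eq] cd T(1) dims by auto
    then show "X = Y" using inj cd by blast
  qed
  ultimately show ?thesis
    using el dims T(1) by (intro exI[of _ "E ` T"]) (auto simp: dim_vector_def)
qed

section \<open>The case of at least five arrows\<close>

text \<open>Over a finite field the product of all X - a, plus 1, takes only the value 1 and so has
  no root.\<close>

lemma infinite_alg_closed_field: "infinite (UNIV :: 'k::alg_closed_field set)"
proof
  assume fin: "finite (UNIV :: 'k set)"
  define p :: "'k poly" where "p = (\<Prod>a\<in>UNIV. [:- a, 1:]) + 1"
  have val: "poly p x = 1" for x
    using fin by (simp add: p_def poly_prod prod_zero_iff)
  have "degree (\<Prod>a\<in>UNIV. [:- a, 1 :: 'k:]) = card (UNIV :: 'k set)"
    by (subst degree_prod_eq_sum_degree) auto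
  moreover have "0 < card (UNIV :: 'k set)" using fin by (simp add: card_gt_0_iff)
  ultimately have "0 < degree p" unfolding p_def by (subst degree_add_eq_left) auto
  then obtain x where "poly p x = 0" using alg_closed_imp_poly_has_root by blast
  then show False using val by simp
qed

lemma ball_less_3: "(\<forall>i<3::nat. Q i) \<longleftrightarrow> Q 0 \<and> Q 1 \<and> Q 2"
  by (auto simp: numeral_3_eq_3 numeral_2_eq_2 less_Suc_eq)

lemma sum_less_3: "(\<Sum>i<3::nat. f i) = f 0 + f 1 + (f 2 :: 'k::field)"
  by (simp add: numeral_3_eq_3 numeral_2_eq_2)

lemma vec_3_eq_zero:
  assumes "v \<in> carrier_vec 3" "v $ 0 = 0" "v $ 1 = 0" "v $ 2 = (0 :: 'k::field)"
  shows "v = 0\<^sub>v 3"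
  using assms by (intro eq_vecI) (auto simp: numeral_3_eq_3 numeral_2_eq_2 less_Suc_eq)

text \<open>The coefficients are chosen such that the lowest terms of \<open>w\<close> and \<open>v\<close> always survive in
  the bilinear forms \<open>\<Sum>i+j=k. hankel_coeff q i j * w_i * v_j\<close>; the only modulus is \<open>q\<close>.\<close>

definition hankel_coeff :: "'k::field \<Rightarrow> nat \<Rightarrow> nat \<Rightarrow> 'k" where
  "hankel_coeff q i j = (if i = 2 \<and> j = 0 then q else 1)"

text \<open>For \<open>q = 1\<close> these are the Hankel matrices, and the arrows compute the
  coefficients of the product of two polynomials of degree at most 2.\<close>

definition hankel_mat :: "'k::field \<Rightarrow> (nat \<Rightarrow> 'k) \<Rightarrow> 'k mat" where
  "hankel_mat q g = mat 3 3 (\<lambda>(i, j). hankel_coeff q i j * g (i + j))"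

definition hankel_rep :: "'k::field \<Rightarrow> 'k kron_rep" where
  "hankel_rep q = \<lparr>dim1 = 3, dim2 = 3, arr = (\<lambda>k. hankel_mat q (\<lambda>n. if n = k then 1 else 0))\<rparr>"

lemma hankel_rep_dims [simp]: "dim1 (hankel_rep q) = 3" "dim2 (hankel_rep q) = 3"
  by (simp_all add: hankel_rep_def)

lemma hankel_mat_carrier [simp]: "hankel_mat q g \<in> carrier_mat 3 3"
  by (simp add: hankel_mat_def)

lemma is_rep_hankel: "is_rep r (hankel_rep q)"
  by (simp add: is_rep_def hankel_rep_def)

lemma arrow_span_hankel:
  fixes q :: "'k::field"
  assumes "5 \<le> r"
  shows "arrow_span r (hankel_rep q) = range (hankel_mat q)"
proof -
  have "lin_comb r (hankel_rep q) g = hankel_mat q g" for g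
  proof (rule eq_matI)
    fix i j assume "i < dim_row (hankel_mat q g)" "j < dim_col (hankel_mat q g)"
    then have ij: "i < 3" "j < 3" by (auto simp: hankel_mat_def)
    have "(\<Sum>k<r. g k * (hankel_coeff q i j * (if i + j = k then 1 else 0))) =
      (\<Sum>k<r. if i + j = k then hankel_coeff q i j * g k else 0)"
      by (intro sum.cong) auto
    also have "\<dots> = hankel_coeff q i j * g (i + j)" using ij assms by simp
    finally show "lin_comb r (hankel_rep q) g $$ (i, j) = hankel_mat q g $$ (i, j)"
      using ij by (simp add: lin_comb_def hankel_rep_def hankel_mat_def)
  qed (auto simp: lin_comb_def hankel_rep_def hankel_mat_def)
  then show ?thesis unfolding arrow_span_def by simp
qed

lemma hankel_nonsingular:
  fixes q :: "'k::field"
  assumes q: "q \<noteq> 0" and w: "w \<in> carrier_vec 3" and v: "v \<in> carrier_vec 3"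
    and zero: "\<And>k. k < 5 \<Longrightarrow> w \<bullet> (arr (hankel_rep q) k *\<^sub>v v) = 0"
  shows "w = 0\<^sub>v 3 \<or> v = 0\<^sub>v 3"
proof -
  have form: "w \<bullet> (arr (hankel_rep q) k *\<^sub>v v) =
    (\<Sum>i<3. \<Sum>j<3. w $ i * (hankel_coeff q i j * (if i + j = k then 1 else 0) * v $ j))" for k
    using w v by (simp add: scalar_prod_def hankel_rep_def hankel_mat_def atLeast0LessThan sum_distrib_left)
  have "w $ 0 * v $ 0 = 0" "w $ 0 * v $ 1 + w $ 1 * v $ 0 = 0"
    "w $ 0 * v $ 2 + w $ 1 * v $ 1 + w $ 2 * (q * v $ 0) = 0"
    "w $ 1 * v $ 2 + w $ 2 * v $ 1 = 0" "w $ 2 * v $ 2 = 0"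
    using zero[of 0] zero[of 1] zero[of 2] zero[of 3] zero[of 4]
    unfolding form by (simp_all add: sum_less_3 hankel_coeff_def)
  then have "w $ 0 = 0 \<and> w $ 1 = 0 \<and> w $ 2 = 0 \<or> v $ 0 = 0 \<and> v $ 1 = 0 \<and> v $ 2 = 0"
    using q by auto
  then show ?thesis using vec_3_eq_zero w v by blast
qed

lemma not_spanning_annihilator:
  fixes B :: "'k::field mat"
  assumes B: "B \<in> carrier_mat n b" and "b < n"
  shows "\<exists>w\<in>carrier_vec n. w \<noteq> 0\<^sub>v n \<and> (\<forall>y\<in>mat_range B. w \<bullet> y = 0)"
proof -
  obtain w where w: "w \<in> carrier_vec n" "w \<noteq> 0\<^sub>v n" "B\<^sup>T *\<^sub>v w = 0\<^sub>v b"
    using exists_kernel_vec[of "B\<^sup>T" b n] assms by auto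
  have "w \<bullet> (B *\<^sub>v x) = 0" if "x \<in> carrier_vec b" for x
    using scalar_prod_mult_transpose[OF B w(1) that] w(3) that by simp
  then show ?thesis using w B unfolding mat_range_def by auto
qed

text \<open>Both rank bounds follow from the absence of zero divisors: too small a subrepresentation
  leaves a functional \<open>w\<close> annihilating the images of \<open>v\<close>, and too small a
  factor leaves a vector \<open>e\<close> killed by \<open>C\<close>, on which \<open>w\<close>
  vanishes after every arrow.\<close>

lemma elementary_hankel:
  fixes q :: "'k::field"
  assumes q: "q \<noteq> 0" and r: "5 \<le> r"
  shows "elementary r (hankel_rep q)"
proof (rule elementary_if_generated[OF is_rep_hankel])
  show "sub_rank r (hankel_rep q) (dim2 (hankel_rep q))"
    unfolding sub_rank_def
  proof (intro allI impI)
    fix v :: "'k vec" and B b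
    assume v: "v \<in> carrier_vec (dim1 (hankel_rep q))" "v \<noteq> 0\<^sub>v (dim1 (hankel_rep q))"
      and B: "B \<in> carrier_mat (dim2 (hankel_rep q)) b"
      and rng: "\<forall>i<r. arr (hankel_rep q) i *\<^sub>v v \<in> mat_range B"
    show "dim2 (hankel_rep q) \<le> b"
    proof (rule ccontr)
      assume "\<not> dim2 (hankel_rep q) \<le> b"
      then obtain w where "w \<in> carrier_vec 3" "w \<noteq> 0\<^sub>v 3" "\<forall>y\<in>mat_range B. w \<bullet> y = 0"
        using not_spanning_annihilator[OF B] by auto
      then show False using hankel_nonsingular[OF q, of w v] v rng r by auto
    qed
  qed
  show "quot_rank r (hankel_rep q) 3"
    unfolding quot_rank_def
  proof (intro allI impI)
    fix w :: "'k vec" and C d h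
    assume w: "w \<in> carrier_vec (dim2 (hankel_rep q))" "w \<noteq> 0\<^sub>v (dim2 (hankel_rep q))"
      and C: "C \<in> carrier_mat d (dim1 (hankel_rep q))"
      and h: "\<forall>i<r. h i \<in> carrier_vec d \<and>
        (\<forall>e\<in>carrier_vec (dim1 (hankel_rep q)). w \<bullet> (arr (hankel_rep q) i *\<^sub>v e) = h i \<bullet> (C *\<^sub>v e))"
    show "3 \<le> d"
    proof (rule ccontr)
      assume "\<not> 3 \<le> d"
      then obtain e where e: "e \<in> carrier_vec 3" "e \<noteq> 0\<^sub>v 3" "C *\<^sub>v e = 0\<^sub>v d"
        using exists_kernel_vec[OF C] by auto
      then have "w \<bullet> (arr (hankel_rep q) i *\<^sub>v e) = 0" if "i < 5" for i
        using h r that by simp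
      then show False using hankel_nonsingular[OF q, of w e] w e by auto
    qed
  qed
qed (use r in auto)

lemma hankel_entries:
  assumes "\<forall>i<3. \<forall>j<3. F i j = hankel_coeff q i j * a (i + j)"
  shows "F 0 0 = a 0" "F 0 1 = a 1" "F 0 2 = a 2" "F 1 0 = a 1" "F 1 1 = a 2" "F 1 2 = a 3"
    "F 2 0 = q * a 2" "F 2 1 = a 3" "F 2 2 = a 4"
  using assms unfolding ball_less_3 hankel_coeff_def by (simp_all add: numeral_eq_Suc)

text \<open>On the rational normal curve of the case \<open>q = 1\<close> the three entries with
  \<open>i + j = 2\<close> agree. The twist makes the 2 by 2 minors give
  \<open>m * m = q * (m * m)\<close> for the middle entry \<open>m = u 1 * s 1\<close>, so
  \<open>m = 0\<close>, and only the two end points of the curve remain.\<close>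

lemma rank_one_hankel:
  fixes q :: "'k::field"
  assumes q: "q \<noteq> 0" "q \<noteq> 1"
    and eq: "\<forall>i<3. \<forall>j<3. u i * s j = hankel_coeff q i j * a (i + j)"
    and nz: "\<exists>i<3. u i \<noteq> 0" "\<exists>j<3. s j \<noteq> 0"
  shows "u 0 \<noteq> 0 \<and> s 0 \<noteq> 0 \<and> u 1 = 0 \<and> u 2 = 0 \<and> s 1 = 0 \<and> s 2 = 0 \<or>
    u 2 \<noteq> 0 \<and> s 2 \<noteq> 0 \<and> u 0 = 0 \<and> u 1 = 0 \<and> s 0 = 0 \<and> s 1 = 0"
proof -
  have e: "u 0 * s 1 = u 1 * s 0" "u 0 * s 2 = u 1 * s 1" "u 2 * s 0 = q * (u 1 * s 1)" "u 1 * s 2 = u 2 * s 1"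
    using hankel_entries[OF eq] by simp_all
  have n: "u 0 \<noteq> 0 \<or> u 1 \<noteq> 0 \<or> u 2 \<noteq> 0" "s 0 \<noteq> 0 \<or> s 1 \<noteq> 0 \<or> s 2 \<noteq> 0"
    using nz by (auto simp: numeral_3_eq_3 numeral_2_eq_2 less_Suc_eq)
  have u1: "u 1 = 0"
  proof (rule ccontr)
    assume u1: "u 1 \<noteq> 0"
    show False
    proof (cases "s 1 = 0")
      case True
      then show False using e n u1 by auto
    next
      case False
      have "u 1 * s 1 * (u 1 * s 1) = u 0 * s 2 * (u 1 * s 1)" using e(2) by simp
      also have "\<dots> = (u 0 * s 1) * (u 1 * s 2)" by (simp add: mult_ac)
      also have "\<dots> = (u 1 * s 0) * (u 2 * s 1)" using e(1,4) by simp
      also have "\<dots> = (u 1 * s 1) * (u 2 * s 0)" by (simp add: mult_ac)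
      also have "\<dots> = q * (u 1 * s 1 * (u 1 * s 1))" using e(3) by (simp add: mult_ac)
      finally show False using q u1 False by simp
    qed
  qed
  then show ?thesis using e n by auto
qed

text \<open>Eliminates \<open>c\<close>, which in both applications is the middle entry of the base
  change at vertex 2, between the conditions coming from arrows 1 and 3.\<close>

lemma cross_mult_eq:
  fixes a :: "'k::field"
  assumes "a * b = c * d" "c * e = f * b"
  shows "b * (f * d) = b * (a * e)"
proof -
  have "b * (f * d) = (f * b) * d" by (simp only: mult_ac)
  also have "\<dots> = (c * e) * d" by (simp only: assms)
  also have "\<dots> = (c * d) * e" by (simp only: mult_ac)
  also have "\<dots> = b * (a * e)" by (simp only: assms(1)[symmetric] mult_ac)
  finally show ?thesis .
qed

text \<open>Arrows 0 and 4 are matrix units, so an equivalence sends them to the two rank-one lines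
  of the target, in the same or in exchanged order. Arrows 1 and 3 then tie the middle entries of
  \<open>R\<close> and \<open>P\<close> to the outer ones, and arrow 2 compares the moduli; the
  exchange inverts \<open>q\<close>.\<close>

lemma hankel_equiv:
  fixes q p :: "'k::field"
  assumes r: "5 \<le> r" and q: "q \<noteq> 0" and p: "p \<noteq> 0" "p \<noteq> 1"
    and eqv: "mat_space_equiv 3 3 (arrow_span r (hankel_rep q)) (arrow_span r (hankel_rep p))"
  shows "q = p \<or> q * p = 1"
proof -
  obtain R R' P P' where c: "R \<in> carrier_mat 3 3" "R' \<in> carrier_mat 3 3" "P \<in> carrier_mat 3 3" "P' \<in> carrier_mat 3 3"
    and inv: "R' * R = 1\<^sub>m 3" "P * P' = 1\<^sub>m 3"
    and img: "(\<lambda>M. R * M * P) ` range (hankel_mat q) = range (hankel_mat p)"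
    using eqv unfolding mat_space_equiv_def arrow_span_hankel[OF r] by blast
  define R1 where "R1 i j = R $$ (i, j)" for i j
  define P1 where "P1 i j = P $$ (i, j)" for i j
  have eqs: "\<exists>a. \<forall>i<3. \<forall>j<3. (\<Sum>l<3. \<Sum>m<3. R1 i m * (hankel_coeff q m l * (if m + l = k then 1 else 0)) * P1 l j)
      = hankel_coeff p i j * a (i + j)" for k
  proof -
    let ?M = "hankel_mat q (\<lambda>n. if n = k then 1 else 0)"
    obtain a where a: "R * ?M * P = hankel_mat p a" using img by blast
    have "(\<Sum>l<3. \<Sum>m<3. R1 i m * (hankel_coeff q m l * (if m + l = k then 1 else 0)) * P1 l j)
      = hankel_coeff p i j * a (i + j)" if ij: "i < 3" "j < 3" for i j
    proof -
      have "(R * ?M * P) $$ (i, j) = hankel_coeff p i j * a (i + j)"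
        unfolding a using ij by (simp add: hankel_mat_def)
      then show ?thesis
        unfolding sandwich_index[OF hankel_mat_carrier c(1,3) ij]
        by (simp add: hankel_mat_def R1_def P1_def)
    qed
    then show ?thesis by blast
  qed
  have Rcol: "\<exists>i<3. R1 i m \<noteq> 0" if m: "m < 3" for m
  proof (rule ccontr)
    assume "\<not> (\<exists>i<3. R1 i m \<noteq> 0)"
    then have "(R' * R) $$ (m, m) = 0" using c m by (simp add: scalar_prod_def R1_def)
    then show False using inv m by simp
  qed
  have Prow: "\<exists>j<3. P1 m j \<noteq> 0" if m: "m < 3" for m
  proof (rule ccontr)
    assume "\<not> (\<exists>j<3. P1 m j \<noteq> 0)"
    then have "(P * P') $$ (m, m) = 0" using c m by (simp add: scalar_prod_def P1_def)
    then show False using inv m by simp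
  qed
  obtain a0 where "\<forall>i<3. \<forall>j<3. R1 i 0 * P1 0 j = hankel_coeff p i j * a0 (i + j)"
    using eqs[of 0] by (auto simp: sum_less_3 hankel_coeff_def)
  note c0 = rank_one_hankel[OF p this Rcol[of 0] Prow[of 0], simplified]
  obtain a4 where "\<forall>i<3. \<forall>j<3. R1 i 2 * P1 2 j = hankel_coeff p i j * a4 (i + j)"
    using eqs[of 4] by (auto simp: sum_less_3 hankel_coeff_def)
  note c4 = rank_one_hankel[OF p this Rcol[of 2] Prow[of 2], simplified]
  \<comment> \<open>If columns 0 and 2 of \<open>R\<close> were supported on the same coordinate,
    they would be proportional, against invertibility. So arrows 0 and 4 go to different rank-one
    lines.\<close>
  have not_prop: "\<not> (R1 1 0 = 0 \<and> R1 1 2 = 0 \<and> R1 z 0 = 0 \<and> R1 z 2 = 0)" if z: "z = 0 \<or> z = 2" for z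
  proof
    assume zero: "R1 1 0 = 0 \<and> R1 1 2 = 0 \<and> R1 z 0 = 0 \<and> R1 z 2 = 0"
    define t where "t = 2 - z"
    have id: "(\<Sum>i<3. R' $$ (m, i) * R1 i l) = (if m = l then 1 else 0)" if "m < 3" "l < 3" for m l
    proof -
      have "(R' * R) $$ (m, l) = (\<Sum>i<3. R' $$ (m, i) * R1 i l)"
        using c that by (simp add: scalar_prod_def R1_def atLeast0LessThan)
      then show ?thesis using inv that by simp
    qed
    have "R' $$ (0, t) * R1 t 0 = 1" "R' $$ (2, t) * R1 t 2 = 1" "R' $$ (0, t) * R1 t 2 = 0"
      using id[of 0 0] id[of 2 2] id[of 0 2] zero z by (auto simp: sum_less_3 t_def)
    then show False by auto
  qed
  obtain a1 where a1: "\<forall>i<3. \<forall>j<3. R1 i 0 * P1 1 j + R1 i 1 * P1 0 j = hankel_coeff p i j * a1 (i + j)"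
    using eqs[of 1] by (auto simp: sum_less_3 hankel_coeff_def add.commute)
  obtain a3 where a3: "\<forall>i<3. \<forall>j<3. R1 i 1 * P1 2 j + R1 i 2 * P1 1 j = hankel_coeff p i j * a3 (i + j)"
    using eqs[of 3] by (auto simp: sum_less_3 hankel_coeff_def add.commute)
  obtain a2 where a2: "\<forall>i<3. \<forall>j<3. R1 i 0 * P1 2 j + R1 i 1 * P1 1 j + R1 i 2 * q * P1 0 j = hankel_coeff p i j * a2 (i + j)"
    using eqs[of 2] by (auto simp: sum_less_3 hankel_coeff_def add_ac)
  show ?thesis
  proof (cases "R1 0 0 = 0")
    case False
    then have d0: "P1 0 0 \<noteq> 0" "R1 1 0 = 0" "R1 2 0 = 0" "P1 0 1 = 0" "P1 0 2 = 0" using c0 by auto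
    then have d2: "R1 2 2 \<noteq> 0" "P1 2 2 \<noteq> 0" "R1 0 2 = 0" "R1 1 2 = 0" "P1 2 0 = 0" "P1 2 1 = 0"
      using c4 not_prop[of 2] by auto
    have e1: "R1 0 0 * P1 1 1 = R1 1 1 * P1 0 0"
      using hankel_entries[OF a1] d0 by simp
    have e3: "R1 1 1 * P1 2 2 = R1 2 2 * P1 1 1"
      using hankel_entries[OF a3] d2 by simp
    have e2: "R1 0 0 * P1 2 2 = R1 1 1 * P1 1 1" "R1 2 2 * q * P1 0 0 = p * (R1 1 1 * P1 1 1)"
      using hankel_entries[OF a1] hankel_entries[OF a3] hankel_entries[OF a2] d0 d2 False by auto
    have "P1 1 1 \<noteq> 0" using e2(1) False d2 by auto
    moreover have "P1 1 1 * (R1 2 2 * P1 0 0) = P1 1 1 * (R1 0 0 * P1 2 2)"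
      by (rule cross_mult_eq[OF e1 e3])
    ultimately have "R1 2 2 * P1 0 0 = R1 0 0 * P1 2 2" by simp
    then have "q * (R1 0 0 * P1 2 2) = R1 2 2 * q * P1 0 0" by (simp add: mult_ac)
    also have "\<dots> = p * (R1 0 0 * P1 2 2)" using e2 by simp
    finally show ?thesis using False d2 by simp
  next
    case True
    then have d0: "R1 2 0 \<noteq> 0" "P1 0 2 \<noteq> 0" "R1 0 0 = 0" "R1 1 0 = 0" "P1 0 0 = 0" "P1 0 1 = 0" using c0 by auto
    then have d2: "R1 0 2 \<noteq> 0" "P1 2 0 \<noteq> 0" "R1 1 2 = 0" "R1 2 2 = 0" "P1 2 1 = 0" "P1 2 2 = 0"
      using c4 not_prop[of 0] by auto
    have e1: "R1 1 1 * P1 0 2 = R1 2 0 * P1 1 1"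
      using hankel_entries[OF a1] d0 by simp
    have e3: "R1 0 2 * P1 1 1 = R1 1 1 * P1 2 0"
      using hankel_entries[OF a3] d2 by simp
    \<comment> \<open>The exchange moves the corner of arrow 2 that carries \<open>q\<close> to
      position (0, 2), where the target has coefficient 1, while the other corner meets the
      coefficient \<open>p\<close>.\<close>
    have e2: "R1 0 2 * q * P1 0 2 = R1 1 1 * P1 1 1" "R1 2 0 * P1 2 0 = p * (R1 1 1 * P1 1 1)"
      using hankel_entries[OF a1] hankel_entries[OF a3] hankel_entries[OF a2] d0 d2 by auto
    have "P1 1 1 \<noteq> 0" using e2(2) d0 d2 by auto
    moreover have "P1 1 1 * (R1 2 0 * P1 2 0) = P1 1 1 * (R1 0 2 * P1 0 2)"
      by (rule cross_mult_eq[OF e3 e1])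
    ultimately have "R1 2 0 * P1 2 0 = R1 0 2 * P1 0 2" by simp
    then have eq: "q * (R1 2 0 * P1 2 0) = R1 0 2 * q * P1 0 2" by (simp add: mult_ac)
    have "q * p * (R1 1 1 * P1 1 1) = q * (p * (R1 1 1 * P1 1 1))" by (rule mult.assoc)
    also have "\<dots> = R1 1 1 * P1 1 1" by (simp only: e2(2)[symmetric] eq e2(1))
    finally have "q * p * (R1 1 1 * P1 1 1) = R1 1 1 * P1 1 1" .
    moreover have "R1 1 1 * P1 1 1 \<noteq> 0" using e2(2) d0 d2 by auto
    ultimately show ?thesis by simp
  qed
qed

lemma infinitely_many_orbits_ge_5:
  assumes r: "5 \<le> r"
  shows "\<exists>S :: 'k::alg_closed_field kron_rep set. infinite S \<and>
    (\<forall>E\<in>S. elementary r E \<and> dim_vector E = (3, 3)) \<and>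
    (\<forall>E\<in>S. \<forall>F\<in>S. E \<noteq> F \<longrightarrow> \<not> rep_iso r E F) \<and> inj_on (GL_orbit r) S"
proof (rule infinitely_many_orbits[where E = hankel_rep and C = "- {0, 1}"])
  show "infinite (- {0, 1 :: 'k})" using infinite_alg_closed_field by (simp add: finite_compl)
  show "finite {c' \<in> - {0, 1}. mat_space_equiv 3 3 (arrow_span r (hankel_rep c')) (arrow_span r (hankel_rep c))}"
    if c: "c \<in> - {0, 1}" for c :: 'k
  proof (rule finite_subset)
    show "{c' \<in> - {0, 1}. mat_space_equiv 3 3 (arrow_span r (hankel_rep c')) (arrow_span r (hankel_rep c))} \<subseteq> {c, inverse c}"
    proof
      fix x assume "x \<in> {c' \<in> - {0, 1}. mat_space_equiv 3 3 (arrow_span r (hankel_rep c')) (arrow_span r (hankel_rep c))}"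
      then have "x = c \<or> x * c = 1" using hankel_equiv[OF r, of x c] c by auto
      then show "x \<in> {c, inverse c}" using c by (auto simp: field_simps)
    qed
  qed simp
qed (use r in \<open>auto intro: elementary_hankel\<close>)

section \<open>The case of four arrows\<close>

text \<open>For fixed \<open>v\<close> the images under the four arrows form a 3 by 4 matrix, linear
  in \<open>v\<close>. Each of the six coordinates of \<open>v\<close> fills a pair of its twelve
  places, and two places in the middle row carry the factor \<open>c\<close>. The annihilator of
  this space of matrices has the same shape, with signs and with -1/c in place of
  \<open>c\<close>.\<close>

definition pair_mat :: "'k::field \<Rightarrow> (nat \<Rightarrow> 'k) \<Rightarrow> 'k mat" where
  "pair_mat c a = mat_of_rows_list 6
    [[a 0, a 1, 0, a 3, a 2, 0],
     [0, c * a 0, c * a 1, 0, a 3, a 2],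
     [a 2, 0, a 0, a 1, 0, a 3]]"

definition pair_rep :: "'k::field \<Rightarrow> 'k kron_rep" where
  "pair_rep c = \<lparr>dim1 = 6, dim2 = 3, arr = (\<lambda>k. pair_mat c (\<lambda>n. if n = k then 1 else 0))\<rparr>"

lemma pair_rep_dims [simp]: "dim1 (pair_rep c) = 6" "dim2 (pair_rep c) = 3"
  by (simp_all add: pair_rep_def)

lemma pair_mat_carrier [simp]: "pair_mat c a \<in> carrier_mat 3 6"
  by (auto simp: pair_mat_def mat_of_rows_list_def)

lemma is_rep_pair: "is_rep r (pair_rep c)"
  by (simp add: is_rep_def pair_rep_def)

lemma sum_0_6: "sum f {0..<6::nat} = f 0 + f 1 + f 2 + f 3 + f 4 + (f 5 :: 'k::field)"
  by (simp add: numeral_eq_Suc)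

lemma pair_mat_mult:
  fixes v :: "'k::field vec"
  assumes "v \<in> carrier_vec 6"
  shows "(pair_mat c a *\<^sub>v v) $ 0 = a 0 * v $ 0 + a 1 * v $ 1 + a 3 * v $ 3 + a 2 * v $ 4"
    "(pair_mat c a *\<^sub>v v) $ 1 = c * (a 0 * v $ 1 + a 1 * v $ 2) + a 3 * v $ 4 + a 2 * v $ 5"
    "(pair_mat c a *\<^sub>v v) $ 2 = a 2 * v $ 0 + a 0 * v $ 2 + a 1 * v $ 3 + a 3 * v $ 5"
  using assms
  by (simp_all add: pair_mat_def mat_of_rows_list_def scalar_prod_def sum_0_6 algebra_simps)

lemma lin_comb_pair: "lin_comb 4 (pair_rep c) a = pair_mat c a"
proof (rule eq_matI)
  fix i j assume "i < dim_row (pair_mat c a)" "j < dim_col (pair_mat c a)"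
  then have "i = 0 \<or> i = 1 \<or> i = 2" "j = 0 \<or> j = 1 \<or> j = 2 \<or> j = 3 \<or> j = 4 \<or> j = 5"
    by (auto simp: pair_mat_def mat_of_rows_list_def)
  moreover have "(\<Sum>k<4. f k) = f 0 + f 1 + f 2 + f 3" for f :: "nat \<Rightarrow> 'a"
    by (simp add: numeral_eq_Suc)
  ultimately show "lin_comb 4 (pair_rep c) a $$ (i, j) = pair_mat c a $$ (i, j)"
    by (auto simp: lin_comb_def pair_rep_def pair_mat_def mat_of_rows_list_def)
qed (auto simp: lin_comb_def pair_rep_def pair_mat_def mat_of_rows_list_def)

lemma arrow_span_pair: "arrow_span 4 (pair_rep c) = range (pair_mat c)"
  unfolding arrow_span_def using lin_comb_pair[of c] by (metis image_cong)

text \<open>For \<open>\<epsilon> = 1\<close> this says that no non-zero vector at vertex 1 has a one-dimensional image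
  under the arrows, for \<open>\<epsilon> = -1\<close> and \<open>-1/c\<close> in place of \<open>c\<close> that every non-zero functional at
  vertex 2 has linearly independent pull-backs along the arrows.\<close>

lemma pair_rank_one:
  fixes c :: "'k::field"
  assumes c: "c \<noteq> 0" "c\<^sup>2 \<noteq> 1" and e: "\<epsilon> \<noteq> 0"
    and eqs: "x 0 * y 0 = \<epsilon> * (x 2 * y 2)" "c * (x 0 * y 1) = x 1 * y 0" "x 1 * y 1 = c * (x 2 * y 0)"
      "x 2 * y 1 = \<epsilon> * (x 0 * y 3)" "x 0 * y 2 = \<epsilon> * (x 1 * y 3)" "x 1 * y 2 = \<epsilon> * (x 2 * y 3)"
  shows "x 0 = 0 \<and> x 1 = 0 \<and> x 2 = 0 \<or> y 0 = 0 \<and> y 1 = 0 \<and> y 2 = 0 \<and> y 3 = 0"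
    (is "_ \<or> ?Y")
proof (rule disjCI)
  assume "\<not> ?Y"
  show "x 0 = 0 \<and> x 1 = 0 \<and> x 2 = 0"
  proof (rule ccontr)
    assume nz: "\<not> (x 0 = 0 \<and> x 1 = 0 \<and> x 2 = 0)"
    have x1: "x 1 \<noteq> 0"
    proof
      assume z: "x 1 = 0"
      then have "x 0 * y 1 = 0" "x 2 * y 0 = 0" "x 0 * y 2 = 0" "x 2 * y 3 = 0" using eqs c e by auto
      then show False using nz z eqs e \<open>\<not> ?Y\<close> by (cases "x 0 = 0") auto
    qed
    have x0: "x 0 \<noteq> 0"
    proof
      assume z: "x 0 = 0"
      then have "y 0 = 0" "y 3 = 0" using eqs(2,5) x1 e by auto
      then show False using eqs(3,6) x1 \<open>\<not> ?Y\<close> by auto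
    qed
    have x2: "x 2 \<noteq> 0"
    proof
      assume z: "x 2 = 0"
      then have "y 1 = 0" "y 2 = 0" using eqs(3,6) x1 by auto
      then show False using eqs(2,5) x1 e \<open>\<not> ?Y\<close> by auto
    qed
    have y0: "y 0 \<noteq> 0"
    proof
      assume z: "y 0 = 0"
      then have "y 1 = 0" "y 2 = 0" using eqs(3,1) x1 x2 e by auto
      then show False using eqs(5) x1 e z \<open>\<not> ?Y\<close> by auto
    qed
    have y: "y 1 \<noteq> 0" "y 2 \<noteq> 0" "y 3 \<noteq> 0"
    proof -
      show "y 1 \<noteq> 0" using eqs(2) x1 y0 by auto
      show y2: "y 2 \<noteq> 0" using eqs(1) x0 y0 by auto
      show "y 3 \<noteq> 0" using eqs(5) x0 y2 by auto
    qed
    \<comment> \<open>The second and third equations give x_1^2 = c^2 x_0 x_2, the fifth and sixth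
      give x_1^2 = x_0 x_2. With all coordinates non-zero this contradicts c^2 \<noteq> 1.\<close>
    have "(x 1 * x 1) * (y 0 * y 1) = (x 1 * y 0) * (x 1 * y 1)" by (simp add: mult_ac)
    also have "\<dots> = (c\<^sup>2 * (x 0 * x 2)) * (y 0 * y 1)"
      unfolding eqs(2)[symmetric] eqs(3) by (simp add: power2_eq_square mult_ac)
    finally have 1: "x 1 * x 1 = c\<^sup>2 * (x 0 * x 2)" using y0 y by simp
    have "(x 1 * x 1) * (\<epsilon> * (y 2 * y 3)) = (x 1 * y 2) * (\<epsilon> * (x 1 * y 3))" by (simp add: mult_ac)
    also have "\<dots> = (x 0 * x 2) * (\<epsilon> * (y 2 * y 3))"
      unfolding eqs(5)[symmetric] eqs(6) by (simp add: mult_ac)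
    finally have 2: "x 1 * x 1 = x 0 * x 2" using y e by simp
    then show False using 1 c x0 x2 by simp
  qed
qed

lemma less_4_cases: "(\<forall>k<4::nat. Q k) \<longleftrightarrow> Q 0 \<and> Q 1 \<and> Q 2 \<and> Q 3"
  by (auto simp: numeral_eq_Suc less_Suc_eq)

lemma vec_6_eq_zero:
  assumes "v \<in> carrier_vec 6" "v $ 0 = 0" "v $ 1 = 0" "v $ 2 = 0" "v $ 3 = 0" "v $ 4 = 0" "v $ 5 = (0 :: 'k::field)"
  shows "v = 0\<^sub>v 6"
  using assms by (intro eq_vecI) (auto simp: numeral_eq_Suc less_Suc_eq)

lemma sub_rank_pair:
  fixes c :: "'k::field"
  assumes c: "c \<noteq> 0" "c\<^sup>2 \<noteq> 1"
  shows "sub_rank 4 (pair_rep c) 2"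
  unfolding sub_rank_def
proof (intro allI impI)
  fix v :: "'k vec" and B b
  assume v: "v \<in> carrier_vec (dim1 (pair_rep c))" "v \<noteq> 0\<^sub>v (dim1 (pair_rep c))"
    and B: "B \<in> carrier_mat (dim2 (pair_rep c)) b"
    and rng: "\<forall>i<4. arr (pair_rep c) i *\<^sub>v v \<in> mat_range B"
  have v6: "v \<in> carrier_vec 6" "v \<noteq> 0\<^sub>v 6" using v by auto
  show "2 \<le> b"
  proof (rule ccontr)
    assume "\<not> 2 \<le> b"
    then have b: "b = 0 \<or> b = 1" by auto
    \<comment> \<open>With at most one column, the range of \<open>B\<close> is spanned by
      \<open>x\<close>, which is set to zero if there is no column. The matrix attached to
      \<open>v\<close> then has entries \<open>x i * y k\<close>, the rank-one shape excluded by
      \<open>pair_rank_one\<close>.\<close>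
    define x where "x i = (if b = 0 then 0 else B $$ (i, 0))" for i
    have "\<exists>y. \<forall>i<3. (arr (pair_rep c) k *\<^sub>v v) $ i = x i * y" if k: "k < 4" for k
    proof -
      obtain z where z: "z \<in> carrier_vec b" "arr (pair_rep c) k *\<^sub>v v = B *\<^sub>v z"
        using rng k B unfolding mat_range_def by auto
      have "(B *\<^sub>v z) $ i = x i * (if b = 0 then 0 else z $ 0)" if "i < 3" for i
        using b z(1) B that by (auto simp: scalar_prod_def x_def)
      then show ?thesis using z(2) by metis
    qed
    then obtain y where y: "\<And>k i. k < 4 \<Longrightarrow> i < 3 \<Longrightarrow> (arr (pair_rep c) k *\<^sub>v v) $ i = x i * y k"
      by metis
    have y': "(pair_mat c (\<lambda>n. if n = k then 1 else 0) *\<^sub>v v) $ 0 = x 0 * y k"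
      "(pair_mat c (\<lambda>n. if n = k then 1 else 0) *\<^sub>v v) $ 1 = x 1 * y k"
      "(pair_mat c (\<lambda>n. if n = k then 1 else 0) *\<^sub>v v) $ 2 = x 2 * y k" if "k < 4" for k
      using y[OF that, of 0] y[OF that, of 1] y[OF that, of 2] by (simp_all add: pair_rep_def)
    have e: "v $ 0 = x 0 * y 0" "c * v $ 1 = x 1 * y 0" "v $ 2 = x 2 * y 0"
      "v $ 1 = x 0 * y 1" "c * v $ 2 = x 1 * y 1" "v $ 3 = x 2 * y 1"
      "v $ 4 = x 0 * y 2" "v $ 5 = x 1 * y 2" "v $ 0 = x 2 * y 2"
      "v $ 3 = x 0 * y 3" "v $ 4 = x 1 * y 3" "v $ 5 = x 2 * y 3"
      using y'[of 0] y'[of 1] y'[of 2] y'[of 3] unfolding pair_mat_mult[OF v6(1)] by simp_all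
    have "x 0 = 0 \<and> x 1 = 0 \<and> x 2 = 0 \<or> y 0 = 0 \<and> y 1 = 0 \<and> y 2 = 0 \<and> y 3 = 0"
      using e by (intro pair_rank_one[OF c, of 1]) simp_all
    then have "v = 0\<^sub>v 6" using e by (intro vec_6_eq_zero[OF v6(1)]) auto
    then show False using v6(2) by blast
  qed
qed

lemma pair_functionals_independent:
  fixes c :: "'k::field"
  assumes c: "c \<noteq> 0" "c\<^sup>2 \<noteq> 1"
    and w: "w \<in> carrier_vec 3" "w \<noteq> 0\<^sub>v 3"
    and zero: "\<And>v. v \<in> carrier_vec 6 \<Longrightarrow> w \<bullet> (pair_mat c a *\<^sub>v v) = 0"
  shows "a 0 = 0 \<and> a 1 = 0 \<and> a 2 = 0 \<and> a 3 = 0"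
proof -
  have dot: "w \<bullet> (pair_mat c a *\<^sub>v v) = w $ 0 * (a 0 * v $ 0 + a 1 * v $ 1 + a 3 * v $ 3 + a 2 * v $ 4)
      + w $ 1 * (c * (a 0 * v $ 1 + a 1 * v $ 2) + a 3 * v $ 4 + a 2 * v $ 5)
      + w $ 2 * (a 2 * v $ 0 + a 0 * v $ 2 + a 1 * v $ 3 + a 3 * v $ 5)"
    if "v \<in> carrier_vec 6" for v
  proof -
    have "pair_mat c a *\<^sub>v v \<in> carrier_vec 3" using that by (metis pair_mat_carrier mult_mat_vec_carrier)
    then have "w \<bullet> (pair_mat c a *\<^sub>v v) = (\<Sum>i<3. w $ i * (pair_mat c a *\<^sub>v v) $ i)"
      by (simp add: scalar_prod_def atLeast0LessThan carrier_matD(1)[OF pair_mat_carrier] del: index_mult_mat_vec)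
    then show ?thesis unfolding sum_less_3 pair_mat_mult[OF that] .
  qed
  have z: "w $ 0 * a 0 + w $ 2 * a 2 = 0" "w $ 0 * a 1 + w $ 1 * (c * a 0) = 0"
    "w $ 1 * (c * a 1) + w $ 2 * a 0 = 0" "w $ 0 * a 3 + w $ 2 * a 1 = 0"
    "w $ 0 * a 2 + w $ 1 * a 3 = 0" "w $ 1 * a 2 + w $ 2 * a 3 = 0"
    using zero[of "unit_vec 6 0"] dot[of "unit_vec 6 0"] zero[of "unit_vec 6 1"] dot[of "unit_vec 6 1"]
      zero[of "unit_vec 6 2"] dot[of "unit_vec 6 2"] zero[of "unit_vec 6 3"] dot[of "unit_vec 6 3"]
      zero[of "unit_vec 6 4"] dot[of "unit_vec 6 4"] zero[of "unit_vec 6 5"] dot[of "unit_vec 6 5"]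
    by simp_all
  have c': "- inverse c \<noteq> 0" "(- inverse c)\<^sup>2 \<noteq> 1"
    using c by (auto simp: power2_eq_square field_simps)
  have "w $ 0 = 0 \<and> w $ 1 = 0 \<and> w $ 2 = 0 \<or> a 0 = 0 \<and> a 1 = 0 \<and> a 2 = 0 \<and> a 3 = 0"
  proof (rule pair_rank_one[OF c', of "- 1" "\<lambda>i. w $ i" a])
    show "w $ 0 * a 0 = - 1 * (w $ 2 * a 2)" "w $ 2 * a 1 = - 1 * (w $ 0 * a 3)"
      "w $ 0 * a 2 = - 1 * (w $ 1 * a 3)" "w $ 1 * a 2 = - 1 * (w $ 2 * a 3)"
      using z by (simp_all add: eq_neg_iff_add_eq_0 add.commute)
    have "w $ 0 * a 1 = - (w $ 1 * (c * a 0))" using z(2) by (simp add: eq_neg_iff_add_eq_0)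
    then show "- inverse c * (w $ 0 * a 1) = w $ 1 * a 0" using c(1) by simp
    show "w $ 1 * a 1 = - inverse c * (w $ 2 * a 0)"
      using z(3) c(1) by (simp add: field_simps eq_neg_iff_add_eq_0)
  qed simp
  then show ?thesis using w vec_3_eq_zero by blast
qed

lemma quot_rank_pair:
  fixes c :: "'k::field"
  assumes c: "c \<noteq> 0" "c\<^sup>2 \<noteq> 1"
  shows "quot_rank 4 (pair_rep c) 4"
  unfolding quot_rank_def
proof (intro allI impI)
  fix w :: "'k vec" and C d h
  assume w: "w \<in> carrier_vec (dim2 (pair_rep c))" "w \<noteq> 0\<^sub>v (dim2 (pair_rep c))"
    and C: "C \<in> carrier_mat d (dim1 (pair_rep c))"
    and h: "\<forall>i<4. h i \<in> carrier_vec d \<and>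
      (\<forall>e\<in>carrier_vec (dim1 (pair_rep c)). w \<bullet> (arr (pair_rep c) i *\<^sub>v e) = h i \<bullet> (C *\<^sub>v e))"
  show "4 \<le> d"
  proof (rule ccontr)
    assume "\<not> 4 \<le> d"
    then have d: "d < 4" by simp
    \<comment> \<open>The columns of \<open>H\<close> are the functionals \<open>h i\<close>. A
      kernel vector of \<open>H\<close> is a linear relation between them, hence between the
      pull-backs of \<open>w\<close> along the four arrows.\<close>
    define H where "H = mat d 4 (\<lambda>(p, i). h i $ p)"
    have H: "H \<in> carrier_mat d 4" by (simp add: H_def)
    obtain x where x: "x \<in> carrier_vec 4" "x \<noteq> 0\<^sub>v 4" "H *\<^sub>v x = 0\<^sub>v d"
      using exists_kernel_vec[OF H d] by blast
    define a where "a i = x $ i" for i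
    have "w \<bullet> (pair_mat c a *\<^sub>v v) = 0" if v: "v \<in> carrier_vec 6" for v
    proof -
      have M: "pair_mat c a \<in> carrier_mat 3 6" by simp
      have "w \<bullet> (pair_mat c a *\<^sub>v v) = (\<Sum>p<3. w $ p * (\<Sum>q<6. (\<Sum>i<4. a i * arr (pair_rep c) i $$ (p, q)) * v $ q))"
        using v w unfolding lin_comb_pair[symmetric]
        by (simp add: scalar_prod_def lin_comb_def atLeast0LessThan)
      also have "\<dots> = (\<Sum>p<3. \<Sum>q<6. \<Sum>i<4. a i * (w $ p * (arr (pair_rep c) i $$ (p, q) * v $ q)))"
        by (simp add: sum_distrib_left sum_distrib_right mult_ac)
      also have "\<dots> = (\<Sum>p<3. \<Sum>i<4. \<Sum>q<6. a i * (w $ p * (arr (pair_rep c) i $$ (p, q) * v $ q)))"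
        by (intro sum.cong refl sum.swap)
      also have "\<dots> = (\<Sum>i<4. \<Sum>p<3. \<Sum>q<6. a i * (w $ p * (arr (pair_rep c) i $$ (p, q) * v $ q)))"
        by (rule sum.swap)
      also have "\<dots> = (\<Sum>i<4. a i * (w \<bullet> (arr (pair_rep c) i *\<^sub>v v)))"
      proof (intro sum.cong refl)
        fix i assume "i \<in> {..<4::nat}"
        have "arr (pair_rep c) i \<in> carrier_mat 3 6" by (simp add: pair_rep_def)
        then show "(\<Sum>p<3. \<Sum>q<6. a i * (w $ p * (arr (pair_rep c) i $$ (p, q) * v $ q))) =
            a i * (w \<bullet> (arr (pair_rep c) i *\<^sub>v v))"
          using v w by (simp add: scalar_prod_def atLeast0LessThan sum_distrib_left)
      qed
      also have "\<dots> = (\<Sum>i<4. a i * (h i \<bullet> (C *\<^sub>v v)))" using h v by (intro sum.cong) auto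
      also have "\<dots> = (\<Sum>i<4. \<Sum>p<d. a i * (h i $ p * (C *\<^sub>v v) $ p))"
        using C v by (simp add: scalar_prod_def[of _ "C *\<^sub>v v"] atLeast0LessThan sum_distrib_left del: index_mult_mat_vec)
      also have "\<dots> = (\<Sum>p<d. \<Sum>i<4. a i * (h i $ p * (C *\<^sub>v v) $ p))" by (rule sum.swap)
      also have "\<dots> = (\<Sum>p<d. (H *\<^sub>v x) $ p * (C *\<^sub>v v) $ p)"
        using x(1) by (intro sum.cong refl)
          (simp add: H_def a_def scalar_prod_def[of _ x] atLeast0LessThan sum_distrib_right
            sum_distrib_left mult_ac del: index_mult_mat_vec(1)[of _ C])
      also have "\<dots> = 0" unfolding x(3) by simp
      finally show ?thesis .
    qed
    then have "a 0 = 0 \<and> a 1 = 0 \<and> a 2 = 0 \<and> a 3 = 0"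
      using pair_functionals_independent[OF c, of w a] w by simp
    then have "\<forall>i<4. x $ i = 0" unfolding less_4_cases by (simp add: a_def)
    then show False using x by (auto intro!: eq_vecI)
  qed
qed

lemma elementary_pair:
  fixes c :: "'k::field"
  assumes "c \<noteq> 0" "c\<^sup>2 \<noteq> 1"
  shows "elementary 4 (pair_rep c)"
  by (rule elementary_if_injective_quotients[OF is_rep_pair])
    (use sub_rank_pair[OF assms] quot_rank_pair[OF assms] in auto)

section \<open>Rigidity of the standard pencil\<close>

text \<open>Matrix times vector on plain functions: transposing becomes a swap of the two indices,
  and coordinates enter polynomial identities directly.\<close>

definition lin3 :: "(nat \<Rightarrow> nat \<Rightarrow> 'k::field) \<Rightarrow> (nat \<Rightarrow> 'k) \<Rightarrow> nat \<Rightarrow> 'k" where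
  "lin3 r y i = r i 0 * y 0 + r i 1 * y 1 + r i 2 * y 2"

definition vec3 :: "'k \<Rightarrow> 'k \<Rightarrow> 'k \<Rightarrow> nat \<Rightarrow> 'k" where
  "vec3 a b d i = (if i = 0 then a else if i = 1 then b else d)"

lemma vec3_simps [simp]: "vec3 a b d 0 = a" "vec3 a b d (Suc 0) = b" "vec3 a b d 1 = b" "vec3 a b d 2 = d"
  by (simp_all add: vec3_def)

text \<open>The second root comes from the sum of the roots, not from a square root of the
  discriminant, so characteristic 2 is covered. A double root would make the discriminant
  zero.\<close>

lemma quadratic_two_roots:
  fixes a b d :: "'k::alg_closed_field"
  assumes d: "d \<noteq> 0" and disc: "b * b \<noteq> 4 * a * d"
  shows "\<exists>s t. s \<noteq> t \<and> a + b * s + d * s\<^sup>2 = 0 \<and> a + b * t + d * t\<^sup>2 = 0"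
proof -
  have "0 < degree [:a, b, d:]" using d by simp
  then obtain s where "poly [:a, b, d:] s = 0" using alg_closed_imp_poly_has_root by blast
  then have s: "a + b * s + d * s\<^sup>2 = 0" by (simp add: power2_eq_square algebra_simps)
  define t where "t = - (b / d) - s"
  have dt: "d * t = - b - d * s" using d by (simp add: t_def field_simps)
  have t: "a + b * t + d * t\<^sup>2 = 0"
  proof -
    have "a + b * t + d * t\<^sup>2 = a + b * t + (d * t) * t" by (simp add: power2_eq_square mult.assoc)
    also have "\<dots> = a + b * t + (- b - d * s) * t" by (simp only: dt)
    also have "\<dots> = a - s * (d * t)" by (simp add: algebra_simps)
    also have "\<dots> = a - s * (- b - d * s)" by (simp only: dt)
    also have "\<dots> = a + b * s + d * s\<^sup>2" by (simp add: algebra_simps power2_eq_square)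
    finally show ?thesis using s by simp
  qed
  have "s \<noteq> t"
  proof
    assume "s = t"
    then have b: "b = - (2 * d * s)" using dt by (simp add: algebra_simps)
    have "a = d * s\<^sup>2" using s unfolding b by (simp add: power2_eq_square algebra_simps)
    then show False using disc unfolding b by (simp add: power2_eq_square algebra_simps)
  qed
  then show ?thesis using s t by blast
qed

text \<open>\<open>R\<close> maps the cone \<open>y_1^2 = c^2 y_0 y_2\<close> to the cone with parameter \<open>c'\<close>, and its transpose
  preserves the conic \<open>w_1^2 = w_0 w_2\<close>. Only for \<open>w = e_0\<close> and \<open>w = e_2\<close> on the conic does the plane
  \<open>w = 0\<close> meet the cones in a single line, hence \<open>R\<close> is diagonal or antidiagonal.\<close>

lemma cone_rigidity:
  fixes r :: "nat \<Rightarrow> nat \<Rightarrow> 'k::alg_closed_field"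
  assumes c: "c \<noteq> 0" "c\<^sup>2 \<noteq> 4"
    and cone: "\<And>y. (y 1)\<^sup>2 = c\<^sup>2 * (y 0 * y 2) \<Longrightarrow> (lin3 r y 1)\<^sup>2 = c'\<^sup>2 * (lin3 r y 0 * lin3 r y 2)"
    and conic: "\<And>w. (w 1)\<^sup>2 = w 0 * w 2 \<Longrightarrow>
      (lin3 (\<lambda>i j. r j i) w 1)\<^sup>2 = lin3 (\<lambda>i j. r j i) w 0 * lin3 (\<lambda>i j. r j i) w 2"
    and inj: "\<And>y. lin3 r y 0 = 0 \<Longrightarrow> lin3 r y 1 = 0 \<Longrightarrow> lin3 r y 2 = 0 \<Longrightarrow> y 0 = 0 \<and> y 1 = 0 \<and> y 2 = 0"
    and inj': "\<And>w. lin3 (\<lambda>i j. r j i) w 0 = 0 \<Longrightarrow> lin3 (\<lambda>i j. r j i) w 1 = 0 \<Longrightarrow>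
      lin3 (\<lambda>i j. r j i) w 2 = 0 \<Longrightarrow> w 0 = 0 \<and> w 1 = 0 \<and> w 2 = 0"
  shows "c\<^sup>2 = c'\<^sup>2"
proof -
  have rows: "(r m 1)\<^sup>2 = r m 0 * r m 2" if m: "m = 0 \<or> m = 2" for m
    using m conic[of "vec3 1 0 0"] conic[of "vec3 0 0 1"] by (auto simp: lin3_def)
  \<comment> \<open>Row \<open>m\<close> of \<open>R\<close> lies on the conic. If its middle entry
    were non-zero, the plane it annihilates would contain two lines of the first cone. Their images
    have zero coordinate \<open>m\<close>, hence zero middle coordinate by the equation of the
    second cone, so they are proportional, against injectivity.\<close>
  have mid: "r m 1 = 0" if m: "m = 0 \<or> m = 2" for m
  proof (rule ccontr)
    assume nz: "r m 1 \<noteq> 0"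
    then have m2: "r m 2 \<noteq> 0" using rows[OF m] by auto
    have "c * r m 1 * (c * r m 1) = c\<^sup>2 * (r m 0 * r m 2)"
      using rows[OF m] by (simp add: power2_eq_square mult_ac)
    moreover have "r m 0 * r m 2 \<noteq> 0" using rows[OF m] nz by auto
    ultimately have "c * r m 1 * (c * r m 1) \<noteq> 4 * r m 0 * r m 2"
      using c(2) by (simp add: mult.assoc)
    then obtain s t where st: "s \<noteq> t" "r m 0 + c * r m 1 * s + r m 2 * s\<^sup>2 = 0"
      "r m 0 + c * r m 1 * t + r m 2 * t\<^sup>2 = 0"
      using quadratic_two_roots[OF m2] by blast
    define y where "y x = vec3 1 (c * x) (x\<^sup>2)" for x
    have R0: "lin3 r (y x) m = 0" "lin3 r (y x) 1 = 0" if "r m 0 + c * r m 1 * x + r m 2 * x\<^sup>2 = 0" for x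
    proof -
      show "lin3 r (y x) m = 0" using that by (simp add: lin3_def y_def mult_ac)
      moreover have "(lin3 r (y x) 1)\<^sup>2 = c'\<^sup>2 * (lin3 r (y x) 0 * lin3 r (y x) 2)"
        by (rule cone) (simp add: y_def power_mult_distrib)
      ultimately show "lin3 r (y x) 1 = 0" using m by auto
    qed
    define m' where "m' = 2 - m"
    have m': "m' = 0 \<or> m' = 2" "m' \<noteq> m" using m by (auto simp: m'_def)
    define zs zt where "zs = lin3 r (y s) m'" and "zt = lin3 r (y t) m'"
    define u where "u i = zt * y s i - zs * y t i" for i
    have lu: "lin3 r u i = zt * lin3 r (y s) i - zs * lin3 r (y t) i" for i
      by (simp add: lin3_def u_def algebra_simps)
    have "lin3 r u 1 = 0" "lin3 r u m = 0" "lin3 r u m' = 0"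
      unfolding lu using R0 st by (simp_all add: zs_def zt_def)
    then have u: "u 0 = 0 \<and> u 1 = 0 \<and> u 2 = 0" using m m' by (intro inj) auto
    then have "zt = zs" "zt * (c * s) = zs * (c * t)" by (auto simp: u_def y_def)
    then have "zt = 0" using st(1) c(1) by auto
    then have "lin3 r (y t) 0 = 0 \<and> lin3 r (y t) 1 = 0 \<and> lin3 r (y t) 2 = 0"
      using R0[OF st(3)] m m' by (auto simp: zt_def)
    then have "y t 0 = 0" using inj by blast
    then show False by (simp add: y_def)
  qed
  have prod: "r m 0 * r m 2 = 0" if "m = 0 \<or> m = 2" for m
    using rows[OF that] mid[OF that] by simp
  have not_both: "\<not> (r 0 j = 0 \<and> r 2 j = 0)" if j: "j = 0 \<or> j = 2" for j
  proof
    assume z: "r 0 j = 0 \<and> r 2 j = 0"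
    \<comment> \<open>Rows 0 and 2 would both be supported on column \<open>2 - j\<close>; this
      combination of them is zero.\<close>
    define w where "w = vec3 (r 2 (2 - j)) 0 (- r 0 (2 - j))"
    have "w 0 = 0 \<and> w 1 = 0 \<and> w 2 = 0"
      using j z mid by (intro inj') (auto simp: lin3_def w_def mult.commute)
    then have "r 0 (2 - j) = 0" by (simp add: w_def)
    then have "r 0 0 = 0 \<and> r 0 1 = 0 \<and> r 0 2 = 0" using j z mid[of 0] by auto
    then have "vec3 1 0 (0 :: 'k) 0 = 0" using inj'[of "vec3 1 0 0"] by (simp add: lin3_def)
    then show False by simp
  qed
  \<comment> \<open>One further point on the conic and one on the cone suffice to compare the square
    of the middle entry of \<open>R\<close> with the product of its two remaining corner
    entries.\<close>
  have ones: "(lin3 (\<lambda>i j. r j i) (vec3 1 1 1) 1)\<^sup>2 =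
      lin3 (\<lambda>i j. r j i) (vec3 1 1 1) 0 * lin3 (\<lambda>i j. r j i) (vec3 1 1 1) 2"
    by (rule conic) simp
  have cc: "(lin3 r (vec3 1 c 1) 1)\<^sup>2 = c'\<^sup>2 * (lin3 r (vec3 1 c 1) 0 * lin3 r (vec3 1 c 1) 2)"
    by (rule cone) simp
  have e0: "(r 1 0)\<^sup>2 = c'\<^sup>2 * (r 0 0 * r 2 0)" using cone[of "vec3 1 0 0"] by (simp add: lin3_def)
  have e2: "(r 1 2)\<^sup>2 = c'\<^sup>2 * (r 0 2 * r 2 2)" using cone[of "vec3 0 0 1"] by (simp add: lin3_def)
  show ?thesis
  proof (cases "r 0 0 = 0")
    case False
    then have d: "r 0 2 = 0" "r 2 2 \<noteq> 0" "r 2 0 = 0" using prod[of 0] prod[of 2] not_both[of 2] by auto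
    then have o: "r 1 0 = 0" "r 1 2 = 0" using e0 e2 by auto
    have 1: "(r 1 1)\<^sup>2 = r 0 0 * r 2 2" using ones d o mid by (simp add: lin3_def)
    have "(r 1 1)\<^sup>2 * c\<^sup>2 = c'\<^sup>2 * (r 0 0 * r 2 2)"
      using cc d o mid by (simp add: lin3_def power_mult_distrib)
    then have "r 0 0 * r 2 2 * c\<^sup>2 = r 0 0 * r 2 2 * c'\<^sup>2" unfolding 1 by (simp add: mult_ac)
    then show ?thesis using False d by simp
  next
    case True
    then have d: "r 2 0 \<noteq> 0" "r 2 2 = 0" "r 0 2 \<noteq> 0" using prod[of 2] not_both[of 0] not_both[of 2] by auto
    then have o: "r 1 0 = 0" "r 1 2 = 0" using e0 e2 True by auto
    have 1: "(r 1 1)\<^sup>2 = r 2 0 * r 0 2" using ones d o mid True by (simp add: lin3_def)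
    have "(r 1 1)\<^sup>2 * c\<^sup>2 = c'\<^sup>2 * (r 0 2 * r 2 0)"
      using cc d o mid True by (simp add: lin3_def power_mult_distrib)
    then have "r 2 0 * r 0 2 * c\<^sup>2 = r 2 0 * r 0 2 * c'\<^sup>2" unfolding 1 by (simp add: mult_ac)
    then show ?thesis using d by simp
  qed
qed

section \<open>Pencils of arrows and their two conics\<close>

definition pencil :: "'k::field \<Rightarrow> (nat \<Rightarrow> 'k) \<Rightarrow> (nat \<Rightarrow> 'k) \<Rightarrow> 'k mat set" where
  "pencil c u v = {pair_mat c (\<lambda>i. s * u i + t * v i) | s t. True}"

definition unit_fun :: "nat \<Rightarrow> nat \<Rightarrow> 'k::field" where
  "unit_fun k i = (if i = k then 1 else 0)"

definition base_pencil :: "'k::field \<Rightarrow> 'k mat set" where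
  "base_pencil c = pencil c (unit_fun 0) (unit_fun 1)"

text \<open>An equivalence of arrow spans that also records the image \<open>X\<close> of the
  standard pencil: there are finitely many possible \<open>X\<close>, and a fixed \<open>X\<close>
  determines the square of the source parameter.\<close>

definition pencil_equiv :: "'k::field \<Rightarrow> 'k \<Rightarrow> 'k mat set \<Rightarrow> bool" where
  "pencil_equiv c d X \<longleftrightarrow> (\<exists>R R' P P'. R \<in> carrier_mat 3 3 \<and> R' \<in> carrier_mat 3 3 \<and>
     P \<in> carrier_mat 6 6 \<and> P' \<in> carrier_mat 6 6 \<and> R * R' = 1\<^sub>m 3 \<and> R' * R = 1\<^sub>m 3 \<and>
     P * P' = 1\<^sub>m 6 \<and> P' * P = 1\<^sub>m 6 \<and> (\<lambda>M. R * M * P) ` range (pair_mat c) = range (pair_mat d) \<and>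
     (\<lambda>M. R * M * P) ` base_pencil c = X)"

lemma pair_mat_cong:
  "a 0 = b 0 \<Longrightarrow> a 1 = b 1 \<Longrightarrow> a 2 = b 2 \<Longrightarrow> a 3 = b 3 \<Longrightarrow> pair_mat c a = pair_mat c b"
  by (simp add: pair_mat_def)

lemma base_pencil_eq: "base_pencil c = {pair_mat c a | a. a 2 = 0 \<and> a 3 = 0}"
proof -
  have "pair_mat c a \<in> base_pencil c" if "a 2 = 0" "a 3 = 0" for a
    unfolding base_pencil_def pencil_def using that
    by (intro CollectI exI[of _ "a 0"] exI[of _ "a 1"] conjI TrueI pair_mat_cong) (auto simp: unit_fun_def)
  then show ?thesis unfolding base_pencil_def pencil_def by (auto simp: unit_fun_def)
qed

lemma pair_mat_mult_zero_iff:
  fixes v :: "'k::field vec"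
  assumes v: "v \<in> carrier_vec 6"
  shows "pair_mat c a *\<^sub>v v = 0\<^sub>v 3 \<longleftrightarrow>
    a 0 * v $ 0 + a 1 * v $ 1 + a 3 * v $ 3 + a 2 * v $ 4 = 0 \<and>
    c * (a 0 * v $ 1 + a 1 * v $ 2) + a 3 * v $ 4 + a 2 * v $ 5 = 0 \<and>
    a 2 * v $ 0 + a 0 * v $ 2 + a 1 * v $ 3 + a 3 * v $ 5 = 0"
proof -
  have "pair_mat c a *\<^sub>v v \<in> carrier_vec 3" using v by (metis pair_mat_carrier mult_mat_vec_carrier)
  then have "pair_mat c a *\<^sub>v v = 0\<^sub>v 3 \<longleftrightarrow> (\<forall>i<3. (pair_mat c a *\<^sub>v v) $ i = 0)"
    by (metis carrier_vecD eq_vecI index_zero_vec)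
  then show ?thesis unfolding ball_less_3 pair_mat_mult[OF v] .
qed

lemma sandwich_mult_vec:
  fixes M :: "'k::field mat"
  assumes "R \<in> carrier_mat n n" "M \<in> carrier_mat n m" "P \<in> carrier_mat m m" "u \<in> carrier_vec m"
  shows "(R * M * P) *\<^sub>v u = R *\<^sub>v (M *\<^sub>v (P *\<^sub>v u))"
proof -
  have "(R * M * P) *\<^sub>v u = (R * M) *\<^sub>v (P *\<^sub>v u)" using assms by (intro assoc_mult_mat_vec) auto
  also have "\<dots> = R *\<^sub>v (M *\<^sub>v (P *\<^sub>v u))" using assms by (intro assoc_mult_mat_vec) auto
  finally show ?thesis .
qed

lemma mult_vec_lin3:
  fixes R :: "'k::field mat"
  assumes "R \<in> carrier_mat 3 3" "y \<in> carrier_vec 3" "i < 3"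
  shows "(R *\<^sub>v y) $ i = lin3 (\<lambda>i j. R $$ (i, j)) (\<lambda>j. y $ j) i"
  using assms sum_less_3[of "\<lambda>j. R $$ (i, j) * y $ j"]
  by (simp add: scalar_prod_def lin3_def atLeast0LessThan)

text \<open>The symmetric matrix with rows (a, b) and (b, d) is singular, as (p, q) lies in its
  kernel.\<close>

lemma symmetric_kernel_det:
  fixes a :: "'k::field"
  assumes "a * p + b * q = 0" "b * p + d * q = 0" "p \<noteq> 0 \<or> q \<noteq> 0"
  shows "b\<^sup>2 = a * d"
proof -
  have e: "a * p = - (b * q)" "b * p = - (d * q)" "b * q = - (a * p)" "d * q = - (b * p)"
    using assms(1,2) by (simp_all add: eq_neg_iff_add_eq_0 add.commute)
  have "p * b\<^sup>2 = b * (b * p)" by (simp add: power2_eq_square mult_ac)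
  also have "\<dots> = d * - (b * q)" unfolding e(2) by (simp add: mult_ac)
  also have "\<dots> = p * (a * d)" unfolding e(1)[symmetric] by (simp add: mult_ac)
  finally have p: "p * b\<^sup>2 = p * (a * d)" .
  have "q * b\<^sup>2 = b * (b * q)" by (simp add: power2_eq_square mult_ac)
  also have "\<dots> = a * - (b * p)" unfolding e(3) by (simp add: mult_ac)
  also have "\<dots> = q * (a * d)" unfolding e(4)[symmetric] by (simp add: mult_ac)
  finally have "q * b\<^sup>2 = q * (a * d)" .
  with p show ?thesis using assms(3) by auto
qed

text \<open>Both conics are intrinsic. The cone y_1^2 = c^2 y_0 y_2 consists of the \<open>y\<close>
  such that some \<open>g\<close> has all its images under the pencil on the line of
  \<open>y\<close>, not all coefficients being zero; \<open>R\<close> transports it. The conic w_1^2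
  = w_0 w_2 consists of the functionals for which the pairing between the common kernel and the two
  remaining arrows degenerates; the transpose of \<open>R\<close> transports it backwards.\<close>

lemma pencil_rigidity:
  fixes c d :: "'k::alg_closed_field"
  assumes c: "c \<noteq> 0" "c\<^sup>2 \<noteq> 4" and d: "d \<noteq> 0" and eqv: "pencil_equiv c d (base_pencil d)"
  shows "c\<^sup>2 = d\<^sup>2"
proof -
  obtain R R' P P' where car: "R \<in> carrier_mat 3 3" "R' \<in> carrier_mat 3 3" "P \<in> carrier_mat 6 6" "P' \<in> carrier_mat 6 6"
    and inv: "R * R' = 1\<^sub>m 3" "R' * R = 1\<^sub>m 3" "P * P' = 1\<^sub>m 6" "P' * P = 1\<^sub>m 6"
    and all: "(\<lambda>M. R * M * P) ` range (pair_mat c) = range (pair_mat d)"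
    and base: "(\<lambda>M. R * M * P) ` base_pencil c = base_pencil d"
    using eqv unfolding pencil_equiv_def by blast
  have injR: "mat_inj R" "mat_inj P"
    using mat_inj_if_left_inverse car inv by blast+
  have injRT: "mat_inj (R\<^sup>T)"
  proof (rule mat_inj_if_left_inverse)
    show "R'\<^sup>T * R\<^sup>T = 1\<^sub>m 3" using transpose_mult[OF car(1,2)] inv by simp
  qed (use car in auto)
  define r where "r i j = R $$ (i, j)" for i j
  have vecR: "(R *\<^sub>v vec 3 y) $ i = lin3 r y i" if "i < 3" for y i
    using mult_vec_lin3[OF car(1) vec_carrier that] by (simp add: r_def lin3_def)
  have vecRT: "(R\<^sup>T *\<^sub>v vec 3 y) $ i = lin3 (\<lambda>i j. r j i) y i" if "i < 3" for y i
    using mult_vec_lin3[of "R\<^sup>T" "vec 3 y" i] car that by (simp add: r_def lin3_def)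
  have base_c: "pair_mat c a \<in> base_pencil c" if "a 2 = 0" "a 3 = 0" for a
    using that unfolding base_pencil_eq by blast
  show ?thesis
  proof (rule cone_rigidity[OF c, of r d])
    fix y :: "nat \<Rightarrow> 'k"
    {
      assume z: "lin3 r y 0 = 0" "lin3 r y 1 = 0" "lin3 r y 2 = 0"
      have "R *\<^sub>v vec 3 y = 0\<^sub>v 3"
        using z vecR car by (intro vec_3_eq_zero) (auto simp del: index_mult_mat_vec)
      then have "vec 3 y = 0\<^sub>v 3" using mat_injD[OF injR(1) car(1)] by simp
      then have "vec 3 y $ i = 0" if "i < 3" for i using that by simp
      from this[of 0] this[of 1] this[of 2] show "y 0 = 0 \<and> y 1 = 0 \<and> y 2 = 0" by simp
    }
    {
      assume z: "lin3 (\<lambda>i j. r j i) y 0 = 0" "lin3 (\<lambda>i j. r j i) y 1 = 0" "lin3 (\<lambda>i j. r j i) y 2 = 0"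
      have "R\<^sup>T *\<^sub>v vec 3 y = 0\<^sub>v 3"
        using z vecRT car by (intro vec_3_eq_zero) (auto simp del: index_mult_mat_vec)
      then have "vec 3 y = 0\<^sub>v 3" using mat_injD[OF injRT, of 3 3] car by simp
      then have "vec 3 y $ i = 0" if "i < 3" for i using that by simp
      from this[of 0] this[of 1] this[of 2] show "y 0 = 0 \<and> y 1 = 0 \<and> y 2 = 0" by simp
    }
    {
      assume on: "(y 1)\<^sup>2 = c\<^sup>2 * (y 0 * y 2)"
      let ?z = "lin3 r y"
      \<comment> \<open>The vector \<open>g\<close> realizes \<open>y\<close> as a rank-one image
        with coefficients \<open>k\<close>. For \<open>y 0 = 0\<close> only the last coordinate of
        \<open>y\<close> is left and \<open>k\<close> is (0, 1); otherwise the ratio of the two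
        coefficients is \<kappa> = y_1 / (c y_0).\<close>
      obtain g k where g: "(g :: 'k vec) \<in> carrier_vec 6" and k: "(k :: nat \<Rightarrow> 'k) 0 \<noteq> 0 \<or> k 1 \<noteq> 0"
        and gy: "\<And>a i. a 2 = 0 \<Longrightarrow> a 3 = 0 \<Longrightarrow> i < 3 \<Longrightarrow>
          (pair_mat c a *\<^sub>v g) $ i = (a 0 * k 0 + a 1 * k 1) * y i"
      proof (cases "y 0 = 0")
        case True
        then have "y 1 = 0" using on by simp
        have *: "\<forall>i<3. (pair_mat c a *\<^sub>v vec 6 (\<lambda>i. if i = 3 then y 2 else 0)) $ i = (a 0 * unit_fun 1 0 + a 1 * unit_fun 1 1) * y i"
          if "a 2 = 0" "a 3 = 0" for a
          unfolding ball_less_3 pair_mat_mult[OF vec_carrier]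
          using that True \<open>y 1 = 0\<close> by (simp add: unit_fun_def)
        show thesis
          by (rule that[of "vec 6 (\<lambda>i. if i = 3 then y 2 else 0)" "unit_fun 1"]) (use * in \<open>auto simp: unit_fun_def\<close>)
      next
        case False
        define \<kappa> where "\<kappa> = y 1 / (c * y 0)"
        have k1: "c * (\<kappa> * y 0) = y 1" using False c by (simp add: \<kappa>_def)
        have "\<kappa> * y 1 * (c * y 0) = y 1 * y 1" using False c by (simp add: \<kappa>_def)
        also have "\<dots> = c * y 2 * (c * y 0)" using on by (simp add: power2_eq_square mult_ac)
        finally have k2: "\<kappa> * y 1 = c * y 2" using False c by simp
        let ?g = "vec 6 ((vec3 (y 0) (\<kappa> * y 0) (y 2))(3 := \<kappa> * y 2, 4 := 0, 5 := 0))"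
        have *: "\<forall>i<3. (pair_mat c a *\<^sub>v ?g) $ i = (a 0 * vec3 1 \<kappa> 0 0 + a 1 * vec3 1 \<kappa> 0 1) * y i"
          if "a 2 = 0" "a 3 = 0" for a
        proof -
          have "c * (a 0 * (\<kappa> * y 0) + a 1 * y 2) = a 0 * (c * (\<kappa> * y 0)) + a 1 * (c * y 2)"
            by (simp add: algebra_simps)
          also have "\<dots> = (a 0 + a 1 * \<kappa>) * y 1" unfolding k1 k2[symmetric] by (simp add: algebra_simps)
          finally show ?thesis
            unfolding ball_less_3 pair_mat_mult[OF vec_carrier] using that
            by (simp add: algebra_simps)
        qed
        show thesis by (rule that[of ?g "vec3 1 \<kappa> 0"]) (use * in auto)
      qed
      define u where "u = P' *\<^sub>v g"
      have u: "u \<in> carrier_vec 6" and Pu: "P *\<^sub>v u = g"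
        using car g inv(3) assoc_mult_mat_vec[OF car(3,4) g] by (auto simp: u_def)
      have img: "\<exists>\<mu>. \<forall>i<3. (pair_mat d b *\<^sub>v u) $ i = \<mu> * ?z i" if b: "b 2 = 0" "b 3 = 0" for b
      proof -
        have "pair_mat d b \<in> (\<lambda>M. R * M * P) ` base_pencil c"
          unfolding base using b unfolding base_pencil_eq by blast
        then obtain a where a: "a 2 = 0" "a 3 = 0" "pair_mat d b = R * pair_mat c a * P"
          unfolding base_pencil_eq by blast
        let ?k = "a 0 * k 0 + a 1 * k 1"
        have "pair_mat c a *\<^sub>v g = ?k \<cdot>\<^sub>v vec 3 y"
        proof (rule eq_vecI)
          fix i assume "i < dim_vec (?k \<cdot>\<^sub>v vec 3 y)"
          then show "(pair_mat c a *\<^sub>v g) $ i = (?k \<cdot>\<^sub>v vec 3 y) $ i" using gy[OF a(1,2)] by simp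
        qed (use carrier_matD(1)[OF pair_mat_carrier] in simp)
        then have "pair_mat d b *\<^sub>v u = R *\<^sub>v (?k \<cdot>\<^sub>v vec 3 y)"
          unfolding a(3) sandwich_mult_vec[OF car(1) pair_mat_carrier car(3) u] Pu by simp
        also have "\<dots> = ?k \<cdot>\<^sub>v (R *\<^sub>v vec 3 y)" by (rule mult_mat_vec[OF car(1)]) simp
        finally have "\<forall>i<3. (pair_mat d b *\<^sub>v u) $ i = ?k * ?z i"
          using vecR car(1) by (simp del: index_mult_mat_vec)
        then show ?thesis by blast
      qed
      obtain \<mu>0 where "\<forall>i<3. (pair_mat d (unit_fun 0) *\<^sub>v u) $ i = \<mu>0 * ?z i"
        using img[of "unit_fun 0"] by (auto simp: unit_fun_def simp del: index_mult_mat_vec)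
      then have m0: "u $ 0 = \<mu>0 * ?z 0" "d * u $ 1 = \<mu>0 * ?z 1" "u $ 2 = \<mu>0 * ?z 2"
        unfolding ball_less_3 pair_mat_mult[OF u] by (auto simp: unit_fun_def)
      obtain \<mu>1 where "\<forall>i<3. (pair_mat d (unit_fun 1) *\<^sub>v u) $ i = \<mu>1 * ?z i"
        using img[of "unit_fun 1"] by (auto simp: unit_fun_def simp del: index_mult_mat_vec)
      then have m1: "u $ 1 = \<mu>1 * ?z 0" "d * u $ 2 = \<mu>1 * ?z 1" "u $ 3 = \<mu>1 * ?z 2"
        unfolding ball_less_3 pair_mat_mult[OF u] by (auto simp: unit_fun_def)
      have e: "\<mu>0 * ?z 1 = d * (\<mu>1 * ?z 0)" "\<mu>1 * ?z 1 = d * (\<mu>0 * ?z 2)" using m0 m1 by auto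
      show "(?z 1)\<^sup>2 = d\<^sup>2 * (?z 0 * ?z 2)"
      proof (cases "\<mu>0 = 0")
        case False
        have "\<mu>0 * (?z 1)\<^sup>2 = (\<mu>0 * ?z 1) * ?z 1" by (simp add: power2_eq_square)
        also have "\<dots> = d * ?z 0 * (\<mu>1 * ?z 1)" unfolding e(1) by (simp add: mult_ac)
        also have "\<dots> = \<mu>0 * (d\<^sup>2 * (?z 0 * ?z 2))" unfolding e(2) by (simp add: power2_eq_square mult_ac)
        finally show ?thesis using False by simp
      next
        case True
        \<comment> \<open>If both multiples vanished, \<open>u\<close> would lie in the common
          kernel of the target pencil and \<open>g\<close> in that of the source pencil. As
          \<open>k\<close> is non-zero, this forces \<open>y\<close> and its image to
          vanish.\<close>
        have "\<mu>1 \<noteq> 0 \<or> (?z 0 = 0 \<and> ?z 1 = 0)"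
        proof (rule ccontr)
          assume "\<not> ?thesis"
          then have 1: "\<mu>1 = 0" and z: "\<not> (?z 0 = 0 \<and> ?z 1 = 0)" by auto
          have u0: "u $ 0 = 0" "u $ 1 = 0" "u $ 2 = 0" "u $ 3 = 0" using m0 m1 True 1 by auto
          have kill: "(a 0 * k 0 + a 1 * k 1) * ?z i = 0" if a: "a 2 = 0" "a 3 = 0" and i: "i < 3"
            for a :: "nat \<Rightarrow> 'k" and i
          proof -
            have "R * pair_mat c a * P \<in> base_pencil d" unfolding base[symmetric] using base_c[of a] a by blast
            then obtain b where b: "b 2 = 0" "b 3 = 0" "R * pair_mat c a * P = pair_mat d b"
              unfolding base_pencil_eq by blast
            have "pair_mat d b *\<^sub>v u = 0\<^sub>v 3" unfolding pair_mat_mult_zero_iff[OF u] using b u0 by simp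
            then have "R *\<^sub>v (pair_mat c a *\<^sub>v g) = 0\<^sub>v 3"
              using sandwich_mult_vec[OF car(1) pair_mat_carrier car(3) u, of c a] b(3) Pu by simp
            then have "pair_mat c a *\<^sub>v g = 0\<^sub>v 3"
              using mat_injD[OF injR(1) car(1) mult_mat_vec_carrier[OF pair_mat_carrier g]] by simp
            then have k0: "\<forall>j<3. (a 0 * k 0 + a 1 * k 1) * y j = 0"
              using gy[OF a] by (metis index_zero_vec(1))
            have "(a 0 * k 0 + a 1 * k 1) * ?z i =
              r i 0 * ((a 0 * k 0 + a 1 * k 1) * y 0) + r i 1 * ((a 0 * k 0 + a 1 * k 1) * y 1) + r i 2 * ((a 0 * k 0 + a 1 * k 1) * y 2)"
              by (simp add: lin3_def algebra_simps)
            also have "\<dots> = 0"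
              using k0 unfolding ball_less_3 by (simp only: mult_zero_right add_0_left)
            finally show ?thesis .
          qed
          show False
            using kill[of "unit_fun 0" 0] kill[of "unit_fun 1" 0] kill[of "unit_fun 0" 1] kill[of "unit_fun 1" 1] k z
            by (auto simp: unit_fun_def)
        qed
        then show ?thesis using e True d by auto
      qed
    }
    {
      assume on: "(y 1)\<^sup>2 = y 0 * y 2"
      let ?w = "lin3 (\<lambda>i j. r j i) y"
      \<comment> \<open>For \<open>y\<close> on the conic the symmetric matrix of the degenerate
        pairing has a kernel vector (p, q). Placed in the last two coordinates, it lies in the
        common kernel of the standard pencil, and \<open>y\<close> vanishes on its images under all
        arrows.\<close>
      obtain p q where pq: "p \<noteq> 0 \<or> q \<noteq> 0" "y 0 * p + y 1 * q = 0" "y 1 * p + y 2 * q = 0"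
      proof (cases "y 0 = 0")
        case True
        then have "y 1 = 0" using on by simp
        then show thesis using True that[of 1 0] by simp
      next
        case False
        show thesis
          by (rule that[of "- y 1" "y 0"]) (use False on in \<open>auto simp: power2_eq_square mult_ac\<close>)
      qed
      let ?u = "vec 6 (\<lambda>i. if i = 4 then p else if i = 5 then q else 0)"
      have u: "?u \<in> carrier_vec 6" by simp
      define v where "v = P *\<^sub>v ?u"
      have v: "v \<in> carrier_vec 6" using car by (simp add: v_def)
      have "?u \<noteq> 0\<^sub>v 6"
      proof
        assume z: "?u = 0\<^sub>v 6"
        have "?u $ 4 = 0" "?u $ 5 = 0" unfolding z by simp_all
        then show False using pq(1) by simp
      qed
      then have v0: "v \<noteq> 0\<^sub>v 6" using mat_injD[OF injR(2) car(3) u] by (auto simp: v_def)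
      have base0: "pair_mat c a *\<^sub>v v = 0\<^sub>v 3" if a: "a 2 = 0" "a 3 = 0" for a :: "nat \<Rightarrow> 'k"
      proof -
        have "R * pair_mat c a * P \<in> base_pencil d" unfolding base[symmetric] using base_c[of a] a by blast
        then obtain b where b: "b 2 = 0" "b 3 = 0" "R * pair_mat c a * P = pair_mat d b"
          unfolding base_pencil_eq by blast
        have "pair_mat d b *\<^sub>v ?u = 0\<^sub>v 3" unfolding pair_mat_mult_zero_iff[OF u] using b by simp
        then have "R *\<^sub>v (pair_mat c a *\<^sub>v v) = 0\<^sub>v 3"
          using sandwich_mult_vec[OF car(1) pair_mat_carrier car(3) u, of c a] b(3) by (simp add: v_def)
        then show ?thesis
          using mat_injD[OF injR(1) car(1) mult_mat_vec_carrier[OF pair_mat_carrier v]] by simp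
      qed
      have vz: "v $ 0 = 0" "v $ 1 = 0" "v $ 2 = 0" "v $ 3 = 0"
        using base0[of "unit_fun 0"] base0[of "unit_fun 1"] c(1)
        unfolding pair_mat_mult_zero_iff[OF v] by (auto simp: unit_fun_def)
      then have v45: "v $ 4 \<noteq> 0 \<or> v $ 5 \<noteq> 0" using v0 vec_6_eq_zero[OF v] by blast
      have dot: "?w 0 * (pair_mat c a *\<^sub>v v) $ 0 + ?w 1 * (pair_mat c a *\<^sub>v v) $ 1 + ?w 2 * (pair_mat c a *\<^sub>v v) $ 2 = 0" for a
      proof -
        define x where "x = pair_mat c a *\<^sub>v v"
        have x: "x \<in> carrier_vec 3" using mult_mat_vec_carrier[OF pair_mat_carrier v] by (simp add: x_def)
        have "R * pair_mat c a * P \<in> range (pair_mat d)" unfolding all[symmetric] by blast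
        then obtain b where b: "R * pair_mat c a * P = pair_mat d b" by blast
        have Rx: "R *\<^sub>v x = pair_mat d b *\<^sub>v ?u"
          using sandwich_mult_vec[OF car(1) pair_mat_carrier car(3) u, of c a] b by (simp add: v_def x_def)
        have "y 0 * (pair_mat d b *\<^sub>v ?u) $ 0 + y 1 * (pair_mat d b *\<^sub>v ?u) $ 1 + y 2 * (pair_mat d b *\<^sub>v ?u) $ 2
          = b 2 * (y 0 * p + y 1 * q) + b 3 * (y 1 * p + y 2 * q)"
          unfolding pair_mat_mult[OF u] by (simp add: algebra_simps)
        then have "y 0 * (R *\<^sub>v x) $ 0 + y 1 * (R *\<^sub>v x) $ 1 + y 2 * (R *\<^sub>v x) $ 2 = 0"
          unfolding Rx using pq by simp
        then have "?w 0 * x $ 0 + ?w 1 * x $ 1 + ?w 2 * x $ 2 = 0"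
          using mult_vec_lin3[OF car(1) x, of 0] mult_vec_lin3[OF car(1) x, of 1] mult_vec_lin3[OF car(1) x, of 2]
          by (simp add: lin3_def r_def algebra_simps del: index_mult_mat_vec)
        then show ?thesis by (simp only: x_def)
      qed
      have w: "?w 0 * v $ 4 + ?w 1 * v $ 5 = 0" "?w 1 * v $ 4 + ?w 2 * v $ 5 = 0"
        using dot[of "unit_fun 2"] dot[of "unit_fun 3"] vz unfolding pair_mat_mult[OF v]
        by (simp_all add: unit_fun_def)
      show "(?w 1)\<^sup>2 = ?w 0 * ?w 2" by (rule symmetric_kernel_det[OF w v45])
    }
  qed
qed

section \<open>Finiteness of the special pencils\<close>

lemma finite_power_eq:
  fixes k :: "'k::field"
  assumes "k \<noteq> 0" "0 < n"
  shows "finite {x. k * x ^ n = m}"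
proof -
  have "coeff (monom k n - [:m:]) n = k" using assms by (cases n) auto
  then have "monom k n - [:m:] \<noteq> 0" using assms(1) by (metis coeff_0)
  then have "finite {x. poly (monom k n - [:m:]) x = 0}" by (rule poly_roots_finite)
  then show ?thesis by (simp add: poly_monom)
qed

text \<open>The matrices \<open>pair_mat c a\<close> for \<open>a\<close> in the span of \<open>(\<beta>, \<delta>, 1, 0)\<close> and \<open>(\<alpha>, \<gamma>, 0, 1)\<close> have a
  common kernel; the hypothesis that it meets every hyperplane \<open>f = 0\<close> says that its dimension is at
  least two.\<close>

lemma special_pencil_parameters:
  fixes c :: "'k::field"
  assumes c: "c \<noteq> 0" "c\<^sup>2 \<noteq> 1"
    and ker: "\<And>f :: nat \<Rightarrow> 'k. \<exists>g :: nat \<Rightarrow> 'k.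
      \<not> (g 0 = 0 \<and> g 1 = 0 \<and> g 2 = 0 \<and> g 3 = 0 \<and> g 4 = 0 \<and> g 5 = 0) \<and>
      \<beta> * g 0 + \<delta> * g 1 + g 4 = 0 \<and> c * (\<beta> * g 1 + \<delta> * g 2) + g 5 = 0 \<and> g 0 + \<beta> * g 2 + \<delta> * g 3 = 0 \<and>
      \<alpha> * g 0 + \<gamma> * g 1 + g 3 = 0 \<and> c * (\<alpha> * g 1 + \<gamma> * g 2) + g 4 = 0 \<and> \<alpha> * g 2 + \<gamma> * g 3 + g 5 = 0 \<and>
      f 0 * g 0 + f 1 * g 1 + f 2 * g 2 = 0"
  shows "\<exists>y. (y = 0 \<or> y ^ 3 = - (c ^ 3)) \<and>
    (\<alpha> = 0 \<or> c\<^sup>2 * \<alpha>\<^sup>2 = 1 + c\<^sup>2 - c \<or> c\<^sup>2 * \<alpha>\<^sup>2 = - (1 + c\<^sup>2 + c) \<or> c * \<alpha>\<^sup>2 = 1 \<or> 1 * \<alpha>\<^sup>2 = c) \<and>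
    \<delta> \<in> {0, \<alpha>, - \<alpha>, inverse \<alpha>} \<and> \<beta> = y * (1 - \<alpha> * \<delta>) \<and> \<gamma> = - (y\<^sup>2 / c) * (1 - \<alpha> * \<delta>)"
proof -
  \<comment> \<open>A kernel vector is determined by \<open>g 0\<close>, \<open>g 1\<close>,
    \<open>g 2\<close>. After elimination of \<open>g 3\<close>, the third equation has the
    coefficient \<open>e\<close> at \<open>g 0\<close>, so for \<open>e \<noteq> 0\<close> the
    values \<open>g 1\<close> and \<open>g 2\<close> alone suffice.\<close>
  define e where "e = 1 - \<alpha> * \<delta>"
  define sol where "sol g \<longleftrightarrow>
      g 3 = - (\<alpha> * g 0) - \<gamma> * g 1 \<and> e * g 0 = \<delta> * \<gamma> * g 1 - \<beta> * g 2 \<and>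
      \<beta> * g 0 + (\<delta> - c * \<alpha>) * g 1 - c * \<gamma> * g 2 = 0 \<and>
      c * \<beta> * g 1 + (c * \<delta> - \<alpha>) * g 2 - \<gamma> * g 3 = 0 \<and>
      \<not> (g 0 = 0 \<and> g 1 = 0 \<and> g 2 = 0)" for g :: "nat \<Rightarrow> 'k"
  have ker': "\<exists>g. sol g \<and> f 0 * g 0 + f 1 * g 1 + f 2 * g 2 = 0" for f :: "nat \<Rightarrow> 'k"
  proof -
    obtain g :: "nat \<Rightarrow> 'k" where nz: "\<not> (g 0 = 0 \<and> g 1 = 0 \<and> g 2 = 0 \<and> g 3 = 0 \<and> g 4 = 0 \<and> g 5 = 0)"
      and q: "\<beta> * g 0 + \<delta> * g 1 + g 4 = 0" "c * (\<beta> * g 1 + \<delta> * g 2) + g 5 = 0" "g 0 + \<beta> * g 2 + \<delta> * g 3 = 0"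
        "\<alpha> * g 0 + \<gamma> * g 1 + g 3 = 0" "c * (\<alpha> * g 1 + \<gamma> * g 2) + g 4 = 0" "\<alpha> * g 2 + \<gamma> * g 3 + g 5 = 0"
      and f: "f 0 * g 0 + f 1 * g 1 + f 2 * g 2 = 0"
      using ker[of f] by (elim exE conjE) (rule that; assumption)
    have g3: "g 3 = - (\<alpha> * g 0) - \<gamma> * g 1" using q(4) by (simp add: eq_neg_iff_add_eq_0 algebra_simps)
    have g4: "g 4 = - (\<beta> * g 0) - \<delta> * g 1" using q(1) by (simp add: eq_neg_iff_add_eq_0 algebra_simps)
    have g5: "g 5 = - (\<alpha> * g 2) - \<gamma> * g 3" using q(6) by (simp add: eq_neg_iff_add_eq_0 algebra_simps)
    have "e * g 0 = \<delta> * \<gamma> * g 1 - \<beta> * g 2"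
      using q(3) unfolding g3 e_def by (simp add: algebra_simps eq_neg_iff_add_eq_0)
    moreover have "\<beta> * g 0 + (\<delta> - c * \<alpha>) * g 1 - c * \<gamma> * g 2 = 0"
      using q(5) unfolding g4 by (simp add: algebra_simps eq_neg_iff_add_eq_0)
    moreover have "c * \<beta> * g 1 + (c * \<delta> - \<alpha>) * g 2 - \<gamma> * g 3 = 0"
      using q(2) unfolding g5 by (simp add: algebra_simps)
    moreover have "\<not> (g 0 = 0 \<and> g 1 = 0 \<and> g 2 = 0)"
    proof
      assume z: "g 0 = 0 \<and> g 1 = 0 \<and> g 2 = 0"
      then have "g 3 = 0" using g3 by simp
      then have "g 4 = 0" "g 5 = 0" using g4 g5 z by simp_all
      then show False using nz z \<open>g 3 = 0\<close> by blast
    qed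
    ultimately show ?thesis using g3 f unfolding sol_def by blast
  qed
  show ?thesis
  proof (cases "e = 0")
    case True
    then have ad: "\<alpha> * \<delta> = 1" by (simp add: e_def)
    then have nz: "\<alpha> \<noteq> 0" "\<delta> \<noteq> 0" by auto
    have \<delta>: "\<delta> = inverse \<alpha>" using ad nz by (simp add: field_simps)
    have b: "\<beta> = 0"
    proof (rule ccontr)
      assume b: "\<beta> \<noteq> 0"
      obtain g where g: "sol g" "g 1 = 0" using ker'[of "unit_fun 1"] by (auto simp: unit_fun_def)
      then have "g 2 = 0" using True b unfolding sol_def by auto
      then show False using g b unfolding sol_def by auto
    qed
    have ga: "\<gamma> = 0"
    proof (rule ccontr)
      assume ga: "\<gamma> \<noteq> 0"
      obtain g where g: "sol g" "g 0 = 0" using ker'[of "unit_fun 0"] by (auto simp: unit_fun_def)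
      then have "g 1 = 0" using True ga nz b unfolding sol_def by auto
      then show False using g ga c unfolding sol_def by auto
    qed
    obtain g where g: "sol g" "g 0 = 0" using ker'[of "unit_fun 0"] by (auto simp: unit_fun_def)
    then have "\<delta> = c * \<alpha> \<or> c * \<delta> = \<alpha>" using b ga unfolding sol_def by auto
    then have "c * \<alpha>\<^sup>2 = 1 \<or> \<alpha>\<^sup>2 = c"
    proof
      assume d: "\<delta> = c * \<alpha>"
      have "c * \<alpha>\<^sup>2 = \<alpha> * \<delta>" unfolding d by (simp add: power2_eq_square mult_ac)
      then show ?thesis using ad by simp
    next
      assume d: "c * \<delta> = \<alpha>"
      have "\<alpha>\<^sup>2 = \<alpha> * (c * \<delta>)" unfolding d by (simp add: power2_eq_square)
      also have "\<dots> = c * (\<alpha> * \<delta>)" by (simp add: mult_ac)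
      finally show ?thesis using ad by simp
    qed
    then show ?thesis using b ga \<delta> by (intro exI[of _ 0]) auto
  next
    case False
    \<comment> \<open>The kernel has dimension at least two and is determined by \<open>g 1\<close>
      and \<open>g 2\<close>. So it contains vectors with one of these zero and the other non-zero,
      and each of the two choices yields two polynomial relations between the parameters.\<close>
    obtain g where g: "sol g" "g 1 = 0" using ker'[of "unit_fun 1"] by (auto simp: unit_fun_def)
    have g2: "g 2 \<noteq> 0" using g False unfolding sol_def by auto
    have g0: "e * g 0 = - (\<beta> * g 2)" and g3: "g 3 = - (\<alpha> * g 0)"
      and C: "\<beta> * g 0 = c * \<gamma> * g 2" and D: "(c * \<delta> - \<alpha>) * g 2 = \<gamma> * g 3"
      using g unfolding sol_def by auto
    have "g 2 * (\<beta> * \<beta>) = \<beta> * (\<beta> * g 2)" by (simp add: mult_ac)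
    also have "\<dots> = - (e * (\<beta> * g 0))" using g0 by (simp add: mult_ac)
    also have "\<dots> = g 2 * - (e * c * \<gamma>)" unfolding C by (simp add: mult_ac)
    finally have bb: "\<beta> * \<beta> = - (e * c * \<gamma>)"
      by (rule mult_left_cancel[OF g2, THEN iffD1])
    have "g 2 * (e * (c * \<delta> - \<alpha>)) = e * ((c * \<delta> - \<alpha>) * g 2)" by (simp add: mult_ac)
    also have "\<dots> = - (\<gamma> * \<alpha> * (e * g 0))" unfolding D g3 by (simp add: mult_ac)
    also have "\<dots> = g 2 * (\<alpha> * \<beta> * \<gamma>)" unfolding g0 by (simp add: mult_ac)
    finally have cd: "e * (c * \<delta> - \<alpha>) = \<alpha> * \<beta> * \<gamma>" using g2 by simp
    obtain h where h: "sol h" "h 2 = 0" using ker'[of "unit_fun 2"] by (auto simp: unit_fun_def)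
    have h1: "h 1 \<noteq> 0" using h False unfolding sol_def by auto
    have h0: "e * h 0 = \<delta> * \<gamma> * h 1" and h3: "h 3 = - (\<alpha> * h 0) - \<gamma> * h 1"
      and C': "\<beta> * h 0 + (\<delta> - c * \<alpha>) * h 1 = 0" and D': "c * \<beta> * h 1 = \<gamma> * h 3"
      using h unfolding sol_def by auto
    have "h 1 * (\<beta> * \<gamma> * \<delta> + e * (\<delta> - c * \<alpha>)) = \<beta> * (e * h 0) + e * ((\<delta> - c * \<alpha>) * h 1)"
      unfolding h0 by (simp add: algebra_simps)
    also have "\<dots> = e * (\<beta> * h 0 + (\<delta> - c * \<alpha>) * h 1)" by (simp add: algebra_simps)
    finally have dc: "\<beta> * \<gamma> * \<delta> + e * (\<delta> - c * \<alpha>) = 0" using h1 unfolding C' by simp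
    have eh3: "e * h 3 = - (\<gamma> * h 1)"
    proof -
      have "e * h 3 = - (\<alpha> * (e * h 0)) - e * \<gamma> * h 1" unfolding h3 by (simp add: algebra_simps)
      also have "\<dots> = - (\<gamma> * h 1)" unfolding h0 by (simp add: e_def algebra_simps)
      finally show ?thesis .
    qed
    have "h 1 * (e * c * \<beta>) = e * (c * \<beta> * h 1)" by (simp add: mult_ac)
    also have "\<dots> = \<gamma> * (e * h 3)" unfolding D' by (simp add: mult_ac)
    also have "\<dots> = h 1 * - (\<gamma> * \<gamma>)" unfolding eh3 by (simp add: mult_ac)
    finally have gg: "e * c * \<beta> = - (\<gamma> * \<gamma>)"
      by (rule mult_left_cancel[OF h1, THEN iffD1])
    \<comment> \<open>In terms of \<open>y\<close> the relations \<open>bb\<close> and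
      \<open>gg\<close> become c \<gamma> = - y^2 e and y (c^3 + y^3) = 0, which leaves finitely
      many values of \<open>y\<close>.\<close>
    define y where "y = \<beta> / e"
    have b_y: "\<beta> = y * e" using False by (simp add: y_def)
    have "e * (c * \<gamma>) = e * (- (y\<^sup>2 * e))"
      using bb unfolding b_y by (simp add: power2_eq_square mult_ac eq_neg_iff_add_eq_0 add.commute)
    then have "c * \<gamma> = - (y\<^sup>2 * e)" by (rule mult_left_cancel[OF False, THEN iffD1])
    then have gy: "\<gamma> = - (y\<^sup>2 / c) * e" using c by (simp add: field_simps)
    have "c * c * (e * c * (y * e)) = - ((c * \<gamma>) * (c * \<gamma>))" using gg by (simp add: b_y mult_ac)
    also have "\<dots> = - (y * y ^ 3 * e * e)"
      unfolding \<open>c * \<gamma> = - (y\<^sup>2 * e)\<close> by (simp add: power2_eq_square power3_eq_cube mult_ac)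
    finally have "(e * e) * (y * (c ^ 3)) = (e * e) * (y * - (y ^ 3))" by (simp add: power3_eq_cube mult_ac)
    then have "y * (c ^ 3) = y * - (y ^ 3)"
      by (rule mult_left_cancel[THEN iffD1, rotated]) (use False in simp)
    then have yc: "y = 0 \<or> c ^ 3 = - (y ^ 3)" by (metis mult_left_cancel)
    have "\<alpha> = 0 \<and> \<delta> = 0 \<or> \<alpha> = \<delta> \<and> c\<^sup>2 * \<alpha>\<^sup>2 = 1 + c\<^sup>2 - c \<or> \<delta> = - \<alpha> \<and> c\<^sup>2 * \<alpha>\<^sup>2 = - (1 + c\<^sup>2 + c)"
    proof (cases "y = 0")
      case True
      then have "\<beta> = 0" "\<gamma> = 0" using b_y gy by auto
      then have "\<delta> = c * \<alpha>" "c * \<delta> = \<alpha>" using dc cd False by auto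
      then have "(c\<^sup>2 - 1) * \<alpha> = 0" by (simp add: power2_eq_square algebra_simps)
      then show ?thesis using c \<open>\<delta> = c * \<alpha>\<close> by auto
    next
      case y: False
      have "c * (\<beta> * \<gamma>) = y * e * (c * \<gamma>)" unfolding b_y by (simp add: mult_ac)
      also have "\<dots> = e * e * - (y ^ 3)"
        unfolding \<open>c * \<gamma> = - (y\<^sup>2 * e)\<close> by (simp add: power2_eq_square power3_eq_cube mult_ac)
      also have "\<dots> = e * e * c ^ 3" using yc y by simp
      finally have "c * (\<beta> * \<gamma>) = c * (c\<^sup>2 * e * e)" by (simp add: power2_eq_square power3_eq_cube mult_ac)
      then have bg: "\<beta> * \<gamma> = c\<^sup>2 * e * e" using c by simp
      \<comment> \<open>With \<open>bg\<close> the relations \<open>dc\<close> and \<open>cd\<close>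
        turn into \<delta> m = c \<alpha> and c \<delta> = \<alpha> m. For \<alpha> \<noteq> 0 this
        forces m^2 = c^2, and each sign of \<open>m\<close> gives one quadratic equation for
        \<alpha>.\<close>
      define m where "m = 1 + c\<^sup>2 * e"
      have "e * (\<delta> * m) = e * (c * \<alpha>)"
        using dc unfolding bg m_def by (simp add: algebra_simps)
      then have m1: "\<delta> * m = c * \<alpha>" using False by simp
      have "e * (c * \<delta>) = e * (\<alpha> * m)"
        using cd bg unfolding m_def by (simp add: algebra_simps)
      then have m2: "c * \<delta> = \<alpha> * m" using False by simp
      show ?thesis
      proof (cases "\<alpha> = 0")
        case True
        then show ?thesis using m2 c by simp
      next
        case a: False
        have "\<alpha> * (m * m) = (c * \<delta>) * m" unfolding m2 by (simp add: mult_ac)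
        also have "\<dots> = c * (\<delta> * m)" by (simp add: mult_ac)
        also have "\<dots> = \<alpha> * (c * c)" unfolding m1 by (simp add: mult_ac)
        finally have "m * m = c * c" using a by simp
        then have "(m - c) * (m + c) = 0" by (simp add: algebra_simps)
        then have "m = c \<or> m = - c" by (auto simp: eq_neg_iff_add_eq_0)
        then show ?thesis
        proof
          assume m: "m = c"
          then have "\<delta> = \<alpha>" using m2 c by (simp add: mult.commute)
          then show ?thesis using m by (simp add: m_def e_def algebra_simps power2_eq_square)
        next
          assume m: "m = - c"
          then have "c * \<delta> = c * - \<alpha>" using m2 by (simp add: mult.commute)
          then have d: "\<delta> = - \<alpha>" by (rule mult_left_cancel[OF c(1), THEN iffD1])
          have "1 + c\<^sup>2 * (1 + \<alpha>\<^sup>2) = - c" using m by (simp add: m_def e_def d power2_eq_square)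
          then have "c\<^sup>2 * \<alpha>\<^sup>2 = - c - 1 - c\<^sup>2" by (simp add: algebra_simps)
          then show ?thesis using d by simp
        qed
      qed
    qed
    then show ?thesis using yc b_y gy by (intro exI[of _ y]) (auto simp: e_def)
  qed
qed

section \<open>A finite list containing all special pencils\<close>

definition vec4 :: "'k \<Rightarrow> 'k \<Rightarrow> 'k \<Rightarrow> 'k \<Rightarrow> nat \<Rightarrow> 'k" where
  "vec4 a b d e i = [a, b, d, e] ! i"

lemma vec4_simps [simp]: "vec4 a b d e 0 = a" "vec4 a b d e (Suc 0) = b" "vec4 a b d e 1 = b"
  "vec4 a b d e 2 = d" "vec4 a b d e 3 = e"
  by (simp_all add: vec4_def)

definition special_pencil :: "'k::field \<Rightarrow> 'k \<Rightarrow> 'k \<Rightarrow> 'k \<Rightarrow> 'k mat set" where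
  "special_pencil c y \<alpha> \<delta> =
     pencil c (vec4 (y * (1 - \<alpha> * \<delta>)) \<delta> 1 0) (vec4 \<alpha> (- (y\<^sup>2 / c) * (1 - \<alpha> * \<delta>)) 0 1)"

text \<open>Only an upper bound: all combinations of the possible parameter values are listed. The
  factors 1 give each set the shape required by \<open>finite_power_eq\<close>.\<close>

definition special_pencils :: "'k::field \<Rightarrow> 'k mat set set" where
  "special_pencils c = insert (base_pencil c) (\<Union>y\<in>insert 0 {y. 1 * y ^ 3 = - (c ^ 3)}.
     \<Union>\<alpha>\<in>insert 0 ({\<alpha>. c\<^sup>2 * \<alpha>\<^sup>2 = 1 + c\<^sup>2 - c} \<union> {\<alpha>. c\<^sup>2 * \<alpha>\<^sup>2 = - (1 + c\<^sup>2 + c)} \<union> {\<alpha>. c * \<alpha>\<^sup>2 = 1} \<union> {\<alpha>. 1 * \<alpha>\<^sup>2 = c}).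
     special_pencil c y \<alpha> ` {0, \<alpha>, - \<alpha>, inverse \<alpha>})"

lemma finite_special_pencils:
  assumes "c \<noteq> 0"
  shows "finite (special_pencils c)"
  unfolding special_pencils_def
  by (intro finite.insertI finite_UN_I finite_UnI finite_imageI finite.emptyI finite_power_eq)
    (use assms in auto)

lemma pair_mat_lin:
  fixes v :: "'k::field vec"
  assumes v: "v \<in> carrier_vec 6"
  shows "pair_mat c (\<lambda>i. s * a i + t * b i) *\<^sub>v v = s \<cdot>\<^sub>v (pair_mat c a *\<^sub>v v) + t \<cdot>\<^sub>v (pair_mat c b *\<^sub>v v)"
    (is "?l = ?r")
proof -
  have d: "dim_row (pair_mat c x) = 3" for x using carrier_matD(1)[OF pair_mat_carrier] .
  have "\<forall>i<3. ?l $ i = s * (pair_mat c a *\<^sub>v v) $ i + t * (pair_mat c b *\<^sub>v v) $ i"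
    unfolding ball_less_3 pair_mat_mult[OF v] by (simp add: algebra_simps)
  then have "?l $ i = ?r $ i" if "i < 3" for i
    using that d by (simp del: index_mult_mat_vec)
  then show ?thesis using d by (intro eq_vecI) (auto simp del: index_mult_mat_vec)
qed

lemma pencil_subset:
  assumes "\<And>i. i < 4 \<Longrightarrow> u' i = p * u i + q * v i" "\<And>i. i < 4 \<Longrightarrow> v' i = p' * u i + q' * v i"
  shows "pencil c u' v' \<subseteq> pencil c u (v :: nat \<Rightarrow> 'k::field)"
proof
  fix X assume "X \<in> pencil c u' v'"
  then obtain s t where X: "X = pair_mat c (\<lambda>i. s * u' i + t * v' i)" unfolding pencil_def by blast
  have "X = pair_mat c (\<lambda>i. (s * p + t * p') * u i + (s * q + t * q') * v i)"
    unfolding X by (rule pair_mat_cong) (simp_all add: assms algebra_simps)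
  then show "X \<in> pencil c u v" unfolding pencil_def by blast
qed

text \<open>The standard pencil kills the last two coordinates, so its image \<open>X\<close> has a
  common kernel of dimension at least two. If \<open>X\<close> projects onto the coordinates 2 and 3
  of the arrow space (\<open>D \<noteq> 0\<close>), it has the normal form of
  \<open>special_pencil_parameters\<close>. Otherwise it meets the standard pencil, and then it
  equals it.\<close>

lemma pencil_equiv_special:
  fixes c d :: "'k::field"
  assumes d: "d \<noteq> 0" "d\<^sup>2 \<noteq> 1" and eqv: "pencil_equiv c d X"
  shows "X \<in> special_pencils d"
proof -
  obtain R R' P P' where car: "R \<in> carrier_mat 3 3" "R' \<in> carrier_mat 3 3" "P \<in> carrier_mat 6 6" "P' \<in> carrier_mat 6 6"
    and inv: "R * R' = 1\<^sub>m 3" "R' * R = 1\<^sub>m 3" "P * P' = 1\<^sub>m 6" "P' * P = 1\<^sub>m 6"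
    and all: "(\<lambda>M. R * M * P) ` range (pair_mat c) = range (pair_mat d)"
    and base: "(\<lambda>M. R * M * P) ` base_pencil c = X"
    using eqv unfolding pencil_equiv_def by blast
  have ex: "\<exists>b. R * pair_mat c a * P = pair_mat d b" for a
  proof -
    have "R * pair_mat c a * P \<in> range (pair_mat d)" unfolding all[symmetric] by blast
    then show ?thesis by blast
  qed
  obtain u where u: "R * pair_mat c (unit_fun 0) * P = pair_mat d u" using ex by blast
  obtain v where v: "R * pair_mat c (unit_fun 1) * P = pair_mat d v" using ex by blast
  have lin: "R * pair_mat c (\<lambda>i. s * unit_fun 0 i + t * unit_fun 1 i) * P = pair_mat d (\<lambda>i. s * u i + t * v i)" for s t
  proof (rule eq_mat_by_vecI[of _ 3 6])
    fix x :: "'k vec" assume x: "x \<in> carrier_vec 6"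
    have Px: "P *\<^sub>v x \<in> carrier_vec 6" using car x by simp
    have c3: "pair_mat c a *\<^sub>v (P *\<^sub>v x) \<in> carrier_vec 3" for a by (rule mult_mat_vec_carrier[OF pair_mat_carrier Px])
    have "(R * pair_mat c (\<lambda>i. s * unit_fun 0 i + t * unit_fun 1 i) * P) *\<^sub>v x =
      R *\<^sub>v (s \<cdot>\<^sub>v (pair_mat c (unit_fun 0) *\<^sub>v (P *\<^sub>v x)) + t \<cdot>\<^sub>v (pair_mat c (unit_fun 1) *\<^sub>v (P *\<^sub>v x)))"
      unfolding sandwich_mult_vec[OF car(1) pair_mat_carrier car(3) x] pair_mat_lin[OF Px] ..
    also have "\<dots> = s \<cdot>\<^sub>v (R *\<^sub>v (pair_mat c (unit_fun 0) *\<^sub>v (P *\<^sub>v x))) + t \<cdot>\<^sub>v (R *\<^sub>v (pair_mat c (unit_fun 1) *\<^sub>v (P *\<^sub>v x)))"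
      using mult_add_distrib_mat_vec[OF car(1)] mult_mat_vec[OF car(1)] c3 by simp
    also have "\<dots> = pair_mat d (\<lambda>i. s * u i + t * v i) *\<^sub>v x"
      unfolding pair_mat_lin[OF x] u[symmetric] v[symmetric]
        sandwich_mult_vec[OF car(1) pair_mat_carrier car(3) x] ..
    finally show "(R * pair_mat c (\<lambda>i. s * unit_fun 0 i + t * unit_fun 1 i) * P) *\<^sub>v x =
      pair_mat d (\<lambda>i. s * u i + t * v i) *\<^sub>v x" .
  next
    show "R * pair_mat c (\<lambda>i. s * unit_fun 0 i + t * unit_fun 1 i) * P \<in> carrier_mat 3 6"
      using car pair_mat_carrier by (metis mult_carrier_mat)
  qed simp
  have X: "X = pencil d u v"
  proof -
    have "X = {R * pair_mat c (\<lambda>i. s * unit_fun 0 i + t * unit_fun 1 i) * P | s t. True}"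
      unfolding base[symmetric] base_pencil_def pencil_def by blast
    then show ?thesis unfolding lin pencil_def .
  qed
  have indep: "s = 0 \<and> t = 0" if z: "\<And>i. i < 4 \<Longrightarrow> s * u i + t * v i = 0" for s t
  proof -
    let ?M = "pair_mat c (\<lambda>i. s * unit_fun 0 i + t * unit_fun 1 i)"
    have "?M *\<^sub>v x = 0\<^sub>v 3" if x: "x \<in> carrier_vec 6" for x
    proof -
      have P'x: "P' *\<^sub>v x \<in> carrier_vec 6" using car x by simp
      have "P *\<^sub>v (P' *\<^sub>v x) = x" using assoc_mult_mat_vec[OF car(3,4) x] inv x by simp
      then have "R *\<^sub>v (?M *\<^sub>v x) = pair_mat d (\<lambda>i. s * u i + t * v i) *\<^sub>v (P' *\<^sub>v x)"
        using sandwich_mult_vec[OF car(1) pair_mat_carrier car(3) P'x] lin by metis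
      also have "\<dots> = 0\<^sub>v 3" unfolding pair_mat_mult_zero_iff[OF P'x] using z by simp
      finally show ?thesis
        using mat_injD[OF mat_inj_if_left_inverse[OF car(1,2) inv(2)] car(1) mult_mat_vec_carrier[OF pair_mat_carrier x]] by simp
    qed
    from this[of "unit_vec 6 0"] this[of "unit_vec 6 1"] show ?thesis
      by (simp add: pair_mat_mult_zero_iff unit_fun_def)
  qed
  have ker: "\<exists>g\<in>carrier_vec 6. g \<noteq> 0\<^sub>v 6 \<and> (\<forall>s t. pair_mat d (\<lambda>i. s * u i + t * v i) *\<^sub>v g = 0\<^sub>v 3) \<and>
      f 0 * g $ 0 + f 1 * g $ 1 + f 2 * g $ 2 + f 3 * g $ 3 = 0" for f :: "nat \<Rightarrow> 'k"
  proof -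
    \<comment> \<open>Five conditions on six unknowns: the first four coordinates of
      \<open>x\<close> vanish, so that \<open>x\<close> lies in the common kernel of the source
      pencil, and \<open>f\<close> vanishes on \<open>P' x\<close>, the corresponding kernel vector
      of the target.\<close>
    define Z where "Z = mat 5 6 (\<lambda>(i, j). if i < 4 then (if i = j then 1 else 0) else
      f 0 * P' $$ (0, j) + f 1 * P' $$ (1, j) + f 2 * P' $$ (2, j) + f 3 * P' $$ (3, j))"
    have Z: "Z \<in> carrier_mat 5 6" by (simp add: Z_def)
    obtain x where x: "x \<in> carrier_vec 6" "x \<noteq> 0\<^sub>v 6" "Z *\<^sub>v x = 0\<^sub>v 5"
      using exists_kernel_vec[OF Z] by auto
    have Zx: "(Z *\<^sub>v x) $ i = 0" if "i < 5" for i using x(3) that by simp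
    have "(Z *\<^sub>v x) $ i = x $ i" if i: "i < 4" for i
    proof -
      have "row Z i = unit_vec 6 i" using i by (intro eq_vecI) (auto simp: Z_def)
      then show ?thesis using i x(1) by (simp add: Z_def)
    qed
    then have x0: "x $ i = 0" if "i < 4" for i using Zx[of i] that by simp
    have xz: "x $ 0 = 0" "x $ 1 = 0" "x $ 2 = 0" "x $ 3 = 0" using x0 by simp_all
    define g where "g = P' *\<^sub>v x"
    have g: "g \<in> carrier_vec 6" using car x by (simp add: g_def)
    have Pg: "P *\<^sub>v g = x" using assoc_mult_mat_vec[OF car(3,4) x(1)] inv x by (simp add: g_def)
    have "g \<noteq> 0\<^sub>v 6" using Pg x(2) mult_zero_vec[OF car(3)] by auto
    moreover have "pair_mat d (\<lambda>i. s * u i + t * v i) *\<^sub>v g = 0\<^sub>v 3" for s t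
    proof -
      have "pair_mat c (\<lambda>i. s * unit_fun 0 i + t * unit_fun 1 i) *\<^sub>v x = 0\<^sub>v 3"
        unfolding pair_mat_mult_zero_iff[OF x(1)] using xz by (simp add: unit_fun_def)
      then show ?thesis
        unfolding lin[symmetric] sandwich_mult_vec[OF car(1) pair_mat_carrier car(3) g] Pg
        using mult_zero_vec[OF car(1)] by simp
    qed
    moreover have "f 0 * g $ 0 + f 1 * g $ 1 + f 2 * g $ 2 + f 3 * g $ 3 = 0"
    proof -
      have "f 0 * g $ 0 + f 1 * g $ 1 + f 2 * g $ 2 + f 3 * g $ 3 = (Z *\<^sub>v x) $ 4"
        using car x(1) by (simp add: g_def Z_def scalar_prod_def sum_0_6 algebra_simps)
      then show ?thesis using Zx[of 4] by simp
    qed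
    ultimately show ?thesis using g by blast
  qed
  define D where "D = u 2 * v 3 - u 3 * v 2"
  show ?thesis
  proof (cases "D = 0")
    case False
    \<comment> \<open>The inverse of the 2 by 2 matrix of the coordinates 2 and 3 normalizes these
      coordinates to (1, 0) and (0, 1).\<close>
    define u' where "u' i = (v 3 / D) * u i + (- u 3 / D) * v i" for i
    define v' where "v' i = (- v 2 / D) * u i + (u 2 / D) * v i" for i
    have n: "u' 2 = 1" "u' 3 = 0" "v' 2 = 0" "v' 3 = 1"
    proof -
      have "u' 2 = (u 2 * v 3 - u 3 * v 2) / D" "v' 3 = (u 2 * v 3 - u 3 * v 2) / D"
        by (simp_all add: u'_def v'_def diff_divide_distrib mult.commute)
      then show "u' 2 = 1" "v' 3 = 1" using False unfolding D_def[symmetric] by simp_all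
    qed (simp_all add: u'_def v'_def mult.commute)
    have uv: "u i = u 2 * u' i + u 3 * v' i" "v i = v 2 * u' i + v 3 * v' i" for i
    proof -
      have "u 2 * u' i + u 3 * v' i = ((u 2 * v 3 - u 3 * v 2) / D) * u i"
        by (simp add: u'_def v'_def diff_divide_distrib algebra_simps)
      then show "u i = u 2 * u' i + u 3 * v' i" using False unfolding D_def[symmetric] by simp
      have "v 2 * u' i + v 3 * v' i = ((u 2 * v 3 - u 3 * v 2) / D) * v i"
        by (simp add: u'_def v'_def diff_divide_distrib algebra_simps)
      then show "v i = v 2 * u' i + v 3 * v' i" using False unfolding D_def[symmetric] by simp
    qed
    let ?\<beta> = "u' 0" and ?\<delta> = "u' 1" and ?\<alpha> = "v' 0" and ?\<gamma> = "v' 1"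
    have "X = pencil d u' v'"
      unfolding X
    proof
      show "pencil d u v \<subseteq> pencil d u' v'" by (rule pencil_subset) (rule uv)+
      show "pencil d u' v' \<subseteq> pencil d u v"
        by (rule pencil_subset[of _ "v 3 / D" _ "- u 3 / D" _ _ "- v 2 / D" "u 2 / D"])
          (simp_all only: u'_def v'_def)
    qed
    also have "\<dots> = pencil d (vec4 ?\<beta> ?\<delta> 1 0) (vec4 ?\<alpha> ?\<gamma> 0 1)"
    proof -
      have "pair_mat d (\<lambda>i. s * u' i + t * v' i) = pair_mat d (\<lambda>i. s * vec4 ?\<beta> ?\<delta> 1 0 i + t * vec4 ?\<alpha> ?\<gamma> 0 1 i)" for s t
        by (rule pair_mat_cong) (simp_all add: n)
      then show ?thesis unfolding pencil_def by simp
    qed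
    finally have X': "X = pencil d (vec4 ?\<beta> ?\<delta> 1 0) (vec4 ?\<alpha> ?\<gamma> 0 1)" .
    have "\<exists>g :: nat \<Rightarrow> 'k.
      \<not> (g 0 = 0 \<and> g 1 = 0 \<and> g 2 = 0 \<and> g 3 = 0 \<and> g 4 = 0 \<and> g 5 = 0) \<and>
      ?\<beta> * g 0 + ?\<delta> * g 1 + g 4 = 0 \<and> d * (?\<beta> * g 1 + ?\<delta> * g 2) + g 5 = 0 \<and> g 0 + ?\<beta> * g 2 + ?\<delta> * g 3 = 0 \<and>
      ?\<alpha> * g 0 + ?\<gamma> * g 1 + g 3 = 0 \<and> d * (?\<alpha> * g 1 + ?\<gamma> * g 2) + g 4 = 0 \<and> ?\<alpha> * g 2 + ?\<gamma> * g 3 + g 5 = 0 \<and>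
      f 0 * g 0 + f 1 * g 1 + f 2 * g 2 = 0" for f :: "nat \<Rightarrow> 'k"
    proof -
      obtain g where g: "g \<in> carrier_vec 6" "g \<noteq> 0\<^sub>v 6"
        and k: "\<And>s t. pair_mat d (\<lambda>i. s * u i + t * v i) *\<^sub>v g = 0\<^sub>v 3"
        and f: "f 0 * g $ 0 + f 1 * g $ 1 + f 2 * g $ 2 = 0"
        using ker[of "f(3 := 0)"] by auto
      have ku: "pair_mat d u' *\<^sub>v g = 0\<^sub>v 3" and kv: "pair_mat d v' *\<^sub>v g = 0\<^sub>v 3"
        using k unfolding u'_def v'_def by blast+
      show ?thesis
        using ku kv f g vec_6_eq_zero[OF g(1)] unfolding pair_mat_mult_zero_iff[OF g(1)] n
        by (intro exI[of _ "\<lambda>i. g $ i"]) auto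
    qed
    from special_pencil_parameters[OF d this]
    obtain y where y: "y = 0 \<or> y ^ 3 = - (d ^ 3)"
      and \<alpha>: "?\<alpha> = 0 \<or> d\<^sup>2 * ?\<alpha>\<^sup>2 = 1 + d\<^sup>2 - d \<or> d\<^sup>2 * ?\<alpha>\<^sup>2 = - (1 + d\<^sup>2 + d) \<or> d * ?\<alpha>\<^sup>2 = 1 \<or> 1 * ?\<alpha>\<^sup>2 = d"
      and \<delta>: "?\<delta> \<in> {0, ?\<alpha>, - ?\<alpha>, inverse ?\<alpha>}"
      and \<beta>: "?\<beta> = y * (1 - ?\<alpha> * ?\<delta>)" and \<gamma>: "?\<gamma> = - (y\<^sup>2 / d) * (1 - ?\<alpha> * ?\<delta>)"
      by (elim exE conjE) (rule that; assumption)
    have "X = special_pencil d y ?\<alpha> ?\<delta>"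
      unfolding X' special_pencil_def \<beta>[symmetric] \<gamma>[symmetric] ..
    then have mem: "X \<in> special_pencil d y ?\<alpha> ` {0, ?\<alpha>, - ?\<alpha>, inverse ?\<alpha>}" using \<delta> by (rule image_eqI)
    have y_mem: "y \<in> insert 0 {y. 1 * y ^ 3 = - (d ^ 3)}" using y by simp
    have \<alpha>_mem: "?\<alpha> \<in> insert 0 ({\<alpha>. d\<^sup>2 * \<alpha>\<^sup>2 = 1 + d\<^sup>2 - d} \<union> {\<alpha>. d\<^sup>2 * \<alpha>\<^sup>2 = - (1 + d\<^sup>2 + d)} \<union>
        {\<alpha>. d * \<alpha>\<^sup>2 = 1} \<union> {\<alpha>. 1 * \<alpha>\<^sup>2 = d})"
      using \<alpha> by blast
    show ?thesis
      unfolding special_pencils_def by (rule insertI2, rule UN_I, rule y_mem, rule UN_I, rule \<alpha>_mem, rule mem)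
  next
    case True
    obtain s t where st: "s \<noteq> 0 \<or> t \<noteq> 0" "s * u 2 + t * v 2 = 0" "s * u 3 + t * v 3 = 0"
    proof -
      consider "v 2 \<noteq> 0 \<or> u 2 \<noteq> 0" | "v 3 \<noteq> 0 \<or> u 3 \<noteq> 0" | "u 2 = 0" "v 2 = 0" "u 3 = 0" "v 3 = 0" by blast
      then show thesis
      proof cases
        case 1
        then show thesis using that[of "v 2" "- u 2"] True by (auto simp: D_def algebra_simps)
      next
        case 2
        then show thesis using that[of "v 3" "- u 3"] True by (auto simp: D_def algebra_simps)
      next
        case 3
        then show thesis using that[of 1 0] by simp
      qed
    qed
    define b where "b i = s * u i + t * v i" for i
    have b23: "b 2 = 0" "b 3 = 0" using st by (simp_all add: b_def)
    have b01: "b 0 \<noteq> 0 \<or> b 1 \<noteq> 0"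
    proof (rule ccontr)
      assume "\<not> ?thesis"
      then have "b i = 0" if "i < 4" for i using b23 that by (auto simp: numeral_eq_Suc less_Suc_eq)
      then show False using indep[of s t] st(1) by (auto simp: b_def)
    qed
    \<comment> \<open>The three kernel equations of \<open>b\<close> form a chain in
      \<open>g 0\<close>, ..., \<open>g 3\<close>. It collapses once \<open>g 0\<close> is zero, or
      \<open>g 3\<close> in case \<open>b 1 = 0\<close>. An element with a non-zero coordinate 2 or
      3 then also kills the last two coordinates of the chosen kernel vector.\<close>
    have flat: "a 2 = 0 \<and> a 3 = 0" if a: "a = u \<or> a = v" for a
    proof (rule ccontr)
      assume a23: "\<not> (a 2 = 0 \<and> a 3 = 0)"
      obtain g where g: "g \<in> carrier_vec 6" "g \<noteq> 0\<^sub>v 6"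
        and k: "\<And>s t. pair_mat d (\<lambda>i. s * u i + t * v i) *\<^sub>v g = 0\<^sub>v 3"
        and f: "g $ (if b 1 = 0 then 3 else 0) = 0"
        using ker[of "unit_fun (if b 1 = 0 then 3 else 0)"] by (auto simp: unit_fun_def split: if_splits)
      have "pair_mat d b *\<^sub>v g = 0\<^sub>v 3" using k[of s t] by (simp add: b_def[abs_def])
      then have "g $ 0 = 0 \<and> g $ 1 = 0 \<and> g $ 2 = 0 \<and> g $ 3 = 0"
        unfolding pair_mat_mult_zero_iff[OF g(1)] using b23 b01 f d by (auto split: if_splits)
      moreover have "pair_mat d a *\<^sub>v g = 0\<^sub>v 3" using a k[of 1 0] k[of 0 1] by auto
      ultimately have "g $ 4 = 0 \<and> g $ 5 = 0" "g $ 0 = 0 \<and> g $ 1 = 0 \<and> g $ 2 = 0 \<and> g $ 3 = 0"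
        unfolding pair_mat_mult_zero_iff[OF g(1)] using a23 by auto
      then show False using g vec_6_eq_zero[OF g(1)] by blast
    qed
    have f0: "u 2 = 0" "u 3 = 0" "v 2 = 0" "v 3 = 0" using flat by auto
    define \<Delta> where "\<Delta> = u 0 * v 1 - u 1 * v 0"
    have D: "\<Delta> \<noteq> 0"
    proof
      assume z: "\<Delta> = 0"
      have four: "i = 0 \<or> i = 1 \<or> i = 2 \<or> i = 3" if "i < 4" for i :: nat using that by auto
      have "v 1 = 0 \<and> - u 1 = 0"
      proof (rule indep)
        show "v 1 * u i + - u 1 * v i = 0" if "i < 4" for i
          using four[OF that] z f0 by (elim disjE) (simp_all add: \<Delta>_def mult.commute)
      qed
      moreover have "v 0 = 0 \<and> - u 0 = 0"
      proof (rule indep)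
        show "v 0 * u i + - u 0 * v i = 0" if "i < 4" for i
          using four[OF that] z f0 by (elim disjE) (simp_all add: \<Delta>_def mult.commute)
      qed
      ultimately have zero: "u 0 = 0" "u 1 = 0" by auto
      have "(1 :: 'k) = 0 \<and> (0 :: 'k) = 0"
      proof (rule indep)
        show "1 * u i + 0 * v i = 0" if "i < 4" for i
          using four[OF that] zero f0 by (elim disjE) simp_all
      qed
      then show False by simp
    qed
    have "X = base_pencil d"
    proof
      show "X \<subseteq> base_pencil d" unfolding X pencil_def base_pencil_eq using f0 by auto
      show "base_pencil d \<subseteq> X"
      proof
        fix Y assume "Y \<in> base_pencil d"
        then obtain a where a: "a 2 = 0" "a 3 = 0" "Y = pair_mat d a" unfolding base_pencil_eq by blast
        define p q where "p = (a 0 * v 1 - a 1 * v 0) / \<Delta>" and "q = (u 0 * a 1 - u 1 * a 0) / \<Delta>"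
        have "p * u 0 + q * v 0 = ((u 0 * v 1 - u 1 * v 0) / \<Delta>) * a 0"
          "p * u 1 + q * v 1 = ((u 0 * v 1 - u 1 * v 0) / \<Delta>) * a 1"
          by (simp_all add: p_def q_def diff_divide_distrib algebra_simps)
        then have "p * u 0 + q * v 0 = a 0" "p * u 1 + q * v 1 = a 1"
          using D unfolding \<Delta>_def[symmetric] by simp_all
        then have "Y = pair_mat d (\<lambda>i. p * u i + q * v i)"
          unfolding a(3) using D a f0 by (intro pair_mat_cong) auto
        then show "Y \<in> X" unfolding X pencil_def by blast
      qed
    qed
    then show ?thesis unfolding special_pencils_def by simp
  qed
qed

section \<open>Composition of equivalences and the count for four arrows\<close>

lemma base_pencil_carrier: "base_pencil c \<subseteq> carrier_mat 3 6"
  unfolding base_pencil_def pencil_def by auto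

text \<open>The first equivalence is followed by the inverse of the second; both the target span and
  the pencil \<open>X\<close> cancel in the middle.\<close>

lemma pencil_equiv_compose:
  fixes a b d :: "'k::field"
  assumes "pencil_equiv a d X" "pencil_equiv b d X"
  shows "pencil_equiv a b (base_pencil b)"
proof -
  obtain R R' P P' where c: "R \<in> carrier_mat 3 3" "R' \<in> carrier_mat 3 3" "P \<in> carrier_mat 6 6" "P' \<in> carrier_mat 6 6"
    and i: "R * R' = 1\<^sub>m 3" "R' * R = 1\<^sub>m 3" "P * P' = 1\<^sub>m 6" "P' * P = 1\<^sub>m 6"
    and all: "(\<lambda>M. R * M * P) ` range (pair_mat a) = range (pair_mat d)"
    and base: "(\<lambda>M. R * M * P) ` base_pencil a = X"
    using assms(1) unfolding pencil_equiv_def by blast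
  obtain S S' Q Q' where c': "S \<in> carrier_mat 3 3" "S' \<in> carrier_mat 3 3" "Q \<in> carrier_mat 6 6" "Q' \<in> carrier_mat 6 6"
    and i': "S * S' = 1\<^sub>m 3" "S' * S = 1\<^sub>m 3" "Q * Q' = 1\<^sub>m 6" "Q' * Q = 1\<^sub>m 6"
    and all': "(\<lambda>M. S * M * Q) ` range (pair_mat b) = range (pair_mat d)"
    and base': "(\<lambda>M. S * M * Q) ` base_pencil b = X"
    using assms(2) unfolding pencil_equiv_def by blast
  have img: "(\<lambda>M. (S' * R) * M * (P * Q')) ` Y = Z"
    if "Y \<subseteq> carrier_mat 3 6" "Z \<subseteq> carrier_mat 3 6" "(\<lambda>M. R * M * P) ` Y = (\<lambda>M. S * M * Q) ` Z" for Y Z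
  proof -
    have "(\<lambda>M. (S' * R) * M * (P * Q')) ` Y = (\<lambda>M. S' * M * Q') ` (\<lambda>M. R * M * P) ` Y"
      unfolding image_image using mult_sandwich[of _ 3 6 R P S' Q'] c c' that(1) by (intro image_cong) auto
    also have "\<dots> = (\<lambda>M. S' * (S * M * Q) * Q') ` Z" unfolding that(3) by (simp add: image_image)
    also have "\<dots> = (\<lambda>M. M) ` Z"
    proof (rule image_cong)
      fix M assume "M \<in> Z"
      then have "M \<in> carrier_mat 3 6" using that(2) by blast
      then show "S' * (S * M * Q) * Q' = M" using mult_sandwich[of M 3 6 S Q S' Q'] c' i' by simp
    qed simp
    finally show ?thesis by simp
  qed
  have rng: "range (pair_mat x) \<subseteq> carrier_mat 3 6" for x :: 'k by auto
  have "(\<lambda>M. (S' * R) * M * (P * Q')) ` range (pair_mat a) = range (pair_mat b)"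
    "(\<lambda>M. (S' * R) * M * (P * Q')) ` base_pencil a = base_pencil b"
    using img[OF rng rng] img[OF base_pencil_carrier base_pencil_carrier] all all' base base' by simp_all
  moreover have "(S' * R) * (R' * S) = 1\<^sub>m 3" "(R' * S) * (S' * R) = 1\<^sub>m 3"
    "(P * Q') * (Q * P') = 1\<^sub>m 6" "(Q * P') * (P * Q') = 1\<^sub>m 6"
    using c c' i i' by (intro mult_right_inverses; simp)+
  moreover have "S' * R \<in> carrier_mat 3 3" "R' * S \<in> carrier_mat 3 3"
    "P * Q' \<in> carrier_mat 6 6" "Q * P' \<in> carrier_mat 6 6"
    using c c' by auto
  ultimately show ?thesis unfolding pencil_equiv_def by blast
qed

lemma infinitely_many_orbits_4:
  "\<exists>S :: 'k::alg_closed_field kron_rep set. infinite S \<and>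
    (\<forall>E\<in>S. elementary 4 E \<and> dim_vector E = (6, 3)) \<and>
    (\<forall>E\<in>S. \<forall>F\<in>S. E \<noteq> F \<longrightarrow> \<not> rep_iso 4 E F) \<and> inj_on (GL_orbit 4) S"
proof (rule infinitely_many_orbits[where E = pair_rep])
  \<comment> \<open>The values with c^2 = 1 are removed for \<open>elementary_pair\<close>, those
    with c^2 = 4 for \<open>pencil_rigidity\<close>.\<close>
  let ?C = "{c :: 'k. c \<noteq> 0 \<and> c\<^sup>2 \<noteq> 1 \<and> c\<^sup>2 \<noteq> 4}"
  have "- ?C \<subseteq> insert 0 ({c. 1 * c\<^sup>2 = 1} \<union> {c. 1 * c\<^sup>2 = 4})" by auto
  moreover have "finite (insert 0 ({c :: 'k. 1 * c\<^sup>2 = 1} \<union> {c. 1 * c\<^sup>2 = 4}))"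
    using finite_power_eq[of "1 :: 'k" 2] by simp
  ultimately have fin: "finite (- ?C)" by (rule finite_subset)
  show "infinite ?C"
  proof
    assume "finite ?C"
    then have "finite (?C \<union> - ?C)" using fin by (rule finite_UnI)
    then show False using infinite_alg_closed_field[where 'k = 'k] by (simp only: Compl_partition)
  qed
  fix c assume c: "c \<in> ?C"
  then show "elementary 4 (pair_rep c)" by (intro elementary_pair) auto
  show "finite {c' \<in> ?C. mat_space_equiv 3 6 (arrow_span 4 (pair_rep c')) (arrow_span 4 (pair_rep c))}"
  proof (rule finite_subset)
    show "{c' \<in> ?C. mat_space_equiv 3 6 (arrow_span 4 (pair_rep c')) (arrow_span 4 (pair_rep c))}
      \<subseteq> (\<Union>X\<in>special_pencils c. {c' \<in> ?C. pencil_equiv c' c X})"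
    proof
      fix c' assume "c' \<in> {c' \<in> ?C. mat_space_equiv 3 6 (arrow_span 4 (pair_rep c')) (arrow_span 4 (pair_rep c))}"
      then have c': "c' \<in> ?C" and "mat_space_equiv 3 6 (range (pair_mat c')) (range (pair_mat c))"
        by (auto simp: arrow_span_pair)
      then have "\<exists>X. pencil_equiv c' c X" unfolding mat_space_equiv_def pencil_equiv_def by blast
      then obtain X where X: "pencil_equiv c' c X" by blast
      then have "X \<in> special_pencils c" using c by (intro pencil_equiv_special) auto
      then show "c' \<in> (\<Union>X\<in>special_pencils c. {c' \<in> ?C. pencil_equiv c' c X})" using c' X by blast
    qed
    \<comment> \<open>Any two parameters reaching the same \<open>X\<close> are linked by an
      equivalence that matches their standard pencils, so their squares agree.\<close>
    have "finite {c' \<in> ?C. pencil_equiv c' c X}" for X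
    proof (cases "{c' \<in> ?C. pencil_equiv c' c X} = {}")
      case False
      then obtain a where a: "a \<in> ?C" "pencil_equiv a c X" by blast
      have "{c' \<in> ?C. pencil_equiv c' c X} \<subseteq> {x. 1 * x\<^sup>2 = a\<^sup>2}"
        using pencil_rigidity[OF _ _ _ pencil_equiv_compose[OF _ a(2)]] a(1) by auto
      then show ?thesis using finite_power_eq[of 1 2 "a\<^sup>2"] finite_subset by auto
    next
      case True
      then show ?thesis by (simp only: finite.emptyI)
    qed
    then show "finite (\<Union>X\<in>special_pencils c. {c' \<in> ?C. pencil_equiv c' c X})"
      using finite_special_pencils c by auto
  qed
qed auto

theorem theorem2:
  fixes r :: nat
  assumes "r \<ge> 4"
  shows "\<exists>(x, y) \<in> \<F> r. \<exists>S :: 'k::alg_closed_field kron_rep set.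
    infinite S \<and>
    (\<forall>E\<in>S. elementary r E \<and> dim_vector E = (x, y)) \<and>
    (\<forall>E\<in>S. \<forall>F\<in>S. E \<noteq> F \<longrightarrow> \<not> rep_iso r E F) \<and>
    inj_on (GL_orbit r) S"
proof (cases "r = 4")
  case True
  \<comment> \<open>For four arrows 2 x / r equals 3 at x = 6, so this vector lies on the lower
    boundary of the region.\<close>
  have "(6, 3) \<in> \<F> r" using True by (simp add: \<F>_def)
  moreover note infinitely_many_orbits_4[where 'k = 'k]
  ultimately show ?thesis unfolding True by blast
next
  case False
  then have r: "5 \<le> r" using assms by simp
  then have "(3, 3) \<in> \<F> r" by (simp add: \<F>_def field_simps)
  moreover note infinitely_many_orbits_ge_5[OF r, where 'k = 'k]
  ultimately show ?thesis by blast
qed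

end
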